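(* Let $|F|\in L^1_{\mathrm{loc}}(\Omega_T)$ and assume that $u\in L^1_{\mathrm{loc}}(0,T;W^{1,1}_{\mathrm{loc}}(\Omega;\mathbb{R}^N))$ satisfies $$\iint_{\Omega_T}\bigl(-u\cdot\varphi_t+\mathcal{A}(z,\nabla u)\cdot\nabla\varphi\bigr)\,dz=\iint_{\Omega_T}F\cdot\nabla\varphi\,dz$$ for every $\varphi\in C_0^\infty(\Omega_T;\mathbb{R}^N)$. Then there exists a constant $c=c(n,L)$ such that $$\frac{|u(x,t)-u(x,s)|}{|t-s|^{\frac12}}\le c\bigl(M^*g(x,t)+M^*g(x,s)\bigr),\qquad g=(|\nabla u|+|F|)1_{2Q},$$ for every parabolic cylinder $Q=Q_\rho=B\times I$ such that $2Q\Subset\Omega_T$ and almost every $x\in B$ and $t,s\in I$.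
   Context: $\Omega\subset\mathbb{R}^n$, $n\ge1$, is a bounded open domain, $T>0$, $\Omega_T=\Omega\times(0,T)$, $N\ge1$, $0<\nu<L<\infty$. $\mathcal{A}:\Omega_T\times\mathbb{R}^{Nn}\to\mathbb{R}^{Nn}$ is a Carathéodory vector field ($\mathcal{A}(\cdot,\xi)$ measurable for every $\xi$, $\mathcal{A}(z,\cdot)$ continuous for a.e. $z$) with $\nu|\xi|^2\le\mathcal{A}(z,\xi)\cdot\xi$ and $|\mathcal{A}(z,\xi)|\le L|\xi|$ for a.e. $z\in\Omega_T$ and every $\xi\in\mathbb{R}^{Nn}$. $F:\Omega_T\to\mathbb{R}^{Nn}$ is measurable. We write $z=(x,t)$, $dz=dx\,dt$, and $\nabla$ is the gradient in $x$. $u\in L^1_{\mathrm{loc}}(0,T;W^{1,1}_{\mathrm{loc}}(\Omega;\mathbb{R}^N))$ means that for all $\Omega'\Subset\Omega$ and $0<t_1<t_2<T$ one has $u(\cdot,t)\in W^{1,1}(\Omega';\mathbb{R}^N)$ for a.e. $t\in(t_1,t_2)$ and $\int_{t_1}^{t_2}\int_{\Omega'}(|u|+|\nabla u|)\,dx\,dt<\infty$. Parabolic cylinders: $Q_\rho=B\times I$ with $B=B_\rho(x_0)$, $I=(t_0-\rho^2,t_0+\rho^2)$, and $2Q_\rho=B_{2\rho}(x_0)\times(t_0-(2\rho)^2,t_0+(2\rho)^2)$. $2Q\Subset\Omega_T$ means that the closure of $2Q$ is a compact subset of $\Omega_T$. The function $g$ is extended by zero outside $2Q$. The strong maximal function of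 $f\in L^1_{\mathrm{loc}}(\mathbb{R}^{n+1})$ is $M^*f(z)=\sup\frac1{|B'\times I'|}\iint_{B'\times I'}|f|\,d\zeta$, the supremum taken over all cylinders $B'\times I'\ni z$ with $B'\subset\mathbb{R}^n$ an open ball and $I'\subset\mathbb{R}$ a bounded open interval (radius and length independent of each other). *)

theory Defs
  imports "HOL-Analysis.Analysis"
begin

text \<open>
  The space dimension \<open>n\<close> is the cardinality of the index type \<open>'n\<close>; a space-time point is
  \<open>z = (x, t) :: (real^'n) \<times> real\<close>.

  The number \<open>N\<close> of components is a natural number rather than a type, because the constant in the
  theorem must not depend on it. A vector in \<open>\<real>\<^sup>N\<close> is a function \<open>v :: nat \<Rightarrow> real\<close> vanishing at
  all indices \<open>i \<ge> N\<close>, and an element of \<open>\<real>\<^sup>N\<^sup>n\<close> is a function \<open>\<xi> :: nat \<Rightarrow> real^'n\<close> vanishing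
  at all \<open>i \<ge> N\<close>, where \<open>\<xi> i\<close> is the \<open>i\<close>-th row. Both are covered by \<open>tuples N\<close>. On this set the
  product topology of the function type agrees with the Euclidean topology.
\<close>

definition tuples :: "nat \<Rightarrow> (nat \<Rightarrow> 'b::zero) set" where
  "tuples N = {v. \<forall>i\<ge>N. v i = 0}"

definition tnorm :: "nat \<Rightarrow> (nat \<Rightarrow> 'b::real_normed_vector) \<Rightarrow> real" where
  "tnorm N v = L2_set (\<lambda>i. norm (v i)) {..<N}"

definition tinner :: "nat \<Rightarrow> (nat \<Rightarrow> 'b::real_inner) \<Rightarrow> (nat \<Rightarrow> 'b) \<Rightarrow> real" where
  "tinner N v w = (\<Sum>i<N. v i \<bullet> w i)"

definition compactly_in :: "'a::topological_space set \<Rightarrow> 'a set \<Rightarrow> bool" where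
  "compactly_in U V \<longleftrightarrow> compact (closure U) \<and> closure U \<subseteq> V"

definition space_time :: "'a set \<Rightarrow> real \<Rightarrow> ('a \<times> real) set" where
  "space_time \<Omega> T = \<Omega> \<times> {0<..<T}"

definition par_cylinder :: "'a::metric_space \<Rightarrow> real \<Rightarrow> real \<Rightarrow> ('a \<times> real) set" where
  "par_cylinder x0 t0 \<rho> = ball x0 \<rho> \<times> {t0 - \<rho>\<^sup>2<..<t0 + \<rho>\<^sup>2}"


text \<open>\<open>C_k k f\<close>: \<open>f\<close> has continuous partial derivatives up to order \<open>k\<close> on the whole space.\<close>

primrec C_k :: "nat \<Rightarrow> ('a::euclidean_space \<Rightarrow> real) \<Rightarrow> bool" where
  "C_k 0 f \<longleftrightarrow> continuous_on UNIV f"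
| "C_k (Suc k) f \<longleftrightarrow> (\<forall>x. f differentiable (at x)) \<and>
     (\<forall>b\<in>Basis. C_k k (\<lambda>x. frechet_derivative f (at x) b))"

text \<open>The space \<open>C\<^sub>0\<^sup>\<infinity>(U)\<close>; its members are taken to be extended by zero to the whole space.\<close>

definition test_functions :: "'a::euclidean_space set \<Rightarrow> ('a \<Rightarrow> real) set" where
  "test_functions U = {\<psi>. (\<forall>k. C_k k \<psi>) \<and> compactly_in {x. \<psi> x \<noteq> 0} U}"

definition test_maps :: "nat \<Rightarrow> 'a::euclidean_space set \<Rightarrow> ('a \<Rightarrow> nat \<Rightarrow> real) set" where
  "test_maps N U = {\<phi>. (\<forall>z. \<phi> z \<in> tuples N) \<and> (\<forall>i<N. (\<lambda>z. \<phi> z i) \<in> test_functions U)}"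

definition grad :: "(real^'n \<Rightarrow> real) \<Rightarrow> real^'n \<Rightarrow> real^'n" where
  "grad \<psi> x = (\<chi> j. frechet_derivative \<psi> (at x) (axis j 1))"

definition space_grad :: "((real^'n) \<times> real \<Rightarrow> nat \<Rightarrow> real) \<Rightarrow> (real^'n) \<times> real \<Rightarrow> nat \<Rightarrow> real^'n" where
  "space_grad \<phi> z i = grad (\<lambda>x. \<phi> (x, snd z) i) (fst z)"

definition time_deriv :: "('a \<times> real \<Rightarrow> nat \<Rightarrow> real) \<Rightarrow> 'a \<times> real \<Rightarrow> nat \<Rightarrow> real" where
  "time_deriv \<phi> z i = deriv (\<lambda>t. \<phi> (fst z, t) i) (snd z)"


text \<open>\<open>f\<close> belongs to \<open>W\<^sup>1\<^sup>,\<^sup>1(U; \<real>\<^sup>N)\<close> and \<open>G\<close> is (a version of) its weak gradient.\<close>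

definition W11_with_grad ::
    "nat \<Rightarrow> (real^'n) set \<Rightarrow> (real^'n \<Rightarrow> nat \<Rightarrow> real) \<Rightarrow> (real^'n \<Rightarrow> nat \<Rightarrow> real^'n) \<Rightarrow> bool" where
  "W11_with_grad N U f G \<longleftrightarrow> (\<forall>i<N.
     set_integrable lebesgue U (\<lambda>x. f x i) \<and>
     set_integrable lebesgue U (\<lambda>x. G x i) \<and>
     (\<forall>\<psi>\<in>test_functions U.
        (LINT x:U|lebesgue. f x i *\<^sub>R grad \<psi> x) = - (LINT x:U|lebesgue. \<psi> x *\<^sub>R G x i)))"

text \<open>
  \<open>u\<close> belongs to \<open>L\<^sup>1\<^sub>l\<^sub>o\<^sub>c(0,T; W\<^sup>1\<^sup>,\<^sup>1\<^sub>l\<^sub>o\<^sub>c(\<Omega>; \<real>\<^sup>N))\<close> and \<open>Du\<close> is (a version of) its spatial gradient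
  \<open>\<nabla>u\<close>. Such a \<open>Du\<close> is determined by \<open>u\<close> up to a null set of \<open>\<Omega> \<times> (0,T)\<close>.
\<close>

definition L1loc_W11loc_with_grad ::
    "nat \<Rightarrow> (real^'n) set \<Rightarrow> real \<Rightarrow> ((real^'n) \<times> real \<Rightarrow> nat \<Rightarrow> real)
      \<Rightarrow> ((real^'n) \<times> real \<Rightarrow> nat \<Rightarrow> real^'n) \<Rightarrow> bool" where
  "L1loc_W11loc_with_grad N \<Omega> T u Du \<longleftrightarrow>
     (\<forall>z\<in>space_time \<Omega> T. u z \<in> tuples N \<and> Du z \<in> tuples N) \<and>
     (\<forall>i<N. (\<lambda>z. u z i) \<in> borel_measurable (lebesgue_on (space_time \<Omega> T)) \<and>
            (\<lambda>z. Du z i) \<in> borel_measurable (lebesgue_on (space_time \<Omega> T))) \<and>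
     (\<forall>U t1 t2. open U \<and> compactly_in U \<Omega> \<and> 0 < t1 \<and> t1 < t2 \<and> t2 < T \<longrightarrow>
        (AE t in lebesgue. t \<in> {t1<..<t2} \<longrightarrow>
            W11_with_grad N U (\<lambda>x. u (x, t)) (\<lambda>x. Du (x, t))) \<and>
        set_integrable lebesgue (U \<times> {t1<..<t2}) (\<lambda>z. tnorm N (u z) + tnorm N (Du z)))"

definition caratheodory ::
    "nat \<Rightarrow> 'a::euclidean_space set \<Rightarrow> ('a \<Rightarrow> (nat \<Rightarrow> real^'n) \<Rightarrow> nat \<Rightarrow> real^'n) \<Rightarrow> bool" where
  "caratheodory N S A \<longleftrightarrow>
     (\<forall>z\<in>S. \<forall>\<xi>\<in>tuples N. A z \<xi> \<in> tuples N) \<and>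
     (\<forall>\<xi>\<in>tuples N. \<forall>i<N. (\<lambda>z. A z \<xi> i) \<in> borel_measurable (lebesgue_on S)) \<and>
     (AE z in lebesgue. z \<in> S \<longrightarrow> continuous_on (tuples N) (A z))"

definition structure_conditions ::
    "nat \<Rightarrow> 'a::euclidean_space set \<Rightarrow> real \<Rightarrow> real
      \<Rightarrow> ('a \<Rightarrow> (nat \<Rightarrow> real^'n) \<Rightarrow> nat \<Rightarrow> real^'n) \<Rightarrow> bool" where
  "structure_conditions N S \<nu> L A \<longleftrightarrow>
     (AE z in lebesgue. z \<in> S \<longrightarrow> (\<forall>\<xi>\<in>tuples N.
        \<nu> * (tnorm N \<xi>)\<^sup>2 \<le> tinner N (A z \<xi>) \<xi> \<and> tnorm N (A z \<xi>) \<le> L * tnorm N \<xi>))"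

definition measurable_field ::
    "nat \<Rightarrow> 'a::euclidean_space set \<Rightarrow> ('a \<Rightarrow> nat \<Rightarrow> real^'n) \<Rightarrow> bool" where
  "measurable_field N S F \<longleftrightarrow>
     (\<forall>z\<in>S. F z \<in> tuples N) \<and> (\<forall>i<N. (\<lambda>z. F z i) \<in> borel_measurable (lebesgue_on S))"

definition L1loc :: "'a::euclidean_space set \<Rightarrow> ('a \<Rightarrow> real) \<Rightarrow> bool" where
  "L1loc S f \<longleftrightarrow> (\<forall>K. compact K \<and> K \<subseteq> S \<longrightarrow> set_integrable lebesgue K f)"

definition weak_solution ::
    "nat \<Rightarrow> (real^'n) set \<Rightarrow> real
      \<Rightarrow> ((real^'n) \<times> real \<Rightarrow> (nat \<Rightarrow> real^'n) \<Rightarrow> nat \<Rightarrow> real^'n)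
      \<Rightarrow> ((real^'n) \<times> real \<Rightarrow> nat \<Rightarrow> real^'n)
      \<Rightarrow> ((real^'n) \<times> real \<Rightarrow> nat \<Rightarrow> real) \<Rightarrow> ((real^'n) \<times> real \<Rightarrow> nat \<Rightarrow> real^'n) \<Rightarrow> bool" where
  "weak_solution N \<Omega> T A F u Du \<longleftrightarrow>
     (\<forall>\<phi>\<in>test_maps N (space_time \<Omega> T).
        (LINT z:space_time \<Omega> T|lebesgue.
            - tinner N (u z) (time_deriv \<phi> z) + tinner N (A z (Du z)) (space_grad \<phi> z))
        = (LINT z:space_time \<Omega> T|lebesgue. tinner N (F z) (space_grad \<phi> z)))"

text \<open>The supremum may be infinite, hence the values in \<open>[0,\<infinity>]\<close>.\<close>

definition strong_maximal :: "('a::euclidean_space \<times> real \<Rightarrow> real) \<Rightarrow> 'a \<times> real \<Rightarrow> ennreal" where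
  "strong_maximal f z =
     (SUP C \<in> {ball y r \<times> {a<..<b} | y r a b. z \<in> ball y r \<times> {a<..<b}}.
        (\<integral>\<^sup>+\<zeta>\<in>C. ennreal \<bar>f \<zeta>\<bar> \<partial>lebesgue) / emeasure lebesgue C)"

end

theory Submission
  imports Defs
begin

text \<open>
Let \<open>\<eta>\<^sub>r(w) = r\<^sup>-\<^sup>n \<eta>(w/r)\<close> be a smooth mollifier and let \<open>U\<^sub>r(x,t)\<close> be the average of \<open>u(\<cdot>,t)\<close> against
\<open>\<eta>\<^sub>r(\<cdot> - x)\<close>. With \<open>r\<close> comparable to the square root of \<open>|t - s|\<close>, split
\<open>u(x,t) - u(x,s) = (u - U\<^sub>r)(x,t) + (U\<^sub>r(x,t) - U\<^sub>r(x,s)) + (U\<^sub>r - u)(x,s)\<close>.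

\<^emph>\<open>Space.\<close> The kernel satisfies \<open>\<partial>\<^sub>r \<eta>\<^sub>r(w) = - div (\<eta>\<^sub>r(w) w/r)\<close>, so the definition of the weak gradient
on a time slice bounds \<open>\<partial>\<^sub>r U\<^sub>r(x,t)\<close> by a constant times the average of \<open>|\<nabla>u(\<cdot>,t)|\<close> over \<open>B\<^sub>r(x)\<close>
(\<open>spatial_average_difference\<close>). Summing over dyadic radii gives \<open>|u - U\<^sub>r|(x,t) \<le> C r A\<close>, where \<open>A\<close>
bounds the averages of \<open>g(\<cdot>,t)\<close> over the balls \<open>B\<^sub>\<sigma>(x)\<close> (\<open>space_mean_deviation\<close>). For almost every
\<open>(x,t)\<close> a slice average is a limit of its time mollifications at scale \<open>h\<close>, with \<open>\<sigma>\<close> fixed, and these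
are bounded by averages over \<open>B\<^sub>\<sigma>(x) \<times> (t - h, t + h)\<close>; so \<open>A\<close> is at most a
constant times \<open>M\<^sup>*g(x,t)\<close> (\<open>ball_mean_le\<close>). This is the reason for a maximal function in which radius and length are independent.

\<^emph>\<open>Time.\<close> Testing the equation with \<open>\<eta>\<^sub>r(y - x) \<zeta>(\<tau>)\<close>, where \<open>\<zeta>\<close> is a smooth approximation of the indicator
of \<open>(s,t)\<close>, writes \<open>U\<^sub>r(x,t) - U\<^sub>r(x,s)\<close> as an integral of the flux against \<open>\<nabla>\<eta>\<^sub>r\<close> over
\<open>B\<^sub>r(x) \<times> (s,t)\<close>. As \<open>|\<nabla>\<eta>\<^sub>r| \<le> C r\<^sup>-\<^sup>n\<^sup>-\<^sup>1\<close>, it is at most \<open>C (t - s)/r\<close> times \<open>M\<^sup>*g(x,t)\<close>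
(\<open>weak_solution_tested\<close>, \<open>space_mean_time_difference\<close>). Both contributions have the size of the square
root of \<open>|t - s|\<close> times \<open>M\<^sup>*g\<close> exactly because of the choice of \<open>r\<close>.

\<^emph>\<open>Exceptional sets.\<close> Every limit above is a mollification, in \<open>x\<close> alone or in \<open>t\<close> alone, of an integrable
function on space-time. Mollifications converge in \<open>L\<^sup>1\<close>, hence almost everywhere along a subsequence
(\<open>smear_AE_subseq\<close>); only the countably many radii \<open>\<rho>/2\<^sup>k\<close> are used, so one null set of points \<open>(x,t)\<close>
suffices, and two good points over the same \<open>x\<close> are available for almost every \<open>(x,t,s)\<close>.

\<^emph>\<open>Number of components.\<close> Bounds for \<open>\<real>\<^sup>N\<close>-valued quantities are obtained by pairing with an arbitrary
\<open>a \<in> \<real>\<^sup>N\<close> and choosing \<open>a\<close> at the end (\<open>L2_set_dual\<close>), so that no constant depends on \<open>N\<close>.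
\<close>

section \<open>Approximate identities in \<open>L\<^sup>1\<close>\<close>

lemma integrable_translate:
  fixes f :: "'a::euclidean_space \<Rightarrow> real"
  assumes "integrable lborel f"
  shows "integrable lborel (\<lambda>z. f (z + v))"
proof -
  have [measurable]: "f \<in> borel_measurable borel" using assms by (simp add: borel_measurable_integrable)
  have "integrable (distr lborel borel ((+) v)) f"
    using assms by (simp add: lborel_distr_plus)
  then have "integrable lborel (\<lambda>z. f (v + z))"
    by (subst (asm) integrable_distr_eq) auto
  then show ?thesis by (simp add: add.commute)
qed

lemma integral_translate:
  fixes f :: "'a::euclidean_space \<Rightarrow> real"
  assumes [measurable]: "f \<in> borel_measurable borel"
  shows "(LBINT z. f (z + v)) = (LBINT z. f z)"
proof -
  have "(LBINT z. f z) = (\<integral>z. f z \<partial>distr lborel borel ((+) v))"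
    by (simp add: lborel_distr_plus)
  also have "\<dots> = (LBINT z. f (v + z))"
    by (subst integral_distr) auto
  finally show ?thesis by (simp add: add.commute)
qed

definition L1_shift :: "('a::euclidean_space \<Rightarrow> real) \<Rightarrow> 'a \<Rightarrow> real" where
  "L1_shift f v = (LBINT z. \<bar>f (z + v) - f z\<bar>)"

lemma L1_shift_nonneg: "0 \<le> L1_shift f v"
  by (simp add: L1_shift_def)

lemma L1_shift_bound:
  assumes "integrable lborel f"
  shows "L1_shift f v \<le> 2 * (LBINT z. \<bar>f z\<bar>)"
proof -
  have [measurable]: "f \<in> borel_measurable borel" using assms by (simp add: borel_measurable_integrable)
  note i = integrable_translate[OF assms, of v]
  have "L1_shift f v \<le> (LBINT z. \<bar>f (z + v)\<bar> + \<bar>f z\<bar>)"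
    unfolding L1_shift_def using i assms by (intro integral_mono) auto
  also have "\<dots> = (LBINT z. \<bar>f (z + v)\<bar>) + (LBINT z. \<bar>f z\<bar>)"
    using i assms by simp
  also have "(LBINT z. \<bar>f (z + v)\<bar>) = (LBINT z. \<bar>f z\<bar>)"
    by (rule integral_translate) measurable
  finally show ?thesis by simp
qed

text \<open>
Translation preserves the \<open>L\<^sup>1\<close> norm, so the modulus of continuity is stable under \<open>L\<^sup>1\<close> perturbations;
this reduces continuity of translations to a dense class.
\<close>

lemma L1_shift_diff:
  assumes "integrable lborel f" "integrable lborel g"
  shows "L1_shift f v \<le> L1_shift g v + 2 * (LBINT z. \<bar>f z - g z\<bar>)"
proof -
  have "L1_shift (\<lambda>z. f z - g z) v \<le> 2 * (LBINT z. \<bar>f z - g z\<bar>)"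
    using assms by (intro L1_shift_bound) auto
  moreover have "L1_shift f v \<le> (LBINT z. \<bar>g (z + v) - g z\<bar> + \<bar>(f (z + v) - g (z + v)) - (f z - g z)\<bar>)"
    unfolding L1_shift_def using assms integrable_translate[OF assms(1), of v] integrable_translate[OF assms(2), of v]
    by (intro integral_mono) auto
  moreover have "\<dots> = L1_shift g v + L1_shift (\<lambda>z. f z - g z) v"
    unfolding L1_shift_def using assms integrable_translate[OF assms(1), of v] integrable_translate[OF assms(2), of v]
    by (subst Bochner_Integration.integral_add) auto
  ultimately show ?thesis by linarith
qed

definition L1_cont :: "('a::euclidean_space \<Rightarrow> real) \<Rightarrow> bool" where
  "L1_cont f \<longleftrightarrow> (\<forall>v. v \<longlonglongrightarrow> 0 \<longrightarrow> (\<lambda>j. L1_shift f (v j)) \<longlonglongrightarrow> 0)"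

lemma L1_cont_approx:
  assumes f: "integrable lborel f"
    and g: "\<And>e. e > 0 \<Longrightarrow> \<exists>g. integrable lborel g \<and> L1_cont g \<and> (LBINT z. \<bar>f z - g z\<bar>) < e"
  shows "L1_cont f"
  unfolding L1_cont_def
proof (intro allI impI)
  fix v :: "nat \<Rightarrow> 'a" assume v: "v \<longlonglongrightarrow> 0"
  show "(\<lambda>j. L1_shift f (v j)) \<longlonglongrightarrow> 0"
  proof (rule LIMSEQ_I)
    fix e :: real assume e: "0 < e"
    obtain g where gi: "integrable lborel g" and gc: "L1_cont g" and gd: "(LBINT z. \<bar>f z - g z\<bar>) < e / 4"
      using g[of "e/4"] e by auto
    have "(\<lambda>j. L1_shift g (v j)) \<longlonglongrightarrow> 0" using gc v unfolding L1_cont_def by blast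
    then obtain n0 where n0: "\<And>n. n \<ge> n0 \<Longrightarrow> norm (L1_shift g (v n) - 0) < e / 2"
      using LIMSEQ_D[of _ 0 "e/2"] e by (meson half_gt_zero)
    show "\<exists>no. \<forall>n\<ge>no. norm (L1_shift f (v n) - 0) < e"
    proof (intro exI allI impI)
      fix n assume "n \<ge> n0"
      from n0[OF this] L1_shift_diff[OF f gi, of "v n"] gd L1_shift_nonneg[of f "v n"] L1_shift_nonneg[of g "v n"]
      show "norm (L1_shift f (v n) - 0) < e" by simp
    qed
  qed
qed

lemma L1_cont_scale: "L1_cont f \<Longrightarrow> L1_cont (\<lambda>x. f x * c)"
proof -
  assume a: "L1_cont f"
  have e: "L1_shift (\<lambda>x. f x * c) v = L1_shift f v * \<bar>c\<bar>" for v
    unfolding L1_shift_def by (simp flip: left_diff_distrib add: abs_mult)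
  show ?thesis
    unfolding L1_cont_def e
  proof (intro allI impI)
    fix v :: "nat \<Rightarrow> 'a" assume "v \<longlonglongrightarrow> 0"
    then have "(\<lambda>j. L1_shift f (v j)) \<longlonglongrightarrow> 0" using a unfolding L1_cont_def by blast
    from tendsto_mult_right[OF this, of "\<bar>c\<bar>"] show "(\<lambda>j. L1_shift f (v j) * \<bar>c\<bar>) \<longlonglongrightarrow> 0" by simp
  qed
qed

lemma L1_cont_add:
  assumes f: "integrable lborel f" "L1_cont f" and g: "integrable lborel g" "L1_cont g"
  shows "L1_cont (\<lambda>x. f x + g x)"
  unfolding L1_cont_def
proof (intro allI impI)
  fix v :: "nat \<Rightarrow> 'a" assume v: "v \<longlonglongrightarrow> 0"
  have "(\<lambda>j. L1_shift f (v j) + L1_shift g (v j)) \<longlonglongrightarrow> 0 + 0"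
    using f g v unfolding L1_cont_def by (intro tendsto_add) auto
  then have lim: "(\<lambda>j. L1_shift f (v j) + L1_shift g (v j)) \<longlonglongrightarrow> 0" by simp
  have le: "L1_shift (\<lambda>x. f x + g x) w \<le> L1_shift f w + L1_shift g w" for w
  proof -
    have "L1_shift (\<lambda>x. f x + g x) w \<le> (LBINT z. \<bar>f (z + w) - f z\<bar> + \<bar>g (z + w) - g z\<bar>)"
      unfolding L1_shift_def using f(1) g(1) integrable_translate[OF f(1), of w] integrable_translate[OF g(1), of w]
      by (intro integral_mono) auto
    also have "\<dots> = L1_shift f w + L1_shift g w"
      unfolding L1_shift_def using f(1) g(1) integrable_translate[OF f(1), of w] integrable_translate[OF g(1), of w]
      by (subst Bochner_Integration.integral_add) auto
    finally show ?thesis .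
  qed
  show "(\<lambda>j. L1_shift (\<lambda>x. f x + g x) (v j)) \<longlonglongrightarrow> 0"
    by (rule tendsto_sandwich[OF _ _ tendsto_const lim]) (auto simp: le L1_shift_nonneg)
qed

text \<open>
Translation does not change the integral of the indicator, so the modulus is twice the integral of the
positive part of \<open>1\<^sub>U - 1\<^sub>U(\<cdot> + v)\<close>. As \<open>U\<close> is open, this positive part tends to 0 pointwise, and \<open>1\<^sub>U\<close>
dominates it.
\<close>

lemma L1_cont_open:
  fixes U :: "'a::euclidean_space set"
  assumes U: "open U" "emeasure lborel U < \<infinity>"
  shows "L1_cont (indicator U)"
  unfolding L1_cont_def
proof (intro allI impI)
  fix v :: "nat \<Rightarrow> 'a" assume v: "v \<longlonglongrightarrow> 0"
  have [measurable]: "U \<in> sets borel" using U by simp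
  let ?i = "indicator U :: 'a \<Rightarrow> real"
  have i: "integrable lborel ?i" using U by (intro integrable_real_indicator) auto
  note it = integrable_translate[OF i]
  \<comment> \<open>\<open>|a| = a + 2 max(0, -a)\<close>, and the integral of the first summand is 0.\<close>
  have eq: "L1_shift ?i w = 2 * (LBINT z. max 0 (?i z - ?i (z + w)))" for w
  proof -
    have "L1_shift ?i w = (LBINT z. (?i (z + w) - ?i z) + 2 * max 0 (?i z - ?i (z + w)))"
      unfolding L1_shift_def by (intro Bochner_Integration.integral_cong) (auto simp: indicator_def)
    also have "\<dots> = (LBINT z. ?i (z + w)) - (LBINT z. ?i z) + 2 * (LBINT z. max 0 (?i z - ?i (z + w)))"
      using i it[of w] by (subst Bochner_Integration.integral_add) auto
    also have "(LBINT z. ?i (z + w)) = (LBINT z. ?i z)"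
      by (rule integral_translate) measurable
    finally show ?thesis by simp
  qed
  have "(\<lambda>j. (LBINT z. max 0 (?i z - ?i (z + v j)))) \<longlonglongrightarrow> (\<integral>z. (0::real) \<partial>(lborel::'a measure))"
  proof (rule integral_dominated_convergence[where w = ?i])
    show "AE x in lborel. (\<lambda>j. max 0 (?i x - ?i (x + v j))) \<longlonglongrightarrow> 0"
    proof (rule AE_I2)
      fix x :: 'a
      show "(\<lambda>j. max 0 (?i x - ?i (x + v j))) \<longlonglongrightarrow> 0"
      proof (cases "x \<in> U")
        case True
        have "(\<lambda>j. x + v j) \<longlonglongrightarrow> x" using tendsto_add[OF tendsto_const v, of x] by simp
        then have "\<forall>\<^sub>F j in sequentially. x + v j \<in> U" using U(1) True topological_tendstoD by blast
        then have "\<forall>\<^sub>F j in sequentially. max 0 (?i x - ?i (x + v j)) = 0"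
          by eventually_elim (use True in auto)
        then show ?thesis by (simp add: tendsto_eventually)
      qed auto
    qed
    show "AE x in lborel. norm (max 0 (?i x - ?i (x + v j))) \<le> ?i x" for j
      by (auto simp: indicator_def)
  qed (use i in auto)
  then have "(\<lambda>j. 2 * (LBINT z. max 0 (?i z - ?i (z + v j)))) \<longlonglongrightarrow> 2 * 0"
    by (intro tendsto_mult) auto
  then show "(\<lambda>j. L1_shift ?i (v j)) \<longlonglongrightarrow> 0" by (simp add: eq)
qed

text \<open>
Indicators of Borel sets are approximated by those of open sets through outer regularity; sums and
dominated limits give all integrable functions.
\<close>

lemma L1_cont_integrable:
  assumes "integrable lborel (f :: 'a::euclidean_space \<Rightarrow> real)"
  shows "L1_cont f"
  using assms
proof (induct rule: integrable_induct)
  case (base A c)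
  have A[measurable]: "A \<in> sets borel" using base by simp
  have iA: "integrable lborel (indicator A :: 'a \<Rightarrow> real)" using base by (intro integrable_real_indicator) auto
  have "L1_cont (indicator A :: 'a \<Rightarrow> real)"
  proof (rule L1_cont_approx[OF iA])
    fix e :: real assume e: "e > 0"
    obtain U where U: "open U" "A \<subseteq> U" "emeasure lborel (U - A) < e"
      using outer_regular_lborel[OF A e] by blast
    have [measurable]: "U \<in> sets borel" using U by simp
    have "U = A \<union> (U - A)" using U by auto
    then have "emeasure lborel U \<le> emeasure lborel A + emeasure lborel (U - A)"
      by (metis A \<open>U \<in> sets borel\<close> emeasure_subadditive sets.Diff sets_lborel)
    also have "\<dots> < \<infinity>" using base U
      by (simp add: ennreal_add_less_top less_top order.strict_trans[of _ "ennreal e"])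
    finally have Uf: "emeasure lborel U < \<infinity>" .
    have "(LBINT z. \<bar>indicator A z - indicator U z\<bar>) = (\<integral>z. indicator (U - A) z \<partial>(lborel::'a measure) :: real)"
      using U by (intro Bochner_Integration.integral_cong) (auto simp: indicator_def)
    also have "\<dots> = measure lborel (U - A)" by simp
    also have "\<dots> < e" using U(3) e unfolding measure_def
      by (simp add: enn2real_less_iff order.strict_trans[OF U(3)])
    finally show "\<exists>g. integrable lborel g \<and> L1_cont g \<and> (LBINT z. \<bar>indicator A z - g z\<bar>) < e"
      using L1_cont_open[OF U(1) Uf] Uf by (intro exI[of _ "indicator U"]) (auto intro!: integrable_real_indicator)
  qed
  then show ?case using L1_cont_scale by simp
next
  case (add f g)
  then show ?case by (intro L1_cont_add)
next
  case (lim f s)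
  have [measurable]: "f \<in> borel_measurable borel" "s i \<in> borel_measurable borel" for i
    using lim(1)[of i] lim(5) by (simp_all add: borel_measurable_integrable)
  show ?case
  proof (rule L1_cont_approx[OF lim(5)])
    fix e :: real assume e: "e > 0"
    have "(\<lambda>i. (LBINT z. \<bar>f z - s i z\<bar>)) \<longlonglongrightarrow> (\<integral>z. 0 \<partial>(lborel::'a measure))"
    proof (rule integral_dominated_convergence[where w = "\<lambda>z. 3 * \<bar>f z\<bar>"])
      show "AE x in lborel. (\<lambda>i. \<bar>f x - s i x\<bar>) \<longlonglongrightarrow> 0"
      proof (rule AE_I2)
        fix x :: 'a
        have "(\<lambda>i. \<bar>f x - s i x\<bar>) \<longlonglongrightarrow> \<bar>f x - f x\<bar>" using lim(3)[of x] by (intro tendsto_intros) auto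
        then show "(\<lambda>i. \<bar>f x - s i x\<bar>) \<longlonglongrightarrow> 0" by simp
      qed
      show "AE x in lborel. norm \<bar>f x - s i x\<bar> \<le> 3 * \<bar>f x\<bar>" for i
        using lim(4)[of _ i] by (intro AE_I2) (smt (verit) UNIV_I real_norm_def space_lborel)
    qed (use lim in auto)
    then have "\<forall>\<^sub>F i in sequentially. (LBINT z. \<bar>f z - s i z\<bar>) < e"
      using e by (simp add: order_tendstoD(2))
    then obtain i where "(LBINT z. \<bar>f z - s i z\<bar>) < e"
      by (meson eventually_happens' sequentially_bot)
    then show "\<exists>g. integrable lborel g \<and> L1_cont g \<and> (LBINT z. \<bar>f z - g z\<bar>) < e"
      using lim(1,2) by blast
  qed
qed

text \<open>
Averaging along the image of a linear map \<open>A\<close> covers mollification in space alone and in time alone, both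
acting on functions of space-time.
\<close>

definition smear :: "('d::euclidean_space \<Rightarrow> real) \<Rightarrow> ('d \<Rightarrow> 'a::euclidean_space) \<Rightarrow> real \<Rightarrow> ('a \<Rightarrow> real) \<Rightarrow> 'a \<Rightarrow> real" where
  "smear k A h f z = (LBINT w. k w * f (z + h *\<^sub>R A w))"

lemma smear_pair_integrable:
  fixes k :: "'d::euclidean_space \<Rightarrow> real" and A :: "'d \<Rightarrow> 'a::euclidean_space"
  assumes k: "integrable lborel k" and A: "bounded_linear A" and f: "integrable lborel f"
  shows "integrable (lborel \<Otimes>\<^sub>M lborel) (\<lambda>(w, z). k w * f (z + h *\<^sub>R A w))"
proof -
  have [measurable]: "f \<in> borel_measurable borel" "k \<in> borel_measurable borel" "A \<in> borel_measurable borel"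
    using f k borel_measurable_continuous_onI[OF linear_continuous_on[OF A]]
    by (simp_all add: borel_measurable_integrable)
  have fi: "integrable lborel (\<lambda>z. f (z + v))" for v by (rule integrable_translate[OF f])
  show ?thesis
  proof (rule lborel_pair.Fubini_integrable)
    have "(LBINT z. norm (k w * f (z + h *\<^sub>R A w))) = \<bar>k w\<bar> * (LBINT z. \<bar>f z\<bar>)" for w
      using integral_translate[of "\<lambda>z. \<bar>f z\<bar>" "h *\<^sub>R A w"] by (simp add: abs_mult)
    then show "integrable lborel (\<lambda>x. (LBINT y. norm (case (x, y) of (w, z) \<Rightarrow> k w * f (z + h *\<^sub>R A w))))"
      using k by simp
    show "AE x in lborel. integrable lborel (\<lambda>y. case (x, y) of (w, z) \<Rightarrow> k w * f (z + h *\<^sub>R A w))"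
      using fi by (intro AE_I2) auto
  qed measurable
qed

lemma smear_integrable:
  fixes k :: "'d::euclidean_space \<Rightarrow> real" and A :: "'d \<Rightarrow> 'a::euclidean_space"
  assumes "integrable lborel k" "bounded_linear A" "integrable lborel f"
  shows "integrable lborel (smear k A h f)"
  unfolding smear_def[abs_def]
  by (rule lborel_pair.integrable_snd) (rule smear_pair_integrable[OF assms])

text \<open>
By Fubini the \<open>L\<^sup>1\<close> distance is at most \<open>\<integral> |k(w)| \<parallel>f(\<cdot> + h A w) - f\<parallel> dw\<close>, to which dominated
convergence applies because translations are continuous in \<open>L\<^sup>1\<close>.
\<close>

lemma smear_tendsto_L1:
  fixes k :: "'d::euclidean_space \<Rightarrow> real" and A :: "'d \<Rightarrow> 'a::euclidean_space"
  assumes k: "integrable lborel k" and k1: "(LBINT w. k w) = 1"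
    and A: "bounded_linear A" and f: "integrable lborel f" and h: "h \<longlonglongrightarrow> 0"
  shows "(\<lambda>j. (LBINT z. \<bar>smear k A (h j) f z - f z\<bar>)) \<longlonglongrightarrow> 0"
proof -
  have [measurable]: "f \<in> borel_measurable borel" "k \<in> borel_measurable borel" "A \<in> borel_measurable borel"
    using f k borel_measurable_continuous_onI[OF linear_continuous_on[OF A]]
    by (simp_all add: borel_measurable_integrable)
  define B where "B = (\<lambda>j. (LBINT w. \<bar>k w\<bar> * L1_shift f (h j *\<^sub>R A w)))"
  have int2: "integrable (lborel \<Otimes>\<^sub>M lborel) (\<lambda>(w, z). k w * (f (z + h j *\<^sub>R A w) - f z))" for j
  proof -
    have "integrable (lborel \<Otimes>\<^sub>M lborel) (\<lambda>(w, z). k w * f (z + h j *\<^sub>R A w) - k w * f (z + 0 *\<^sub>R A w))"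
      using smear_pair_integrable[OF k A f, of "h j"] smear_pair_integrable[OF k A f, of 0]
      by (simp add: case_prod_unfold)
    then show ?thesis by (simp add: right_diff_distrib)
  qed
  have mshift: "(\<lambda>w. L1_shift f (h j *\<^sub>R A w)) \<in> borel_measurable borel" for j
    unfolding L1_shift_def by measurable
  have le: "(LBINT z. \<bar>smear k A (h j) f z - f z\<bar>) \<le> B j" for j
  proof -
    have int3: "integrable (lborel \<Otimes>\<^sub>M lborel) (\<lambda>(w, z). \<bar>k w * (f (z + h j *\<^sub>R A w) - f z)\<bar>)"
      using integrable_abs[OF int2[of j]] by (simp add: case_prod_unfold)
    have "(LBINT z. \<bar>smear k A (h j) f z - f z\<bar>)
        \<le> (LBINT z. (LBINT w. \<bar>k w * (f (z + h j *\<^sub>R A w) - f z)\<bar>))"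
    proof (rule integral_mono_AE)
      show "integrable lborel (\<lambda>z. \<bar>smear k A (h j) f z - f z\<bar>)"
        using smear_integrable[OF k A f] f by auto
      show "integrable lborel (\<lambda>z. (LBINT w. \<bar>k w * (f (z + h j *\<^sub>R A w) - f z)\<bar>))"
        using lborel_pair.integrable_snd[OF int3] .
      show "AE z in lborel. \<bar>smear k A (h j) f z - f z\<bar> \<le> (LBINT w. \<bar>k w * (f (z + h j *\<^sub>R A w) - f z)\<bar>)"
        using lborel_pair.AE_integrable_snd[OF smear_pair_integrable[OF k A f, of "h j"]]
      proof eventually_elim
        fix z assume iz: "integrable lborel (\<lambda>w. k w * f (z + h j *\<^sub>R A w))"
        have "smear k A (h j) f z - f z = (LBINT w. k w * f (z + h j *\<^sub>R A w)) - (LBINT w. k w * f z)"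
          by (simp add: smear_def k1)
        also have "\<dots> = (LBINT w. k w * f (z + h j *\<^sub>R A w) - k w * f z)"
          using iz k by (subst Bochner_Integration.integral_diff) auto
        also have "\<dots> = (LBINT w. k w * (f (z + h j *\<^sub>R A w) - f z))"
          by (simp add: right_diff_distrib)
        finally show "\<bar>smear k A (h j) f z - f z\<bar> \<le> (LBINT w. \<bar>k w * (f (z + h j *\<^sub>R A w) - f z)\<bar>)"
          by simp
      qed
    qed
    also have "\<dots> = (LBINT w. (LBINT z. \<bar>k w * (f (z + h j *\<^sub>R A w) - f z)\<bar>))"
      using lborel_pair.integral_snd[OF int3] lborel_pair.integral_fst[OF int3] by simp
    also have "\<dots> = B j"
      unfolding B_def L1_shift_def by (simp add: abs_mult)
    finally show ?thesis .
  qed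
  have "B \<longlonglongrightarrow> (\<integral>w. 0 \<partial>(lborel::'d measure))"
    unfolding B_def
  proof (rule integral_dominated_convergence[where w = "\<lambda>w. \<bar>k w\<bar> * (2 * (LBINT z. \<bar>f z\<bar>))"])
    show "AE w in lborel. (\<lambda>j. \<bar>k w\<bar> * L1_shift f (h j *\<^sub>R A w)) \<longlonglongrightarrow> 0"
    proof (rule AE_I2)
      fix w
      have "(\<lambda>j. h j *\<^sub>R A w) \<longlonglongrightarrow> 0 *\<^sub>R A w" using h by (intro tendsto_intros)
      then have "(\<lambda>j. L1_shift f (h j *\<^sub>R A w)) \<longlonglongrightarrow> 0"
        using L1_cont_integrable[OF f] unfolding L1_cont_def by simp
      from tendsto_mult_left[OF this, of "\<bar>k w\<bar>"]
      show "(\<lambda>j. \<bar>k w\<bar> * L1_shift f (h j *\<^sub>R A w)) \<longlonglongrightarrow> 0" by simp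
    qed
    show "AE w in lborel. norm (\<bar>k w\<bar> * L1_shift f (h j *\<^sub>R A w)) \<le> \<bar>k w\<bar> * (2 * (LBINT z. \<bar>f z\<bar>))" for j
      using L1_shift_bound[OF f] L1_shift_nonneg[of f] by (intro AE_I2) (simp add: abs_mult mult_left_mono)
  qed (use k mshift in auto)
  then have "B \<longlonglongrightarrow> 0" by simp
  then show ?thesis
    by (rule tendsto_sandwich[OF _ _ tendsto_const, rotated -1]) (auto simp: le)
qed

text \<open>
The components of a vector-valued function need a common subsequence; it comes from the scalar sequence of
the summed absolute errors.
\<close>

lemma smear_AE_subseq:
  fixes k :: "'d::euclidean_space \<Rightarrow> real" and A :: "'d \<Rightarrow> 'a::euclidean_space" and f :: "'i \<Rightarrow> 'a \<Rightarrow> real"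
  assumes k: "integrable lborel k" and k1: "(LBINT w. k w) = 1"
    and A: "bounded_linear A" and I: "finite I" and f: "\<And>i. i \<in> I \<Longrightarrow> integrable lborel (f i)" and h: "h \<longlonglongrightarrow> 0"
  shows "\<exists>r::nat\<Rightarrow>nat. strict_mono r \<and>
    (AE z in lborel. \<forall>i\<in>I. (\<lambda>j. smear k A (h (r j)) (f i) z) \<longlonglongrightarrow> f i z)"
proof -
  let ?S = "\<lambda>j z. \<Sum>i\<in>I. \<bar>smear k A (h j) (f i) z - f i z\<bar>"
  have int: "integrable lborel (\<lambda>z. \<bar>smear k A (h j) (f i) z - f i z\<bar>)" if "i \<in> I" for i j
    using smear_integrable[OF k A f[OF that]] f[OF that] by auto
  have "(\<lambda>j. \<Sum>i\<in>I. (LBINT z. \<bar>smear k A (h j) (f i) z - f i z\<bar>)) \<longlonglongrightarrow> (\<Sum>i\<in>I. 0)"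
    using f by (intro tendsto_sum smear_tendsto_L1[OF k k1 A _ h]) auto
  moreover have "(\<Sum>i\<in>I. (LBINT z. \<bar>smear k A (h j) (f i) z - f i z\<bar>)) = (LBINT z. norm (?S j z))" for j
    using int by (subst Bochner_Integration.integral_sum[symmetric]) (auto simp: sum_nonneg)
  ultimately have "(\<lambda>j. (LBINT z. norm (?S j z))) \<longlonglongrightarrow> 0" by simp
  from tendsto_L1_AE_subseq[where u = ?S and M = lborel, OF _ this] int
  obtain r :: "nat \<Rightarrow> nat" where r: "strict_mono r" and ae: "AE z in lborel. (\<lambda>j. ?S (r j) z) \<longlonglongrightarrow> 0"
    by auto
  from ae have "AE z in lborel. \<forall>i\<in>I. (\<lambda>j. smear k A (h (r j)) (f i) z) \<longlonglongrightarrow> f i z"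
  proof eventually_elim
    fix z assume z: "(\<lambda>j. ?S (r j) z) \<longlonglongrightarrow> 0"
    show "\<forall>i\<in>I. (\<lambda>j. smear k A (h (r j)) (f i) z) \<longlonglongrightarrow> f i z"
    proof
      fix i assume i: "i \<in> I"
      have "(\<lambda>j. smear k A (h (r j)) (f i) z - f i z) \<longlonglongrightarrow> 0"
      proof (rule Lim_null_comparison[OF _ z], rule always_eventually, rule allI)
        fix j
        show "norm (smear k A (h (r j)) (f i) z - f i z) \<le> ?S (r j) z"
          using member_le_sum[OF i, of "\<lambda>i. \<bar>smear k A (h (r j)) (f i) z - f i z\<bar>"] I by simp
      qed
      then show "(\<lambda>j. smear k A (h (r j)) (f i) z) \<longlonglongrightarrow> f i z" by (rule LIM_zero_cancel)
    qed
  qed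
  with r show ?thesis by blast
qed

section \<open>Smooth functions of compact support\<close>

lemma C_k_SucI:
  assumes "\<And>x. (f has_derivative D x) (at x)" "\<And>b. b \<in> Basis \<Longrightarrow> C_k k (\<lambda>x. D x b)"
  shows "C_k (Suc k) f"
proof -
  have "frechet_derivative f (at x) = D x" for x
    using frechet_derivative_at[OF assms(1)[of x]] by simp
  then show ?thesis
    using assms by (auto simp: differentiable_def)
qed

lemma C_k_has_derivative:
  assumes "C_k (Suc k) f"
  shows "(f has_derivative frechet_derivative f (at x)) (at x)"
  using assms frechet_derivative_works by auto

lemma C_k_partial: "C_k (Suc k) f \<Longrightarrow> b \<in> Basis \<Longrightarrow> C_k k (\<lambda>x. frechet_derivative f (at x) b)"
  by simp

text \<open>
The recursive clause is unfolded one order at a time by the two rules above and \<open>C_k_SucI\<close>; as a rewrite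
rule it would make the simplifier chase derivatives of derivatives.
\<close>

declare C_k.simps(2) [simp del]

lemma C_k_SucD: "C_k (Suc k) f \<Longrightarrow> C_k k f"
proof (induction k arbitrary: f)
  case 0
  then show ?case
    by (auto simp: C_k.simps intro!: continuous_at_imp_continuous_on differentiable_imp_continuous_within)
next
  case (Suc k)
  show ?case
    by (rule C_k_SucI[OF C_k_has_derivative[OF Suc.prems]]) (rule Suc.IH[OF C_k_partial[OF Suc.prems]])
qed

lemma C_k_const [simp]: "C_k k (\<lambda>x. c)"
proof (induction k arbitrary: c)
  case (Suc k)
  show ?case by (rule C_k_SucI[of _ "\<lambda>x h. 0"]) (auto intro: Suc)
qed auto

lemma C_k_add: "C_k k f \<Longrightarrow> C_k k g \<Longrightarrow> C_k k (\<lambda>x. f x + g x)"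
proof (induction k arbitrary: f g)
  case 0
  then show ?case by (auto intro: continuous_intros)
next
  case (Suc k)
  show ?case
    by (rule C_k_SucI[OF has_derivative_add[OF Suc.prems[THEN C_k_has_derivative]]])
      (rule Suc.IH[OF Suc.prems[THEN C_k_partial]])
qed

lemma C_k_mult: "C_k k f \<Longrightarrow> C_k k g \<Longrightarrow> C_k k (\<lambda>x. f x * g x)"
proof (induction k arbitrary: f g)
  case 0
  then show ?case by (auto intro: continuous_intros)
next
  case (Suc k)
  show ?case
    by (rule C_k_SucI[OF has_derivative_mult[OF Suc.prems[THEN C_k_has_derivative]]])
      (intro C_k_add Suc.IH C_k_partial[OF Suc.prems(1)] C_k_partial[OF Suc.prems(2)] Suc.prems[THEN C_k_SucD])
qed

lemma C_k_sum: "(\<And>i. i \<in> I \<Longrightarrow> C_k k (f i)) \<Longrightarrow> C_k k (\<lambda>x. \<Sum>i\<in>I. f i x)"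
  by (induction I rule: infinite_finite_induct) (auto intro: C_k_add)

lemma C_k_linear:
  assumes "bounded_linear f"
  shows "C_k k f"
proof (cases k)
  case 0
  then show ?thesis using linear_continuous_on[OF assms] by simp
next
  case (Suc m)
  show ?thesis unfolding Suc
    by (rule C_k_SucI[OF bounded_linear.has_derivative[OF assms has_derivative_ident]]) auto
qed

text \<open>
The chain rule expresses a partial derivative of the composite through the partial derivatives of \<open>f\<close> with
constant coefficients, so the order of differentiability passes through the induction unchanged.
\<close>

lemma C_k_affine:
  fixes f :: "'b::euclidean_space \<Rightarrow> real" and A :: "'a::euclidean_space \<Rightarrow> 'b"
  assumes A: "bounded_linear A"
  shows "C_k k f \<Longrightarrow> C_k k (\<lambda>z. f (a + A z))"
proof (induction k arbitrary: f)
  case 0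
  then show ?case
    using continuous_on_compose2[of UNIV f UNIV "\<lambda>z. a + A z"]
      continuous_on_add[OF continuous_on_const linear_continuous_on[OF A]] by auto
next
  case (Suc k)
  let ?D = "\<lambda>x. frechet_derivative f (at x)"
  have D: "(f has_derivative ?D x) (at x)" for x
    by (rule C_k_has_derivative[OF Suc.prems])
  show ?case
  proof (rule C_k_SucI)
    show "((\<lambda>z. f (a + A z)) has_derivative (\<lambda>h. ?D (a + A z) (A h))) (at z)" for z
      by (rule has_derivative_compose[OF _ D])
        (auto intro!: derivative_eq_intros bounded_linear.has_derivative[OF A])
    fix b :: 'a
    have "?D x (A b) = (\<Sum>e\<in>Basis. (A b \<bullet> e) * ?D x e)" for x
      using linear_sum[OF has_derivative_linear[OF D[of x]], of "\<lambda>e. (A b \<bullet> e) *\<^sub>R e" Basis]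
        linear_scale[OF has_derivative_linear[OF D[of x]]] by (simp add: euclidean_representation)
    moreover have "C_k k (\<lambda>z. \<Sum>e\<in>Basis. (A b \<bullet> e) * ?D (a + A z) e)"
      by (intro C_k_sum C_k_mult C_k_const Suc.IH[OF C_k_partial[OF Suc.prems]])
    ultimately show "C_k k (\<lambda>z. ?D (a + A z) (A b))" by simp
  qed
qed

lemma C_k_compose_real:
  fixes g :: "real \<Rightarrow> real"
  shows "C_k k g \<Longrightarrow> C_k k f \<Longrightarrow> C_k k (\<lambda>x. g (f x))"
proof (induction k arbitrary: f g)
  case 0
  then show ?case using continuous_on_compose2[of UNIV g UNIV f] by auto
next
  case (Suc k)
  let ?D = "\<lambda>x. frechet_derivative g (at x)"
  have D: "(g has_derivative ?D x) (at x)" for x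
    by (rule C_k_has_derivative[OF Suc.prems(1)])
  have lin: "?D x h = ?D x 1 * h" for x h
    using linear_scale[OF has_derivative_linear[OF D[of x]], of h 1] by (simp add: mult.commute)
  show ?case
  proof (rule C_k_SucI)
    show "((\<lambda>z. g (f z)) has_derivative (\<lambda>h. ?D (f z) (frechet_derivative f (at z) h))) (at z)" for z
      by (rule has_derivative_compose[OF C_k_has_derivative[OF Suc.prems(2)] D])
    fix b :: 'a assume "b \<in> Basis"
    then have "C_k k (\<lambda>z. ?D (f z) 1 * frechet_derivative f (at z) b)"
      using Suc.IH[OF C_k_partial[OF Suc.prems(1)] C_k_SucD[OF Suc.prems(2)], of 1]
      by (intro C_k_mult C_k_partial[OF Suc.prems(2)]) simp_all
    moreover have "(\<lambda>z. ?D (f z) (frechet_derivative f (at z) b))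
        = (\<lambda>z. ?D (f z) 1 * frechet_derivative f (at z) b)"
      by (rule ext) (rule lin)
    ultimately show "C_k k (\<lambda>z. ?D (f z) (frechet_derivative f (at z) b))"
      by (simp only:)
  qed
qed

lemma C_k_real_SucI:
  fixes f :: "real \<Rightarrow> real"
  assumes "\<And>x. (f has_real_derivative g x) (at x)" "C_k k g"
  shows "C_k (Suc k) f"
  by (rule C_k_SucI[of f "\<lambda>x h. g x * h"]) (use assms in \<open>auto simp: has_field_derivative_def\<close>)

text \<open>
The functions \<open>p(1/x) exp(-1/x)\<close> form a class closed under differentiation, which proves smoothness of
\<open>exp(-1/x)\<close> at 0 by a single induction over all \<open>p\<close>.
\<close>

definition exp_flat :: "real poly \<Rightarrow> real \<Rightarrow> real" where
  "exp_flat p x = (if x \<le> 0 then 0 else poly p (1 / x) * exp (- (1 / x)))"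

lemma poly_times_exp_tendsto_0: "((\<lambda>y. y ^ k * poly p y * exp (- y)) \<longlongrightarrow> (0::real)) at_top"
proof (induction p arbitrary: k)
  case 0
  then show ?case by simp
next
  case (pCons a p)
  have "((\<lambda>y. a * (y ^ k / exp y) + y ^ Suc k * poly p y * exp (- y)) \<longlongrightarrow> a * 0 + 0) at_top"
    by (intro tendsto_intros tendsto_power_div_exp_0 pCons.IH)
  moreover have "(\<lambda>y. a * (y ^ k / exp y) + y ^ Suc k * poly p y * exp (- y))
      = (\<lambda>y. y ^ k * poly (pCons a p) y * exp (- y))"
    by (auto simp: fun_eq_iff exp_minus field_simps)
  ultimately show ?case by simp
qed

text \<open>
Away from 0 this is the product rule in the variable \<open>y = 1/x\<close>; at 0 the difference quotient from the right
is \<open>y p(y) exp(-y)\<close>.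
\<close>

lemma exp_flat_has_real_derivative:
  "(exp_flat p has_real_derivative exp_flat ([:0, 0, 1:] * (p - pderiv p)) x) (at x)"
proof -
  consider "x < 0" | "x = 0" | "x > 0" by linarith
  then show ?thesis
  proof cases
    case 1
    have "((\<lambda>x. 0) has_real_derivative 0) (at x)" by simp
    then have "(exp_flat p has_real_derivative 0) (at x)"
      by (rule has_field_derivative_transform_within_open[of _ _ _ "{..<0}"]) (use 1 in \<open>auto simp: exp_flat_def\<close>)
    then show ?thesis using 1 by (simp add: exp_flat_def)
  next
    case 3
    have "((\<lambda>x. poly p (1 / x) * exp (- (1 / x))) has_real_derivative
        poly (pderiv p) (1/x) * (- (1 / x^2)) * exp (- (1 / x)) + poly p (1/x) * (exp (- (1/x)) * (1 / x^2))) (at x)"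
      using 3 by (auto intro!: derivative_eq_intros simp: power2_eq_square)
    then have "(exp_flat p has_real_derivative
        poly (pderiv p) (1/x) * (- (1 / x^2)) * exp (- (1 / x)) + poly p (1/x) * (exp (- (1/x)) * (1 / x^2))) (at x)"
      by (rule has_field_derivative_transform_within_open[of _ _ _ "{0<..}"]) (use 3 in \<open>auto simp: exp_flat_def\<close>)
    moreover have "poly (pderiv p) (1/x) * (- (1 / x^2)) * exp (- (1 / x)) + poly p (1/x) * (exp (- (1/x)) * (1 / x^2))
        = exp_flat ([:0, 0, 1:] * (p - pderiv p)) x"
      using 3 by (simp add: exp_flat_def field_simps power2_eq_square)
    ultimately show ?thesis by simp
  next
    case 2
    have "((\<lambda>h. exp_flat p h / h) \<longlongrightarrow> 0) (at_right 0)"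
    proof -
      have "((\<lambda>h. inverse h ^ 1 * poly p (inverse h) * exp (- inverse h)) \<longlongrightarrow> 0) (at_right 0)"
        by (rule filterlim_compose[OF poly_times_exp_tendsto_0 filterlim_inverse_at_top_right])
      moreover have "\<forall>\<^sub>F h in at_right 0. inverse h ^ 1 * poly p (inverse h) * exp (- inverse h) = exp_flat p h / h"
        by (auto simp: eventually_at_right_field exp_flat_def field_simps intro!: exI[of _ 1])
      ultimately show ?thesis by (rule Lim_transform_eventually)
    qed
    moreover have "((\<lambda>h. exp_flat p h / h) \<longlongrightarrow> 0) (at_left 0)"
      by (rule tendsto_eventually) (auto simp: eventually_at_left_field exp_flat_def intro!: exI[of _ "-1"])
    ultimately have "((\<lambda>h. exp_flat p h / h) \<longlongrightarrow> 0) (at 0)"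
      by (simp add: filterlim_split_at)
    then show ?thesis using 2 by (simp add: DERIV_def exp_flat_def)
  qed
qed

lemma C_k_exp_flat: "C_k k (exp_flat p)"
proof (induction k arbitrary: p)
  case 0
  show ?case
    using exp_flat_has_real_derivative[THEN DERIV_isCont] by (auto intro: continuous_at_imp_continuous_on)
next
  case (Suc k)
  then show ?case by (intro C_k_real_SucI[OF exp_flat_has_real_derivative])
qed

lemma exp_flat_one_bounds: "0 \<le> exp_flat 1 x" "exp_flat 1 x \<le> 1"
  by (auto simp: exp_flat_def)

lemma exp_flat_quadratic_bounds: "0 \<le> exp_flat [:0, 0, 1:] x" "exp_flat [:0, 0, 1:] x \<le> 2"
proof -
  have "y * y * exp (- y) \<le> 2" if "0 < y" for y :: real
  proof -
    have "y * y / 2 \<le> exp y"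
      using exp_lower_Taylor_quadratic[of y] that by (simp add: power2_eq_square)
    then show ?thesis by (simp add: exp_minus field_simps)
  qed
  from this[of "1 / x"] show "exp_flat [:0, 0, 1:] x \<le> 2" by (auto simp: exp_flat_def field_simps)
qed (auto simp: exp_flat_def)

text \<open>
The normalising factor of the mollifier. The number \<open>4 / bump_mass\<close> recurs below as a common bound for the
mollifier and for its slope.
\<close>

definition bump_mass :: "'a::euclidean_space itself \<Rightarrow> real" where
  "bump_mass _ = (\<integral>v. exp_flat 1 (1 - v \<bullet> v) \<partial>(lborel :: 'a measure))"

definition moll :: "'a::euclidean_space \<Rightarrow> real" where
  "moll w = exp_flat 1 (1 - w \<bullet> w) / bump_mass TYPE('a)"

text \<open>
The radial slope of the mollifier: its gradient at \<open>w\<close> is \<open>- moll_slope w\<close> times \<open>w\<close>.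
\<close>

definition moll_slope :: "'a::euclidean_space \<Rightarrow> real" where
  "moll_slope w = 2 * exp_flat [:0, 0, 1:] (1 - w \<bullet> w) / bump_mass TYPE('a)"

lemma inner_self_ge_1: "norm w \<ge> 1 \<Longrightarrow> 1 - w \<bullet> w \<le> 0"
  using power_mono[of 1 "norm w" 2] by (simp add: power2_norm_eq_inner)

lemma exp_flat_outside: "norm w \<ge> 1 \<Longrightarrow> exp_flat p (1 - w \<bullet> w) = 0"
  using inner_self_ge_1[of w] by (simp add: exp_flat_def)

lemma C_k_bump: "C_k k (\<lambda>w::'a::euclidean_space. exp_flat p (1 - w \<bullet> w))"
proof -
  have "C_k k (\<lambda>w::'a. 1 + (\<Sum>b\<in>Basis. (-1) * ((w \<bullet> b) * (w \<bullet> b))))"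
    by (intro C_k_add C_k_sum C_k_mult C_k_const C_k_linear bounded_linear_inner_left)
  moreover have "(\<lambda>w::'a. 1 + (\<Sum>b\<in>Basis. (-1) * ((w \<bullet> b) * (w \<bullet> b)))) = (\<lambda>w. 1 - w \<bullet> w)"
    by (rule ext, subst (3) euclidean_inner) (simp add: sum_negf)
  ultimately have "C_k k (\<lambda>w::'a. 1 - w \<bullet> w)" by simp
  from C_k_compose_real[OF C_k_exp_flat this] show ?thesis .
qed

lemma continuous_bump: "continuous_on S (\<lambda>w::'a::euclidean_space. exp_flat p (1 - w \<bullet> w))"
  using C_k_bump[of 0 p] continuous_on_subset by auto

lemma bump_integrable: "integrable lborel (\<lambda>w::'a::euclidean_space. exp_flat p (1 - w \<bullet> w))"
proof -
  let ?f = "\<lambda>w::'a. exp_flat p (1 - w \<bullet> w)"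
  have "(\<lambda>w. indicator (cball 0 1) w *\<^sub>R ?f w) = ?f"
  proof
    fix w :: 'a
    show "indicator (cball 0 1) w *\<^sub>R ?f w = ?f w"
      using exp_flat_outside[of w p] by (cases "norm w \<ge> 1") (simp_all add: indicator_def)
  qed
  moreover have "integrable lborel (\<lambda>w. indicator (cball 0 1) w *\<^sub>R ?f w)"
    by (rule borel_integrable_compact[OF compact_cball continuous_bump])
  ultimately show ?thesis by metis
qed

lemma bump_mass_pos: "bump_mass TYPE('a::euclidean_space) > 0"
proof -
  let ?f = "\<lambda>w::'a. exp_flat 1 (1 - w \<bullet> w)"
  have "bump_mass TYPE('a) \<ge> 0" by (simp add: bump_mass_def exp_flat_one_bounds)
  moreover have "bump_mass TYPE('a) \<noteq> 0"
  proof
    assume "bump_mass TYPE('a) = 0"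
    then have "AE w in (lborel :: 'a measure). ?f w = 0"
      using integral_nonneg_eq_0_iff_AE[OF bump_integrable[of 1, where ?'a = 'a]] exp_flat_one_bounds
      by (simp add: bump_mass_def)
    then have ae: "AE w in (lborel :: 'a measure). w \<notin> ball 0 1"
    proof eventually_elim
      fix w :: 'a assume "?f w = 0"
      then have "\<not> 1 - w \<bullet> w > 0" by (auto simp: exp_flat_def)
      then show "w \<notin> ball 0 1"
        using power_strict_mono[of "norm w" 1 2] by (auto simp: power2_norm_eq_inner)
    qed
    have "emeasure lborel (ball (0::'a) 1) = 0"
      by (rule null_setsD1, rule iffD2[OF AE_iff_null_sets ae]) simp
    then have "measure lborel (ball (0::'a) 1) = 0" by (simp add: measure_def)
    then show False using content_ball_pos[of 1 "0::'a"] by simp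
  qed
  ultimately show ?thesis by linarith
qed

lemma moll_nonneg: "0 \<le> moll w"
  using bump_mass_pos[where ?'a = 'a] exp_flat_one_bounds by (simp add: moll_def)

lemma moll_le: "moll w \<le> 4 / bump_mass TYPE('a)" for w :: "'a::euclidean_space"
proof -
  have "exp_flat 1 (1 - w \<bullet> w) \<le> 4" using exp_flat_one_bounds(2)[of "1 - w \<bullet> w"] by linarith
  then show ?thesis using bump_mass_pos[where ?'a = 'a] by (simp add: moll_def divide_right_mono)
qed

lemma abs_moll_le: "\<bar>moll w\<bar> \<le> 4 / bump_mass TYPE('a)" for w :: "'a::euclidean_space"
  using moll_le[of w] moll_nonneg[of w] by linarith

lemma moll_slope_nonneg: "0 \<le> moll_slope w"
  using bump_mass_pos[where ?'a = 'a] exp_flat_quadratic_bounds by (simp add: moll_slope_def)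

lemma moll_slope_le: "moll_slope w \<le> 4 / bump_mass TYPE('a)" for w :: "'a::euclidean_space"
  using bump_mass_pos[where ?'a = 'a] exp_flat_quadratic_bounds(2)[of "1 - w \<bullet> w"]
  by (simp add: moll_slope_def divide_right_mono)

lemma moll_outside: "norm w \<ge> 1 \<Longrightarrow> moll w = 0" "norm w \<ge> 1 \<Longrightarrow> moll_slope w = 0"
  by (simp_all add: moll_def moll_slope_def exp_flat_outside)

lemma continuous_moll: "continuous_on S moll" "continuous_on S moll_slope" for S :: "'a::euclidean_space set"
  unfolding moll_def moll_slope_def
  using bump_mass_pos[where ?'a = 'a]
  by (auto intro!: continuous_intros continuous_bump)

lemma moll_measurable [measurable]: "moll \<in> borel_measurable borel" "moll_slope \<in> borel_measurable borel"
  by (auto intro: borel_measurable_continuous_onI continuous_moll)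

lemma moll_integrable: "integrable lborel moll"
  unfolding moll_def using bump_integrable[of 1] by auto

lemma integral_moll: "(LBINT w. moll w) = 1"
  using bump_mass_pos[where ?'a = 'a] by (simp add: moll_def bump_mass_def)

lemma C_k_moll: "C_k k (moll :: 'a::euclidean_space \<Rightarrow> real)"
proof -
  have "C_k k (\<lambda>w::'a. exp_flat 1 (1 - w \<bullet> w) * (1 / bump_mass TYPE('a)))"
    by (intro C_k_mult C_k_bump C_k_const)
  then show ?thesis by (simp add: moll_def[abs_def])
qed

lemma moll_has_derivative:
  "(moll has_derivative (\<lambda>h. - moll_slope w * (w \<bullet> h))) (at w)" for w :: "'a::euclidean_space"
proof -
  have d: "(exp_flat 1 has_derivative (\<lambda>h. exp_flat [:0, 0, 1:] x * h)) (at x)" for x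
    using exp_flat_has_real_derivative[of 1 x] by (simp add: has_field_derivative_def)
  have "((\<lambda>w::'a. 1 - w \<bullet> w) has_derivative (\<lambda>h. - 2 * (w \<bullet> h))) (at w)"
    by (auto intro!: derivative_eq_intros simp: inner_commute)
  from has_derivative_compose[OF this d]
  have "((\<lambda>w::'a. exp_flat 1 (1 - w \<bullet> w)) has_derivative (\<lambda>h. exp_flat [:0, 0, 1:] (1 - w \<bullet> w) * (- 2 * (w \<bullet> h)))) (at w)"
    by simp
  then have "((\<lambda>w::'a. exp_flat 1 (1 - w \<bullet> w) * (1 / bump_mass TYPE('a))) has_derivative
      (\<lambda>h. exp_flat [:0, 0, 1:] (1 - w \<bullet> w) * (- 2 * (w \<bullet> h)) * (1 / bump_mass TYPE('a)))) (at w)"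
    by (rule has_derivative_mult_left)
  then show ?thesis by (simp add: moll_def[abs_def] moll_slope_def mult_ac)
qed

text \<open>
The lower limit may be any number below \<open>-1\<close>, where the mollifier on the line begins; starting strictly before
it makes the derivative two-sided at every point of the support.
\<close>

definition smooth_step :: "real \<Rightarrow> real" where
  "smooth_step x = integral {-2..x} moll"

lemma smooth_step_eq_0: "x \<le> -1 \<Longrightarrow> smooth_step x = 0"
proof -
  assume "x \<le> -1"
  then have "integral {-2..x} moll = integral {-2..x} (\<lambda>y::real. 0::real)"
    by (intro Henstock_Kurzweil_Integration.integral_cong moll_outside) auto
  then show ?thesis by (simp add: smooth_step_def)
qed

lemma smooth_step_has_derivative: "(smooth_step has_real_derivative moll x) (at x)"
proof (cases "x < -1")
  case True
  have "((\<lambda>x. 0) has_real_derivative 0) (at x)" by simp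
  then have "(smooth_step has_real_derivative 0) (at x)"
    by (rule has_field_derivative_transform_within_open[of _ _ _ "{..<-1}"])
       (use True in \<open>auto simp: smooth_step_eq_0\<close>)
  then show ?thesis using True by (simp add: moll_outside)
next
  case False
  have "((\<lambda>x. integral {-2..x} moll) has_real_derivative moll x) (at x within {-2..x+1})"
    using False by (intro integral_has_real_derivative continuous_moll) auto
  moreover have "at x within {-2..x+1} = at x"
    by (rule at_within_interior) (use False in simp)
  ultimately show ?thesis unfolding smooth_step_def[abs_def] by metis
qed

lemma smooth_step_eq_1: "x \<ge> 1 \<Longrightarrow> smooth_step x = 1"
proof -
  assume x: "x \<ge> 1"
  have "set_integrable lborel {-2..x} (moll :: real \<Rightarrow> real)"
    unfolding set_integrable_def by (rule integrable_mult_indicator[OF _ moll_integrable]) simp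
  from set_borel_integral_eq_integral(2)[OF this]
  have "smooth_step x = (LINT y:{-2..x}|lborel. moll y)" by (simp add: smooth_step_def)
  also have "\<dots> = (\<integral>y. moll y \<partial>(lborel :: real measure))"
    unfolding set_lebesgue_integral_def
  proof (rule Bochner_Integration.integral_cong)
    fix y :: real
    show "indicat_real {-2..x} y *\<^sub>R moll y = moll y"
      using x moll_outside(1)[of y] by (cases "norm y \<ge> 1") (auto simp: indicator_def)
  qed simp
  finally show ?thesis by (simp add: integral_moll)
qed

lemma smooth_step_mono: "x \<le> y \<Longrightarrow> smooth_step x \<le> smooth_step y"
  by (rule DERIV_nonneg_imp_nondecreasing) (blast intro: smooth_step_has_derivative moll_nonneg)+

lemma smooth_step_bounds: "0 \<le> smooth_step x" "smooth_step x \<le> 1"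
  using smooth_step_mono[of "min x (-1)" x] smooth_step_mono[of x "max x 1"]
    smooth_step_eq_0[of "min x (-1)"] smooth_step_eq_1[of "max x 1"] by auto

lemma C_k_smooth_step: "C_k k smooth_step"
proof (cases k)
  case 0
  then show ?thesis
    using smooth_step_has_derivative[THEN DERIV_isCont] by (auto intro: continuous_at_imp_continuous_on)
next
  case (Suc m)
  then show ?thesis using C_k_real_SucI[OF smooth_step_has_derivative C_k_moll] by simp
qed

lemma smooth_step_measurable [measurable]: "smooth_step \<in> borel_measurable borel"
  using C_k_smooth_step[of 0] by (auto intro: borel_measurable_continuous_onI)

section \<open>Spatial averages of a function with a weak gradient\<close>

lemma integrable_mult_bounded:
  fixes f g :: "'a \<Rightarrow> real"
  assumes f: "integrable M f" and g[measurable]: "g \<in> borel_measurable M" and b: "\<And>x. \<bar>g x\<bar> \<le> C"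
  shows "integrable M (\<lambda>x. f x * g x)"
proof (rule Bochner_Integration.integrable_bound[of _ "\<lambda>x. f x * C"])
  have "\<bar>g x\<bar> \<le> \<bar>C\<bar>" for x using b[of x] by linarith
  then show "AE x in M. norm (f x * g x) \<le> norm (f x * C)"
    by (auto simp: abs_mult intro!: mult_left_mono)
qed (use f in auto)

lemma integrable_pair_mult:
  fixes f :: "'a::euclidean_space \<Rightarrow> real" and g :: "'b::euclidean_space \<Rightarrow> real"
  assumes f: "integrable lborel f" and g: "integrable lborel g"
  shows "integrable (lborel \<Otimes>\<^sub>M lborel) (\<lambda>(x, y). f x * g y)"
proof (rule lborel_pair.Fubini_integrable)
  have [measurable]: "f \<in> borel_measurable borel" "g \<in> borel_measurable borel"
    using f g by (simp_all add: borel_measurable_integrable)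
  show "(\<lambda>(x, y). f x * g y) \<in> borel_measurable (lborel \<Otimes>\<^sub>M lborel)" by measurable
  show "integrable lborel (\<lambda>x. (LBINT y. norm (case (x, y) of (x, y) \<Rightarrow> f x * g y)))"
    using f by (simp add: abs_mult)
qed (use g in auto)

lemma integral_affine:
  fixes f :: "'a::euclidean_space \<Rightarrow> real"
  assumes c: "0 < c" and [measurable]: "f \<in> borel_measurable borel"
  shows "(LBINT y. f y) = c ^ DIM('a) * (LBINT w. f (t + c *\<^sub>R w))"
proof -
  have "(LBINT y. f y) = (\<integral>y. f y \<partial>density (distr lborel borel (\<lambda>x. t + c *\<^sub>R x)) (\<lambda>_. ennreal (\<bar>c\<bar> ^ DIM('a))))"
    using lborel_affine[of c t] c by simp
  also have "\<dots> = (\<integral>y. \<bar>c\<bar> ^ DIM('a) *\<^sub>R f y \<partial>distr lborel borel (\<lambda>x. t + c *\<^sub>R x))"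
    by (subst integral_density) auto
  also have "\<dots> = (LBINT w. \<bar>c\<bar> ^ DIM('a) *\<^sub>R f (t + c *\<^sub>R w))"
    by (subst integral_distr) auto
  finally show ?thesis using c by simp
qed

lemma grad_eq: "(f has_derivative D) (at x) \<Longrightarrow> grad f x = (\<chi> j. D (axis j 1))"
  using frechet_derivative_at[of f D x] by (simp add: grad_def)

abbreviation rescale :: "'a::real_vector \<Rightarrow> real \<Rightarrow> 'a \<Rightarrow> 'a" where
  "rescale x r y \<equiv> (1 / r) *\<^sub>R (y - x)"

lemma C_k_moll_scaled: "C_k k (\<lambda>y::'a::euclidean_space. moll (rescale x \<sigma> y))"
  using C_k_affine[OF bounded_linear_scaleR_right[of "1 / \<sigma>"] C_k_moll, of k "- (1 / \<sigma>) *\<^sub>R x"]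
  by (simp add: algebra_simps)

lemma moll_scaled_has_derivative:
  "((\<lambda>y. moll (rescale x \<sigma> y)) has_derivative
    (\<lambda>h. - (moll_slope (rescale x \<sigma> y) / \<sigma>) * ((rescale x \<sigma> y) \<bullet> h))) (at y)"
proof -
  have "((\<lambda>y. rescale x \<sigma> y) has_derivative (\<lambda>h. (1 / \<sigma>) *\<^sub>R h)) (at y)"
    by (auto intro!: derivative_eq_intros)
  from has_derivative_compose[OF this moll_has_derivative] show ?thesis by simp
qed

lemma moll_scaled_outside:
  assumes "0 < \<sigma>" "y \<notin> ball x \<sigma>"
  shows "moll (rescale x \<sigma> y) = 0" "moll_slope (rescale x \<sigma> y) = 0"
proof -
  have "norm (rescale x \<sigma> y) = norm (y - x) / \<sigma>" using assms by simp
  moreover have "\<sigma> \<le> norm (y - x)" using assms by (simp add: dist_norm norm_minus_commute)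
  ultimately have "norm (rescale x \<sigma> y) \<ge> 1"
    using assms(1) by (simp add: pos_le_divide_eq)
  then show "moll (rescale x \<sigma> y) = 0" "moll_slope (rescale x \<sigma> y) = 0"
    using moll_outside by blast+
qed

text \<open>
The components of the vector field whose divergence is, up to the sign and a power of the radius, the
derivative of the dilated mollifier with respect to the radius.
\<close>

lemma radial_test_function:
  fixes x :: "real^'n"
  assumes "0 < \<sigma>" "cball x \<sigma> \<subseteq> U"
  shows "(\<lambda>y. (y - x) $ j * moll (rescale x \<sigma> y)) \<in> test_functions U"
proof -
  have "C_k k (\<lambda>y. (- (x $ j) + y $ j) * moll (rescale x \<sigma> y))" for k
    by (intro C_k_mult C_k_moll_scaled C_k_add C_k_const C_k_linear bounded_linear_vec_nth)
  then have "C_k k (\<lambda>y. (y - x) $ j * moll (rescale x \<sigma> y))" for k by simp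
  moreover have sub: "{y. (y - x) $ j * moll (rescale x \<sigma> y) \<noteq> 0} \<subseteq> cball x \<sigma>" (is "?S \<subseteq> _")
  proof
    fix y assume "y \<in> ?S"
    then have "y \<in> ball x \<sigma>" using moll_scaled_outside(1)[OF assms(1), of y x] by auto
    then show "y \<in> cball x \<sigma>" by simp
  qed
  moreover have "closure ?S \<subseteq> cball x \<sigma>"
    using sub by (rule closure_minimal) simp
  moreover have "compact (closure ?S)"
    unfolding compact_closure using bounded_subset[OF bounded_cball sub] .
  ultimately show ?thesis
    using assms by (auto simp: test_functions_def compactly_in_def)
qed

lemma radial_test_function_grad:
  fixes x :: "real^'n"
  shows "grad (\<lambda>y. (y - x) $ j * moll (rescale x \<sigma> y)) y
    = (let W = rescale x \<sigma> y in moll W *\<^sub>R axis j 1 - (moll_slope W * W $ j) *\<^sub>R W)"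
proof -
  have 1: "((\<lambda>y. (y - x) $ j) has_derivative (\<lambda>h. h $ j)) (at y)"
    by (auto intro!: derivative_eq_intros bounded_linear.has_derivative[OF bounded_linear_vec_nth])
  show ?thesis
    unfolding grad_eq[OF has_derivative_mult[OF 1 moll_scaled_has_derivative]]
    by (simp add: vec_eq_iff Let_def inner_axis) (simp add: axis_def mult_ac)
qed

lemma norm_mult_self_le_1_moll_slope:
  fixes W :: "'a::euclidean_space"
  shows "moll_slope W * (norm W * norm W) \<le> 4 / bump_mass TYPE('a)"
proof (cases "norm W \<ge> 1")
  case True
  then show ?thesis using bump_mass_pos[where ?'a = 'a] by (simp add: moll_outside)
next
  case False
  then have "norm W * norm W \<le> 1" by (simp add: mult_le_one)
  then have "moll_slope W * (norm W * norm W) \<le> moll_slope W * 1"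
    by (intro mult_left_mono moll_slope_nonneg)
  then show ?thesis using moll_slope_le[of W] by linarith
qed

text \<open>
Minus the divergence of the field \<open>w \<mapsto> moll w \<cdot> w\<close>. It serves twice: as this divergence in
\<open>weak_divergence\<close>, and as the derivative of the dilated kernel in the radius in \<open>kernel_has_derivative\<close>.
\<close>

definition kernel_rate :: "'a::euclidean_space \<Rightarrow> real" where
  "kernel_rate W = (W \<bullet> W) * moll_slope W - real DIM('a) * moll W"

lemma kernel_rate_bound: "\<bar>kernel_rate W\<bar> \<le> (1 + real DIM('a)) * (4 / bump_mass TYPE('a))" for W :: "'a::euclidean_space"
proof -
  have "0 \<le> (W \<bullet> W) * moll_slope W" by (simp add: moll_slope_nonneg)
  moreover have "(W \<bullet> W) * moll_slope W \<le> 4 / bump_mass TYPE('a)"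
    using norm_mult_self_le_1_moll_slope[of W] by (simp add: power2_norm_eq_inner[symmetric] power2_eq_square mult.commute)
  moreover have "0 \<le> real DIM('a) * moll W" by (simp add: moll_nonneg)
  moreover have "real DIM('a) * moll W \<le> real DIM('a) * (4 / bump_mass TYPE('a))"
    by (intro mult_left_mono moll_le) simp
  ultimately show ?thesis unfolding kernel_rate_def distrib_right abs_le_iff by linarith
qed

lemma kernel_rate_measurable [measurable]: "kernel_rate \<in> borel_measurable borel"
  unfolding kernel_rate_def by measurable

lemma continuous_kernel_rate: "continuous_on S kernel_rate"
  unfolding kernel_rate_def by (intro continuous_intros continuous_moll)

text \<open>
The weak gradient is tested with each component of the radial field, and the diagonal entries of the
resulting vector identities are added.
\<close>

lemma weak_divergence:
  fixes v :: "real^'n \<Rightarrow> real" and G :: "real^'n \<Rightarrow> real^'n"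
  assumes v: "integrable lborel v" and G: "integrable lborel G"
    and weak: "\<And>\<psi>. \<psi> \<in> test_functions U \<Longrightarrow>
      (LBINT y. v y *\<^sub>R grad \<psi> y) = - (LBINT y. \<psi> y *\<^sub>R G y)"
    and \<sigma>: "0 < \<sigma>" "cball x \<sigma> \<subseteq> U"
  shows "(LBINT y. v y * kernel_rate (rescale x \<sigma> y))
      = (LBINT y. moll (rescale x \<sigma> y) * (G y \<bullet> (y - x)))"
proof -
  define K where "K = 4 / bump_mass TYPE(real^'n)"
  define W where "W = (\<lambda>y. rescale x \<sigma> y)"
  define \<psi> where "\<psi> = (\<lambda>j y. (y - x) $ j * moll (W y))"
  have [measurable]: "v \<in> borel_measurable borel" "G \<in> borel_measurable borel"
    using v G by (simp_all add: borel_measurable_integrable)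
  have [measurable]: "W \<in> borel_measurable borel" unfolding W_def by measurable
  have Kpos: "K > 0" using bump_mass_pos by (simp add: K_def)
  have gradc: "grad (\<psi> j) y $ i = moll (W y) * (if i = j then 1 else 0) - moll_slope (W y) * W y $ j * W y $ i" for i j y
    using radial_test_function_grad[of x j \<sigma> y] by (simp add: \<psi>_def W_def Let_def axis_def)
  have [measurable]: "(\<lambda>y. W y $ j) \<in> borel_measurable borel" for j
    unfolding W_def by (intro borel_measurable_continuous_onI continuous_intros)
  have gmeas: "(\<lambda>y. grad (\<psi> j) y) \<in> borel_measurable borel" for j
  proof -
    have "grad (\<psi> j) = (\<lambda>y. moll (W y) *\<^sub>R axis j 1 - (moll_slope (W y) * W y $ j) *\<^sub>R W y)"
      using radial_test_function_grad[of x j \<sigma>] by (simp add: \<psi>_def W_def Let_def fun_eq_iff)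
    then show ?thesis by simp
  qed
  have gbound: "norm (grad (\<psi> j) y) \<le> 2 * K" for j y
  proof -
    have "grad (\<psi> j) y = moll (W y) *\<^sub>R axis j 1 - (moll_slope (W y) * W y $ j) *\<^sub>R W y"
      using radial_test_function_grad[of x j \<sigma>] by (simp add: \<psi>_def W_def Let_def fun_eq_iff)
    also have "norm \<dots> \<le> norm (moll (W y) *\<^sub>R (axis j 1 :: real^'n)) + norm ((moll_slope (W y) * W y $ j) *\<^sub>R W y)"
      by (rule norm_triangle_ineq4)
    also have "norm (moll (W y) *\<^sub>R (axis j 1 :: real^'n)) \<le> K"
      using moll_le[of "W y"] moll_nonneg[of "W y"] by (simp add: norm_axis_1 K_def)
    also have "norm ((moll_slope (W y) * W y $ j) *\<^sub>R W y) \<le> moll_slope (W y) * (norm (W y) * norm (W y))"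
      using moll_slope_nonneg[of "W y"] component_le_norm_cart[of "W y" j]
      by (simp add: abs_mult mult.assoc mult_left_mono mult_right_mono)
    also have "\<dots> \<le> K" unfolding K_def by (rule norm_mult_self_le_1_moll_slope)
    finally show ?thesis by simp
  qed
  have vint: "integrable lborel (\<lambda>y. v y *\<^sub>R grad (\<psi> j) y)" for j
  proof (rule Bochner_Integration.integrable_bound[of _ "\<lambda>y. v y * (2 * K)"])
    show "AE y in lborel. norm (v y *\<^sub>R grad (\<psi> j) y) \<le> norm (v y * (2 * K))"
      using gbound[of j] Kpos by (auto simp: abs_mult intro!: mult_left_mono)
  qed (use v gmeas in auto)
  have psib: "\<bar>\<psi> j y\<bar> \<le> \<sigma> * K" for j y
  proof (cases "y \<in> ball x \<sigma>")
    case True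
    then have "\<bar>(y - x) $ j\<bar> \<le> \<sigma>"
      using component_le_norm_cart[of "y - x" j] by (simp add: dist_norm norm_minus_commute)
    then show ?thesis
      using moll_le[of "W y"] moll_nonneg[of "W y"] \<sigma> unfolding \<psi>_def K_def by (simp only: abs_mult) (intro mult_mono, auto)
  next
    case False
    from moll_scaled_outside(1)[OF \<sigma>(1) this] show ?thesis using \<sigma> Kpos by (simp add: \<psi>_def W_def)
  qed
  have [measurable]: "(\<lambda>y. (y - x) $ j) \<in> borel_measurable borel" for j
    by (intro borel_measurable_continuous_onI continuous_intros)
  have [measurable]: "\<psi> j \<in> borel_measurable borel" for j unfolding \<psi>_def by measurable
  have Gint: "integrable lborel (\<lambda>y. \<psi> j y *\<^sub>R G y)" for j
  proof (rule Bochner_Integration.integrable_bound[of _ "\<lambda>y. (\<sigma> * K) *\<^sub>R G y"])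
    show "AE y in lborel. norm (\<psi> j y *\<^sub>R G y) \<le> norm ((\<sigma> * K) *\<^sub>R G y)"
      using psib[of j] Kpos \<sigma> by (auto intro!: mult_right_mono)
  qed (use G in auto)
  have comp: "(LBINT y. v y * grad (\<psi> j) y $ j) = - (LBINT y. \<psi> j y * G y $ j)" for j
  proof -
    have "\<psi> j \<in> test_functions U"
      unfolding \<psi>_def W_def by (rule radial_test_function[OF \<sigma>])
    from weak[OF this] have "(LBINT y. v y *\<^sub>R grad (\<psi> j) y) $ j = - (LBINT y. \<psi> j y *\<^sub>R G y) $ j" by simp
    then show ?thesis
      using integral_bounded_linear[OF bounded_linear_vec_nth vint[of j], of j]
        integral_bounded_linear[OF bounded_linear_vec_nth Gint[of j], of j] by simp
  qed
  have ci: "integrable lborel (\<lambda>y. v y * grad (\<psi> j) y $ j)" "integrable lborel (\<lambda>y. \<psi> j y * G y $ j)" for j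
    using integrable_bounded_linear[OF bounded_linear_vec_nth vint[of j], of j]
      integrable_bounded_linear[OF bounded_linear_vec_nth Gint[of j], of j] by simp_all
  have k: "kernel_rate (W y) = - (\<Sum>j\<in>UNIV. grad (\<psi> j) y $ j)" for y
    unfolding gradc kernel_rate_def
    by (simp add: sum_subtractf sum_distrib_left[symmetric] inner_vec_def mult_ac)
  have "(LBINT y. v y * kernel_rate (W y)) = (LBINT y. - (\<Sum>j\<in>UNIV. v y * grad (\<psi> j) y $ j))"
    by (simp add: k sum_distrib_left)
  also have "\<dots> = - (\<Sum>j\<in>UNIV. (LBINT y. v y * grad (\<psi> j) y $ j))"
    using ci by simp
  also have "\<dots> = (\<Sum>j\<in>UNIV. (LBINT y. \<psi> j y * G y $ j))"
    by (simp add: comp sum_negf)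
  also have "\<dots> = (LBINT y. (\<Sum>j\<in>UNIV. \<psi> j y * G y $ j))"
    using ci by simp
  also have "(\<lambda>y. (\<Sum>j\<in>UNIV. \<psi> j y * G y $ j)) = (\<lambda>y. moll (W y) * (G y \<bullet> (y - x)))"
    by (simp add: \<psi>_def inner_vec_def sum_distrib_left mult_ac)
  finally show ?thesis by (simp add: W_def)
qed

lemma kernel_has_derivative:
  fixes y x :: "'a::euclidean_space"
  assumes \<sigma>: "0 < \<sigma>"
  shows "((\<lambda>\<sigma>. moll (rescale x \<sigma> y) / \<sigma> ^ DIM('a)) has_real_derivative
      kernel_rate (rescale x \<sigma> y) / \<sigma> ^ Suc DIM('a)) (at \<sigma>)"
proof -
  let ?n = "DIM('a)" let ?W = "rescale x \<sigma> y"
  have "((\<lambda>\<sigma>. 1 / \<sigma>) has_derivative (\<lambda>h. h * (- (1 / \<sigma>\<^sup>2)))) (at \<sigma>)"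
    using \<sigma> by (auto intro!: derivative_eq_intros simp: power2_eq_square)
  from has_derivative_scaleR_left[OF this]
  have "((\<lambda>\<sigma>. rescale x \<sigma> y) has_derivative (\<lambda>h. (h * (- (1 / \<sigma>\<^sup>2))) *\<^sub>R (y - x))) (at \<sigma>)" .
  from has_derivative_compose[OF this moll_has_derivative]
  have "((\<lambda>\<sigma>. moll (rescale x \<sigma> y)) has_derivative
      (\<lambda>h. - moll_slope ?W * (?W \<bullet> ((h * (- (1 / \<sigma>\<^sup>2))) *\<^sub>R (y - x))))) (at \<sigma>)" .
  moreover have "(\<lambda>h. - moll_slope ?W * (?W \<bullet> ((h * (- (1 / \<sigma>\<^sup>2))) *\<^sub>R (y - x))))
      = (\<lambda>h. (moll_slope ?W * (?W \<bullet> ?W) / \<sigma>) * h)"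
  proof
    fix h
    have "?W \<bullet> (y - x) = \<sigma> * (?W \<bullet> ?W)" using \<sigma> by simp
    then show "- moll_slope ?W * (?W \<bullet> ((h * (- (1 / \<sigma>\<^sup>2))) *\<^sub>R (y - x))) = (moll_slope ?W * (?W \<bullet> ?W) / \<sigma>) * h"
      using \<sigma> unfolding inner_scaleR_right[of ?W "h * (- (1 / \<sigma>\<^sup>2))"] by (simp add: power2_eq_square)
  qed
  ultimately have 1: "((\<lambda>\<sigma>. moll (rescale x \<sigma> y)) has_real_derivative moll_slope ?W * (?W \<bullet> ?W) / \<sigma>) (at \<sigma>)"
    unfolding has_field_derivative_def by (simp only:)
  have 2: "((\<lambda>\<sigma>. \<sigma> ^ ?n) has_real_derivative real ?n * \<sigma> ^ (?n - Suc 0)) (at \<sigma>)"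
    by (auto intro!: derivative_eq_intros)
  obtain m where m: "?n = Suc m" using DIM_positive[where 'a='a] by (cases "?n") auto
  have "(moll_slope ?W * (?W \<bullet> ?W) / \<sigma> * \<sigma> ^ ?n - moll ?W * (real ?n * \<sigma> ^ (?n - Suc 0))) / (\<sigma> ^ ?n * \<sigma> ^ ?n)
      = kernel_rate ?W / \<sigma> ^ Suc ?n"
    unfolding kernel_rate_def m using \<sigma> by (simp add: divide_simps) (simp add: algebra_simps)
  with DERIV_divide[OF 1 2] \<sigma> show ?thesis by simp
qed

text \<open>
The difference of the two averages is the integral over \<open>\<sigma>\<close> in \<open>[r', r]\<close> of the derivative of the dilated
kernel against \<open>v\<close>. After exchanging the integrals, \<open>weak_divergence\<close> turns the inner one into an average of
\<open>G\<close>, because the derivative in the radius is a divergence.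
\<close>

lemma spatial_average_difference:
  fixes v :: "real^'n \<Rightarrow> real" and G :: "real^'n \<Rightarrow> real^'n"
  assumes v: "integrable lborel v" and G: "integrable lborel G"
    and weak: "\<And>\<psi>. \<psi> \<in> test_functions U \<Longrightarrow>
      (LBINT y. v y *\<^sub>R grad \<psi> y) = - (LBINT y. \<psi> y *\<^sub>R G y)"
    and r: "0 < r'" "r' \<le> r" "cball x r \<subseteq> U"
  shows "\<bar>(LBINT w. moll w * v (x + r *\<^sub>R w)) - (LBINT w. moll w * v (x + r' *\<^sub>R w))\<bar>
    \<le> (r - r') * (4 / bump_mass TYPE(real^'n) / r' ^ CARD('n) * (LBINT y. indicator (ball x r) y * norm (G y)))"
proof -
  let ?n = "CARD('n)"
  define K where "K = 4 / bump_mass TYPE(real^'n)"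
  have Kpos: "K > 0" using bump_mass_pos by (simp add: K_def)
  have [measurable]: "v \<in> borel_measurable borel" "G \<in> borel_measurable borel"
    using v G by (simp_all add: borel_measurable_integrable)
  define E where "E = (\<lambda>\<sigma> y. kernel_rate (rescale x \<sigma> y) / \<sigma> ^ Suc ?n)"
  define \<eta> where "\<eta> = (\<lambda>\<sigma> y. moll (rescale x \<sigma> y) / \<sigma> ^ ?n)"
  define I where "I = (indicator {r'..r} :: real \<Rightarrow> real)"
  have [measurable]: "I \<in> borel_measurable borel" unfolding I_def by measurable
  have Iint: "integrable lborel I"
    unfolding I_def by (rule integrable_real_indicator) (simp_all add: emeasure_lborel_Icc_eq)
  have [measurable]: "\<eta> \<sigma> \<in> borel_measurable borel" for \<sigma> unfolding \<eta>_def by measurable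
  have subst: "(LBINT w. moll w * v (x + \<sigma> *\<^sub>R w)) = (LBINT y. \<eta> \<sigma> y * v y)" if "0 < \<sigma>" for \<sigma>
    using integral_affine[OF that, of "\<lambda>y. \<eta> \<sigma> y * v y" x] that by (simp add: \<eta>_def)
  have \<eta>int: "integrable lborel (\<lambda>y. \<eta> \<sigma> y * v y)" if "0 < \<sigma>" for \<sigma>
  proof -
    have "\<bar>\<eta> \<sigma> y\<bar> \<le> K / \<sigma> ^ ?n" for y
      using moll_le[of "rescale x \<sigma> y", folded K_def] moll_nonneg[of "rescale x \<sigma> y"] that
      by (simp add: \<eta>_def divide_right_mono)
    then show ?thesis using integrable_mult_bounded[OF v, of "\<eta> \<sigma>" "K / \<sigma> ^ ?n"] by (simp add: mult.commute)
  qed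
  have ftc: "has_bochner_integral lborel (\<lambda>\<sigma>. E \<sigma> y * I \<sigma>) (\<eta> r y - \<eta> r' y)" for y
    unfolding I_def
  proof (rule has_bochner_integral_FTC_Icc_real)
    fix \<sigma> assume "r' \<le> \<sigma>" "\<sigma> \<le> r"
    then have \<sigma>: "0 < \<sigma>" using r by simp
    show "((\<lambda>\<sigma>. \<eta> \<sigma> y) has_real_derivative E \<sigma> y) (at \<sigma>)"
      using kernel_has_derivative[OF \<sigma>, of y x] by (simp add: \<eta>_def E_def)
    have kc: "isCont kernel_rate z" for z :: "real^'n"
      using continuous_kernel_rate[of "UNIV :: (real^'n) set"] by (simp add: continuous_on_eq_continuous_at)
    have "isCont (\<lambda>\<sigma>. rescale x \<sigma> y) \<sigma>"
      using \<sigma> by (intro continuous_intros) auto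
    from isCont_o2[OF this kc] show "isCont (\<lambda>\<sigma>. E \<sigma> y) \<sigma>"
      unfolding E_def using \<sigma> by (intro isCont_divide) auto
  qed (use r in auto)
  define C where "C = (1 + real ?n) * K / r' ^ Suc ?n"
  have Eb: "\<bar>E \<sigma> y * I \<sigma>\<bar> \<le> C * I \<sigma>" for \<sigma> y
  proof (cases "\<sigma> \<in> {r'..r}")
    case True
    then have \<sigma>: "r' \<le> \<sigma>" "0 < \<sigma>" using r by auto
    have "\<bar>E \<sigma> y\<bar> = \<bar>kernel_rate (rescale x \<sigma> y)\<bar> / \<sigma> ^ Suc ?n"
      unfolding E_def using \<sigma> by (simp add: abs_mult power_abs)
    also have "\<dots> \<le> ((1 + real ?n) * K) / r' ^ Suc ?n"
      using kernel_rate_bound[of "rescale x \<sigma> y"] \<sigma> r Kpos unfolding K_def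
      by (intro frac_le power_mono zero_less_power) auto
    finally show ?thesis using True by (simp add: I_def C_def)
  qed (simp add: I_def)
  have int2: "integrable (lborel \<Otimes>\<^sub>M lborel) (\<lambda>(\<sigma>, y). E \<sigma> y * I \<sigma> * v y)"
  proof (rule Bochner_Integration.integrable_bound)
    have "integrable lborel (\<lambda>\<sigma>. C * I \<sigma>)" using Iint by simp
    from integrable_pair_mult[OF this v]
    show "integrable (lborel \<Otimes>\<^sub>M lborel) (\<lambda>(\<sigma>, y). C * I \<sigma> * v y)" .
    show "(\<lambda>(\<sigma>, y). E \<sigma> y * I \<sigma> * v y) \<in> borel_measurable (lborel \<Otimes>\<^sub>M lborel)"
      unfolding E_def by measurable
    have dom: "\<bar>E \<sigma> y * I \<sigma> * v y\<bar> \<le> \<bar>C * I \<sigma> * v y\<bar>" for \<sigma> y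
      unfolding abs_mult[of _ "v y"]
      by (rule mult_right_mono[OF order_trans[OF Eb abs_ge_self] abs_ge_zero])
    show "AE z in lborel \<Otimes>\<^sub>M lborel. norm (case z of (\<sigma>, y) \<Rightarrow> E \<sigma> y * I \<sigma> * v y)
        \<le> norm (case z of (\<sigma>, y) \<Rightarrow> C * I \<sigma> * v y)"
      unfolding case_prod_unfold real_norm_def by (rule AE_I2) (rule dom)
  qed
  have "(LBINT w. moll w * v (x + r *\<^sub>R w)) - (LBINT w. moll w * v (x + r' *\<^sub>R w))
      = (LBINT y. \<eta> r y * v y) - (LBINT y. \<eta> r' y * v y)"
    using r by (simp add: subst)
  also have "\<dots> = (LBINT y. (\<eta> r y - \<eta> r' y) * v y)"
    using \<eta>int[of r] \<eta>int[of r'] r by (simp add: left_diff_distrib)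
  also have "\<dots> = (LBINT y. (LBINT \<sigma>. E \<sigma> y * I \<sigma> * v y))"
  proof (rule Bochner_Integration.integral_cong)
    fix y
    show "(\<eta> r y - \<eta> r' y) * v y = (LBINT \<sigma>. E \<sigma> y * I \<sigma> * v y)"
      using has_bochner_integral_integral_eq[OF ftc[of y]] by simp
  qed simp
  also have "\<dots> = (LBINT \<sigma>. (LBINT y. E \<sigma> y * I \<sigma> * v y))"
    using lborel_pair.integral_snd[OF int2] lborel_pair.integral_fst[OF int2] by simp
  also have "\<bar>\<dots>\<bar> \<le> (LBINT \<sigma>. I \<sigma> * (K / r' ^ ?n * (LBINT y. indicator (ball x r) y * norm (G y))))"
  proof (rule order_trans[OF integral_abs_bound], rule integral_mono)
    show "integrable lborel (\<lambda>\<sigma>. \<bar>LBINT y. E \<sigma> y * I \<sigma> * v y\<bar>)"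
      using lborel_pair.integrable_fst[OF int2] by simp
    show "integrable lborel (\<lambda>\<sigma>. I \<sigma> * (K / r' ^ ?n * (LBINT y. indicator (ball x r) y * norm (G y))))"
      using Iint by simp
    fix \<sigma>
    show "\<bar>LBINT y. E \<sigma> y * I \<sigma> * v y\<bar> \<le> I \<sigma> * (K / r' ^ ?n * (LBINT y. indicator (ball x r) y * norm (G y)))"
    proof (cases "\<sigma> \<in> {r'..r}")
      case True
      then have \<sigma>: "0 < \<sigma>" "r' \<le> \<sigma>" "\<sigma> \<le> r" using r by auto
      have sub: "cball x \<sigma> \<subseteq> U" using r(3) \<sigma> by (meson subset_cball order_trans)
      have "(LBINT y. E \<sigma> y * I \<sigma> * v y) = (LBINT y. v y * kernel_rate (rescale x \<sigma> y) / \<sigma> ^ Suc ?n)"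
        using True by (simp add: E_def I_def mult.commute)
      also have "\<dots> = (LBINT y. v y * kernel_rate (rescale x \<sigma> y)) / \<sigma> ^ Suc ?n"
        by simp
      also have "\<dots> = (LBINT y. moll (rescale x \<sigma> y) * (G y \<bullet> (y - x))) / \<sigma> ^ Suc ?n"
        using weak_divergence[OF v G weak \<sigma>(1) sub] by simp
      also have "\<bar>\<dots>\<bar> = \<bar>LBINT y. moll (rescale x \<sigma> y) * (G y \<bullet> (y - x))\<bar> / \<sigma> ^ Suc ?n"
        using \<sigma> by simp
      also have "\<bar>LBINT y. moll (rescale x \<sigma> y) * (G y \<bullet> (y - x))\<bar>
          \<le> (LBINT y. K * \<sigma> * (indicator (ball x r) y * norm (G y)))"
      proof (rule order_trans[OF integral_abs_bound], rule integral_mono')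
        show "integrable lborel (\<lambda>y. K * \<sigma> * (indicator (ball x r) y * norm (G y)))"
          using integrable_mult_indicator[of "ball x r" lborel "\<lambda>y. norm (G y)"] G by simp
        fix y
        show "\<bar>moll (rescale x \<sigma> y) * (G y \<bullet> (y - x))\<bar> \<le> K * \<sigma> * (indicator (ball x r) y * norm (G y))"
        proof (cases "y \<in> ball x \<sigma>")
          case True
          then have yr: "y \<in> ball x r" "norm (y - x) \<le> \<sigma>" using \<sigma> by (auto simp: dist_norm norm_minus_commute)
          have "\<bar>G y \<bullet> (y - x)\<bar> \<le> norm (G y) * norm (y - x)" by (rule Cauchy_Schwarz_ineq2)
          also have "\<dots> \<le> norm (G y) * \<sigma>" using yr by (intro mult_left_mono) auto
          finally have "\<bar>moll (rescale x \<sigma> y)\<bar> * \<bar>G y \<bullet> (y - x)\<bar> \<le> K * (norm (G y) * \<sigma>)"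
            using moll_le[of "rescale x \<sigma> y"] moll_nonneg[of "rescale x \<sigma> y"]
            by (intro mult_mono) (auto simp: K_def bump_mass_pos less_imp_le)
          then show ?thesis using yr by (simp add: abs_mult mult_ac)
        next
          case False
          from moll_scaled_outside(1)[OF \<sigma>(1) this] show ?thesis using Kpos \<sigma> by simp
        qed
        show "0 \<le> K * \<sigma> * (indicator (ball x r) y * norm (G y))" using Kpos \<sigma> by simp
      qed
      also have "(LBINT y. K * \<sigma> * (indicator (ball x r) y * norm (G y))) / \<sigma> ^ Suc ?n
          = K / \<sigma> ^ ?n * (LBINT y. indicator (ball x r) y * norm (G y))"
        using \<sigma> by simp
      also have "\<dots> \<le> K / r' ^ ?n * (LBINT y. indicator (ball x r) y * norm (G y))"
        using \<sigma> r Kpos by (intro mult_right_mono divide_left_mono power_mono) auto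
      finally show ?thesis using True \<sigma> by (simp add: I_def divide_right_mono)
    qed (simp add: I_def)
  qed
  also have "\<dots> = (r - r') * (K / r' ^ ?n * (LBINT y. indicator (ball x r) y * norm (G y)))"
    using r by (simp add: I_def)
  finally show ?thesis by (simp add: K_def)
qed

section \<open>Caratheodory compositions and Borel representatives\<close>

lemma tendsto_fun_componentwise:
  fixes s :: "'k \<Rightarrow> 'i \<Rightarrow> 'b::topological_space"
  assumes "\<And>j. ((\<lambda>k. s k j) \<longlongrightarrow> l j) F"
  shows "(s \<longlongrightarrow> l) F"
proof -
  have "limitin (product_topology (\<lambda>i. euclidean) UNIV) s l F"
    unfolding limitin_componentwise using assms by simp
  then show ?thesis unfolding euclidean_product_topology by simp
qed

text \<open>
A simple function with values in tuples splits the domain into finitely many measurable pieces, on each of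
which the second argument of \<open>a\<close> is constant.
\<close>

lemma simple_function_tuple_composite:
  fixes s :: "nat \<Rightarrow> 'a \<Rightarrow> 'b::zero" and a :: "'a \<Rightarrow> (nat \<Rightarrow> 'b) \<Rightarrow> 'c::euclidean_space"
  assumes s: "\<And>j. j < N \<Longrightarrow> simple_function M (s j)"
    and a: "\<And>\<xi>. \<xi> \<in> tuples N \<Longrightarrow> (\<lambda>z. a z \<xi>) \<in> borel_measurable M"
  shows "(\<lambda>z. a z (\<lambda>j. if j < N then s j z else 0)) \<in> borel_measurable M"
proof -
  let ?s = "\<lambda>z j. if j < N then s j z else 0"
  define R where "R = {f. \<forall>j. (j \<in> {..<N} \<longrightarrow> f j \<in> (\<Union>j<N. s j ` space M)) \<and> (j \<notin> {..<N} \<longrightarrow> f j = 0)}"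
  have "finite R"
    unfolding R_def using s by (intro finite_set_of_finite_funs) (auto dest: simple_functionD)
  have R: "?s z \<in> R" if "z \<in> space M" for z
    using that by (auto simp: R_def)
  have Rt: "\<xi> \<in> tuples N" if "\<xi> \<in> R" for \<xi> using that by (auto simp: R_def tuples_def)
  have sets: "{z \<in> space M. ?s z = \<xi>} \<in> sets M" if "\<xi> \<in> R" for \<xi>
  proof -
    have "{z \<in> space M. ?s z = \<xi>} = {z \<in> space M. \<forall>j\<in>{..<N}. s j z = \<xi> j}"
      using that by (auto simp: fun_eq_iff R_def)
    moreover have "{z \<in> space M. s j z = \<xi> j} \<in> sets M" if "j < N" for j
    proof -
      have "{z \<in> space M. s j z = \<xi> j} = s j -` {\<xi> j} \<inter> space M" by auto
      then show ?thesis using simple_functionD(2)[OF s[OF that]] by simp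
    qed
    ultimately show ?thesis by (simp add: sets.sets_Collect_finite_All)
  qed
  have "(\<lambda>z. \<Sum>\<xi>\<in>R. indicator {z \<in> space M. ?s z = \<xi>} z *\<^sub>R a z \<xi>) \<in> borel_measurable M"
    using sets a Rt by (intro borel_measurable_sum borel_measurable_scaleR borel_measurable_indicator) auto
  moreover have "(\<Sum>\<xi>\<in>R. indicator {z \<in> space M. ?s z = \<xi>} z *\<^sub>R a z \<xi>) = a z (?s z)" if "z \<in> space M" for z
  proof -
    have "(\<Sum>\<xi>\<in>R. indicator {z \<in> space M. ?s z = \<xi>} z *\<^sub>R a z \<xi>) = (\<Sum>\<xi>\<in>R. if ?s z = \<xi> then a z \<xi> else 0)"
      using that by (intro sum.cong) (auto simp: indicator_def)
    also have "\<dots> = a z (?s z)" using \<open>finite R\<close> R[OF that] by simp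
    finally show ?thesis .
  qed
  ultimately show ?thesis by (simp cong: measurable_cong)
qed

text \<open>
The inner function is a pointwise limit of simple functions; continuity in the second argument passes the
limit through \<open>A\<close> almost everywhere, and Lebesgue measure is complete.
\<close>

lemma caratheodory_composite_measurable:
  fixes S :: "'a::euclidean_space set" and A :: "'a \<Rightarrow> (nat \<Rightarrow> real^'n) \<Rightarrow> nat \<Rightarrow> real^'n"
  assumes A: "caratheodory N S A" and S: "S \<in> sets lebesgue"
    and \<xi>: "\<And>z. z \<in> S \<Longrightarrow> \<xi> z \<in> tuples N" "\<And>i. i < N \<Longrightarrow> (\<lambda>z. \<xi> z i) \<in> borel_measurable (lebesgue_on S)"
    and i: "i < N"
  shows "(\<lambda>z. A z (\<xi> z) i) \<in> borel_measurable (lebesgue_on S)"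
proof -
  let ?M = "lebesgue_on S"
  have "\<forall>j\<in>{..<N}. \<exists>F. (\<forall>k. simple_function ?M (F k)) \<and> (\<forall>z\<in>space ?M. (\<lambda>k. F k z) \<longlonglongrightarrow> \<xi> z j)"
    using borel_measurable_implies_sequence_metric[OF \<xi>(2)] by blast
  from bchoice[OF this] obtain F where
    "\<forall>j\<in>{..<N}. (\<forall>k. simple_function ?M (F j k)) \<and> (\<forall>z\<in>space ?M. (\<lambda>k. F j k z) \<longlonglongrightarrow> \<xi> z j)"
    by (elim exE)
  then have F: "\<And>j k. j < N \<Longrightarrow> simple_function ?M (F j k)"
      "\<And>j z. j < N \<Longrightarrow> z \<in> S \<Longrightarrow> (\<lambda>k. F j k z) \<longlonglongrightarrow> \<xi> z j"
    by (simp_all add: space_restrict_space)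
  define s where "s = (\<lambda>k z j. if j < N then F j k z else 0)"
  have meas: "(\<lambda>z. A z (s k z) i) \<in> borel_measurable ?M" for k
    unfolding s_def using A i F(1) unfolding caratheodory_def
    by (intro simple_function_tuple_composite[where a = "\<lambda>z \<xi>. A z \<xi> i"]) auto
  have lim: "s k z \<in> tuples N" "(\<lambda>k. s k z) \<longlonglongrightarrow> \<xi> z" if "z \<in> S" for k z
  proof -
    show "s k z \<in> tuples N" by (simp add: s_def tuples_def)
    show "(\<lambda>k. s k z) \<longlonglongrightarrow> \<xi> z"
    proof (rule tendsto_fun_componentwise)
      fix j
      show "(\<lambda>k. s k z j) \<longlonglongrightarrow> \<xi> z j"
        using F(2)[of j z] that \<xi>(1)[OF that] by (cases "j < N") (auto simp: s_def tuples_def)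
    qed
  qed
  have "AE z in lebesgue. z \<in> S \<longrightarrow> continuous_on (tuples N) (A z)"
    using A unfolding caratheodory_def by simp
  then have "AE z in lebesgue. z \<in> S \<longrightarrow> (\<lambda>k. A z (s k z) i) \<longlonglongrightarrow> A z (\<xi> z) i"
  proof (eventually_elim, intro impI)
    fix z assume "z \<in> S \<longrightarrow> continuous_on (tuples N) (A z)" and z: "z \<in> S"
    then have "continuous_on (tuples N) (A z)" by simp
    then have c: "continuous_on (tuples N) (\<lambda>\<xi>. A z \<xi> i)"
      by (rule continuous_on_product_then_coordinatewise)
    show "(\<lambda>k. A z (s k z) i) \<longlonglongrightarrow> A z (\<xi> z) i"
      by (rule continuous_on_tendsto_compose[OF c lim(2)[OF z] \<xi>(1)[OF z]]) (simp add: lim(1)[OF z])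
  qed
  then obtain Z where Z: "Z \<in> null_sets lebesgue"
      "\<And>z. z \<notin> Z \<Longrightarrow> z \<in> S \<Longrightarrow> (\<lambda>k. A z (s k z) i) \<longlonglongrightarrow> A z (\<xi> z) i"
    unfolding completion.AE_iff_null_sets by auto
  let ?f = "\<lambda>k z. indicator (S - Z) z *\<^sub>R A z (s k z) i"
  have "(\<lambda>z. indicator (S - Z) z *\<^sub>R A z (\<xi> z) i) \<in> borel_measurable lebesgue"
  proof (rule borel_measurable_LIMSEQ_metric)
    fix k
    have m: "(\<lambda>z. indicator S z *\<^sub>R A z (s k z) i) \<in> borel_measurable lebesgue"
      using meas[of k] S by (subst (asm) borel_measurable_restrict_space_iff) auto
    have Zc: "- Z \<in> sets lebesgue" using Z(1) by (simp add: null_setsD2 Compl_in_sets_lebesgue)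
    have "(\<lambda>z. indicator (- Z) z *\<^sub>R (indicator S z *\<^sub>R A z (s k z) i)) \<in> borel_measurable lebesgue"
      by (rule borel_measurable_scaleR[OF borel_measurable_indicator[OF Zc] m])
    moreover have "(\<lambda>z. indicator (- Z) z *\<^sub>R (indicator S z *\<^sub>R A z (s k z) i)) = ?f k"
      by (auto simp: fun_eq_iff indicator_def)
    ultimately show "?f k \<in> borel_measurable lebesgue" by simp
  next
    fix z
    show "(\<lambda>k. ?f k z) \<longlonglongrightarrow> indicator (S - Z) z *\<^sub>R A z (\<xi> z) i"
      using Z(2)[of z] by (cases "z \<in> S - Z") auto
  qed
  moreover have "AE z in lebesgue. indicator (S - Z) z *\<^sub>R A z (\<xi> z) i = indicator S z *\<^sub>R A z (\<xi> z) i"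
    using AE_not_in[OF Z(1)] by eventually_elim (simp add: indicator_def)
  ultimately have "(\<lambda>z. indicator S z *\<^sub>R A z (\<xi> z) i) \<in> borel_measurable lebesgue"
    by (rule borel_measurable_AE)
  then show ?thesis
    using S by (subst borel_measurable_restrict_space_iff) auto
qed

text \<open>
Completeness of Lebesgue measure makes \<open>f\<close> measurable; for a function that is not measurable the left side
would be the default value 0.
\<close>

lemma lebesgue_integral_eq_borel:
  fixes f f' :: "'a::euclidean_space \<Rightarrow> 'b::euclidean_space"
  assumes f': "f' \<in> borel_measurable borel" and ae: "AE z in lborel. f z = f' z"
  shows "(\<integral>z. f z \<partial>lebesgue) = (LBINT z. f' z)"
proof -
  have f'l: "f' \<in> borel_measurable lebesgue" using f' by (simp add: measurable_completion)
  have ae': "AE z in lebesgue. f' z = f z" using ae by (auto simp: AE_completion_iff elim: eventually_mono)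
  have "f \<in> borel_measurable lebesgue" by (rule borel_measurable_AE[OF f'l ae'])
  then have "(\<integral>z. f z \<partial>lebesgue) = (\<integral>z. f' z \<partial>lebesgue)"
    using f'l ae' by (intro integral_cong_AE) (auto elim: eventually_mono)
  also have "\<dots> = (LBINT z. f' z)" using f' by (intro integral_completion) simp
  finally show ?thesis .
qed

text \<open>
Fubini's theorem is used for Borel functions on the product of the Borel-Lebesgue measures, so every
Lebesgue measurable datum is replaced by a Borel function on the whole space, cut off outside \<open>V\<close>.
\<close>

definition borel_version ::
    "'a::euclidean_space set \<Rightarrow> ('a \<Rightarrow> 'b::{banach, second_countable_topology}) \<Rightarrow> ('a \<Rightarrow> 'b) \<Rightarrow> bool" where
  "borel_version V f f' \<longleftrightarrow>
     integrable lborel f' \<and> (\<forall>z. z \<notin> V \<longrightarrow> f' z = 0) \<and> (AE z in lborel. z \<in> V \<longrightarrow> f' z = f z)"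

lemma borel_versionD:
  assumes "borel_version V f f'"
  shows "integrable lborel f'" "z \<notin> V \<Longrightarrow> f' z = 0" "AE z in lborel. z \<in> V \<longrightarrow> f' z = f z"
  using assms by (auto simp: borel_version_def)

lemma borel_version_choice:
  assumes "\<And>i. i < N \<Longrightarrow> \<exists>h. borel_version V (\<lambda>z. f z i) h"
  shows "\<exists>h. \<forall>i<N. borel_version V (\<lambda>z. f z i) (h i)"
  using assms by metis

lemma borel_version_real:
  fixes f :: "'a::euclidean_space \<Rightarrow> real"
  assumes S: "S \<in> sets lebesgue" and f: "f \<in> borel_measurable (lebesgue_on S)"
    and V: "V \<in> sets borel" "V \<subseteq> S" and g: "set_integrable lebesgue V g"
    and le: "AE z in lebesgue. z \<in> V \<longrightarrow> \<bar>f z\<bar> \<le> g z"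
  shows "\<exists>f'. borel_version V f f'"
proof -
  have Vl: "V \<in> sets lebesgue" using V by (simp add: sets_completionI_sets)
  have "(\<lambda>z. indicator S z *\<^sub>R f z) \<in> borel_measurable lebesgue"
    using f S by (subst (asm) borel_measurable_restrict_space_iff) auto
  then have "(\<lambda>z. indicator V z *\<^sub>R (indicator S z *\<^sub>R f z)) \<in> borel_measurable lebesgue"
    by (rule borel_measurable_scaleR[OF borel_measurable_indicator[OF Vl]])
  moreover have "(\<lambda>z. indicator V z *\<^sub>R (indicator S z *\<^sub>R f z)) = (\<lambda>z. indicator V z *\<^sub>R f z)"
    using V by (auto simp: fun_eq_iff indicator_def)
  ultimately have m: "(\<lambda>z. indicator V z *\<^sub>R f z) \<in> borel_measurable lebesgue" by simp
  have int: "integrable lebesgue (\<lambda>z. indicator V z *\<^sub>R f z)"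
  proof (rule Bochner_Integration.integrable_bound[OF g[unfolded set_integrable_def] m])
    show "AE z in lebesgue. norm (indicator V z *\<^sub>R f z) \<le> norm (indicator V z *\<^sub>R g z)"
      using le by eventually_elim (auto simp: indicator_def)
  qed
  obtain h where h: "h \<in> borel_measurable lborel" "AE z in lborel. indicator V z *\<^sub>R f z = h z"
    using completion_ex_borel_measurable_real[OF m] by auto
  have hV: "(\<lambda>z. indicator V z * h z) \<in> borel_measurable lborel" using h V by simp
  have "integrable lebesgue (\<lambda>z. indicator V z * h z)"
  proof (rule integrable_cong_AE_imp[OF int])
    show "(\<lambda>z. indicator V z * h z) \<in> borel_measurable lebesgue" using hV by (rule measurable_completion)
    have "AE z in lebesgue. indicator V z *\<^sub>R f z = h z" using h(2) by (rule AE_completion)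
    then show "AE z in lebesgue. indicator V z *\<^sub>R f z = indicator V z * h z"
      by eventually_elim (auto simp: indicator_def)
  qed
  then have "integrable lborel (\<lambda>z. indicator V z * h z)"
    using integrable_completion[OF hV] by simp
  moreover have "AE z in lborel. z \<in> V \<longrightarrow> indicator V z * h z = f z"
    using h(2) by eventually_elim (auto simp: indicator_def)
  ultimately show ?thesis
    unfolding borel_version_def by (intro exI[of _ "\<lambda>z. indicator V z * h z"]) auto
qed

lemma borel_version_vec:
  fixes f :: "'a::euclidean_space \<Rightarrow> real^'n"
  assumes S: "S \<in> sets lebesgue" and f: "f \<in> borel_measurable (lebesgue_on S)"
    and V: "V \<in> sets borel" "V \<subseteq> S" and g: "set_integrable lebesgue V g"
    and le: "AE z in lebesgue. z \<in> V \<longrightarrow> norm (f z) \<le> g z"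
  shows "\<exists>f'. borel_version V f f'"
proof -
  have "\<exists>h. borel_version V (\<lambda>z. f z $ j) h" for j
  proof (rule borel_version_real[OF S _ V g])
    show "(\<lambda>z. f z $ j) \<in> borel_measurable (lebesgue_on S)"
      by (rule measurable_compose[OF f]) (intro borel_measurable_continuous_onI continuous_intros)
    show "AE z in lebesgue. z \<in> V \<longrightarrow> \<bar>f z $ j\<bar> \<le> g z"
      using le by eventually_elim (meson component_le_norm_cart order_trans)
  qed
  then obtain h where "\<And>j. borel_version V (\<lambda>z. f z $ j) (h j)" by metis
  note h = borel_versionD[OF this]
  have eq: "(\<lambda>z. (\<chi> j. h j z)) = (\<lambda>z. \<Sum>j\<in>UNIV. h j z *\<^sub>R axis j 1)"
    by (auto simp: fun_eq_iff vec_eq_iff axis_def if_distrib cong: if_cong)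
  have "integrable lborel (\<lambda>z. (\<chi> j. h j z))"
    unfolding eq using h(1) by auto
  moreover have "AE z in lborel. \<forall>j\<in>UNIV. z \<in> V \<longrightarrow> h j z = f z $ j"
    using h(3) by (intro AE_finite_allI) auto
  then have "AE z in lborel. z \<in> V \<longrightarrow> (\<chi> j. h j z) = f z"
    by eventually_elim (auto simp: vec_eq_iff)
  ultimately show ?thesis
    unfolding borel_version_def using h(2) by (intro exI[of _ "\<lambda>z. (\<chi> j. h j z)"]) (auto simp: vec_eq_iff)
qed

section \<open>Testing the equation\<close>

text \<open>
A smooth approximation at scale \<open>h\<close> of the indicator of \<open>(s, t)\<close>. Its derivative is the difference of two
mollifiers centred at \<open>s\<close> and \<open>t\<close>, which produces time averages at the two end points.
\<close>

definition bump_in_time :: "real \<Rightarrow> real \<Rightarrow> real \<Rightarrow> real \<Rightarrow> real" where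
  "bump_in_time s t h \<tau> = smooth_step ((\<tau> - s) / h) - smooth_step ((\<tau> - t) / h)"

definition bump_in_time_deriv :: "real \<Rightarrow> real \<Rightarrow> real \<Rightarrow> real \<Rightarrow> real" where
  "bump_in_time_deriv s t h \<tau> = (moll ((\<tau> - s) / h) - moll ((\<tau> - t) / h)) / h"

lemma bump_in_time_outside:
  assumes "0 < h" "s < t" "\<tau> \<notin> {s - h<..<t + h}"
  shows "bump_in_time s t h \<tau> = 0" "bump_in_time_deriv s t h \<tau> = 0"
proof -
  have "\<tau> \<le> s - h \<or> t + h \<le> \<tau>" using assms by auto
  then have "((\<tau> - s) / h \<le> -1 \<and> (\<tau> - t) / h \<le> -1) \<or> (1 \<le> (\<tau> - s) / h \<and> 1 \<le> (\<tau> - t) / h)"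
    using assms by (auto simp: field_simps)
  moreover from this have "1 \<le> norm ((\<tau> - s) / h)" "1 \<le> norm ((\<tau> - t) / h)"
    unfolding real_norm_def by linarith+
  ultimately show "bump_in_time s t h \<tau> = 0" "bump_in_time_deriv s t h \<tau> = 0"
    using moll_outside(1)[of "(\<tau> - s) / h"] moll_outside(1)[of "(\<tau> - t) / h"]
    by (auto simp: bump_in_time_def bump_in_time_deriv_def smooth_step_eq_0 smooth_step_eq_1)
qed

lemma bump_in_time_bound: "\<bar>bump_in_time s t h \<tau>\<bar> \<le> 1"
  using smooth_step_bounds[of "(\<tau> - s) / h"] smooth_step_bounds[of "(\<tau> - t) / h"]
  by (simp add: bump_in_time_def)

lemma bump_in_time_deriv_bound:
  assumes "0 < h"
  shows "\<bar>bump_in_time_deriv s t h \<tau>\<bar> \<le> 2 * (4 / bump_mass TYPE(real)) / h"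
proof -
  have "\<bar>moll ((\<tau> - s) / h) - moll ((\<tau> - t) / h)\<bar> \<le> 2 * (4 / bump_mass TYPE(real))"
    using abs_moll_le[of "(\<tau> - s) / h"] abs_moll_le[of "(\<tau> - t) / h"] by linarith
  from divide_right_mono[OF this, of h] show ?thesis
    using assms by (simp only: bump_in_time_deriv_def abs_divide abs_of_pos less_imp_le)
qed

lemma bump_in_time_has_derivative:
  assumes "0 < h"
  shows "(bump_in_time s t h has_real_derivative bump_in_time_deriv s t h \<tau>) (at \<tau>)"
proof -
  have "((\<lambda>\<tau>. smooth_step ((\<tau> - a) / h)) has_real_derivative moll ((\<tau> - a) / h) * (1 / h)) (at \<tau>)" for a
    by (rule DERIV_chain2[OF smooth_step_has_derivative]) (use assms in \<open>auto intro!: derivative_eq_intros\<close>)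
  from DERIV_diff[OF this this] show ?thesis
    by (simp add: bump_in_time_def[abs_def] bump_in_time_deriv_def diff_divide_distrib)
qed

lemma bump_in_time_measurable [measurable]:
  "bump_in_time s t h \<in> borel_measurable borel" "bump_in_time_deriv s t h \<in> borel_measurable borel"
  unfolding bump_in_time_def[abs_def] bump_in_time_deriv_def[abs_def] by measurable

lemma C_k_bump_in_time: "C_k k (bump_in_time s t h)"
proof -
  have "C_k k (\<lambda>\<tau>. smooth_step (- a / h + (1 / h) * \<tau>))" for a
    by (rule C_k_affine[OF bounded_linear_mult_right C_k_smooth_step])
  then have "C_k k (\<lambda>\<tau>. smooth_step ((\<tau> - a) / h))" for a
    by (simp add: diff_divide_distrib)
  from C_k_add[OF this[of s] C_k_mult[OF C_k_const[of k "-1"] this[of t]]]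
  show ?thesis by (simp add: bump_in_time_def[abs_def])
qed

lemma space_time_test_function:
  fixes x :: "'a::euclidean_space"
  assumes "0 < r" "0 < h" "s < t" "cball x r \<times> {s - h..t + h} \<subseteq> U"
  shows "(\<lambda>z. b * (moll (rescale x r (fst z)) * bump_in_time s t h (snd z))) \<in> test_functions U"
proof -
  let ?f = "\<lambda>z. b * (moll (rescale x r (fst z)) * bump_in_time s t h (snd z))"
  have "C_k k (\<lambda>z::'a \<times> real. moll (- (1 / r) *\<^sub>R x + (1 / r) *\<^sub>R fst z))" for k
    by (rule C_k_affine[OF bounded_linear_const_scaleR[OF bounded_linear_fst] C_k_moll])
  then have 1: "C_k k (\<lambda>z::'a \<times> real. moll (rescale x r (fst z)))" for k
    by (simp add: scaleR_diff_right)
  have 2: "C_k k (\<lambda>z::'a \<times> real. bump_in_time s t h (0 + snd z))" for k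
    by (rule C_k_affine[OF bounded_linear_snd C_k_bump_in_time])
  have C: "C_k k ?f" for k
    using 1 2 by (intro C_k_mult C_k_const) auto
  have sub: "{z. ?f z \<noteq> 0} \<subseteq> cball x r \<times> {s - h..t + h}" (is "?S \<subseteq> ?K")
  proof
    fix z assume z: "z \<in> ?S"
    then have "fst z \<in> ball x r" using moll_scaled_outside(1)[OF assms(1), of "fst z" x] by auto
    moreover have "snd z \<in> {s - h<..<t + h}" using z bump_in_time_outside(1)[OF assms(2,3), of "snd z"] by auto
    ultimately show "z \<in> ?K" by (cases z) auto
  qed
  have K: "compact ?K" by (intro compact_Times) auto
  have "closure ?S \<subseteq> ?K" using sub by (rule closure_minimal) (rule compact_imp_closed[OF K])
  moreover have "compact (closure ?S)"
    unfolding compact_closure using bounded_subset[OF compact_imp_bounded[OF K] sub] .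
  ultimately show ?thesis using C assms by (auto simp: test_functions_def compactly_in_def)
qed

text \<open>
The spatial gradient of \<open>moll ((y - x)/r) \<cdot> bump_in_time s t h \<tau>\<close>.
\<close>

definition tested_gradient :: "real^'n \<Rightarrow> real \<Rightarrow> real \<Rightarrow> real \<Rightarrow> real \<Rightarrow> (real^'n) \<times> real \<Rightarrow> real^'n" where
  "tested_gradient x r s t h z = (let W = rescale x r (fst z)
     in (- (moll_slope W * bump_in_time s t h (snd z) / r)) *\<^sub>R W)"

lemma tested_gradient_outside:
  assumes "0 < r" "0 < h" "s < t" "z \<notin> ball x r \<times> {s - h<..<t + h}"
  shows "tested_gradient x r s t h z = 0"
proof -
  have "fst z \<notin> ball x r \<or> snd z \<notin> {s - h<..<t + h}" using assms(4) by (cases z) auto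
  then show ?thesis
    using moll_scaled_outside(2)[OF assms(1), of "fst z" x] bump_in_time_outside(1)[OF assms(2,3), of "snd z"]
    by (auto simp: tested_gradient_def Let_def)
qed

text \<open>
The slope is supported in the unit ball, which absorbs the factor \<open>W\<close>.
\<close>

lemma tested_gradient_bound:
  fixes x :: "real^'n"
  assumes "0 < r"
  shows "norm (tested_gradient x r s t h z) \<le> 4 / bump_mass TYPE(real^'n) / r"
proof -
  define K where "K = 4 / bump_mass TYPE(real^'n)"
  define W where "W = rescale x r (fst z)"
  have sW: "moll_slope W * norm W \<le> K"
  proof (cases "norm W \<ge> 1")
    case True
    then show ?thesis using bump_mass_pos[where ?'a = "real^'n"] by (simp add: moll_outside K_def)
  next
    case False
    then have "moll_slope W * norm W \<le> K * 1"
      using moll_slope_le[of W] moll_slope_nonneg[of W] unfolding K_def[symmetric] by (intro mult_mono) auto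
    then show ?thesis by simp
  qed
  have "norm (tested_gradient x r s t h z) = moll_slope W * norm W * \<bar>bump_in_time s t h (snd z)\<bar> / r"
    using assms moll_slope_nonneg[of W] by (simp add: tested_gradient_def Let_def W_def[symmetric] abs_mult)
  also have "\<dots> \<le> K * 1 / r"
    using assms sW bump_in_time_bound moll_slope_nonneg[of W] bump_mass_pos[where ?'a = "real^'n"]
    by (intro divide_right_mono mult_mono) (auto simp: K_def)
  finally show ?thesis by (simp add: K_def)
qed

lemma tested_gradient_measurable [measurable]:
  "tested_gradient x r s t h \<in> borel_measurable borel"
  unfolding tested_gradient_def[abs_def] Let_def borel_prod[symmetric] by measurable

text \<open>
The test map has the components \<open>a\<^sub>i \<psi>\<close> with one scalar function \<open>\<psi>\<close>. Its support lies in \<open>V\<close>, so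
the data may be replaced by Borel versions on \<open>V\<close>, and the integrals of the three terms exist separately.
\<close>

lemma weak_solution_tested:
  fixes u :: "(real^'n) \<times> real \<Rightarrow> nat \<Rightarrow> real" and a :: "nat \<Rightarrow> real"
  assumes ws: "weak_solution N \<Omega> T A F u Du" and V: "V \<subseteq> space_time \<Omega> T"
    and bv: "\<And>i. i < N \<Longrightarrow> borel_version V (\<lambda>z. u z i) (ut i)" "\<And>i. i < N \<Longrightarrow> borel_version V (\<lambda>z. A z (Du z) i) (At i)"
      "\<And>i. i < N \<Longrightarrow> borel_version V (\<lambda>z. F z i) (Ft i)"
    and r: "0 < r" and h: "0 < h" and st: "s < t" and sub: "cball x r \<times> {s - h..t + h} \<subseteq> V"
  shows "(LBINT z. (\<Sum>i<N. a i * ut i z) * (moll (rescale x r (fst z)) * bump_in_time_deriv s t h (snd z)))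
      = (LBINT z. (\<Sum>i<N. a i *\<^sub>R (At i z - Ft i z)) \<bullet> tested_gradient x r s t h z)"
proof -
  let ?ST = "space_time \<Omega> T"
  note ut = borel_versionD(1,3)[OF bv(1)] and At = borel_versionD(1,3)[OF bv(2)] and Ft = borel_versionD(1,3)[OF bv(3)]
  define q where "q = tested_gradient x r s t h"
  define p where "p = (\<lambda>z. moll (rescale x r (fst z)) * bump_in_time_deriv s t h (snd z))"
  define \<phi> where "\<phi> = (\<lambda>z i. if i < N then a i * (moll (rescale x r (fst z)) * bump_in_time s t h (snd z)) else 0)"
  have test: "\<phi> \<in> test_maps N ?ST"
    unfolding test_maps_def
  proof (safe intro!: CollectI)
    show "\<phi> z \<in> tuples N" for z by (simp add: \<phi>_def tuples_def)
    fix i assume "i < N"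
    then show "(\<lambda>z. \<phi> z i) \<in> test_functions ?ST"
      using space_time_test_function[OF r h st order_trans[OF sub V], of "a i"] by (simp add: \<phi>_def)
  qed
  have td: "time_deriv \<phi> z i = a i * p z" if "i < N" for z i
  proof -
    have "((\<lambda>t. \<phi> (fst z, t) i) has_real_derivative a i * p z) (at (snd z))"
      using DERIV_cmult[OF bump_in_time_has_derivative[OF h], of "a i * moll (rescale x r (fst z))"] that
      by (simp add: \<phi>_def p_def mult.assoc)
    then show ?thesis unfolding time_deriv_def by (rule DERIV_imp_deriv)
  qed
  have sg: "space_grad \<phi> z i = a i *\<^sub>R q z" if "i < N" for z i
  proof -
    have "((\<lambda>y. (a i * bump_in_time s t h (snd z)) * moll (rescale x r y)) has_derivative
      (\<lambda>k. (a i * bump_in_time s t h (snd z)) *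
        (- (moll_slope (rescale x r (fst z)) / r) * ((rescale x r (fst z)) \<bullet> k)))) (at (fst z))"
      by (rule has_derivative_mult_right[OF moll_scaled_has_derivative])
    moreover have "(\<lambda>y. \<phi> (y, snd z) i) = (\<lambda>y. (a i * bump_in_time s t h (snd z)) * moll (rescale x r y))"
      using that by (auto simp: \<phi>_def mult_ac)
    ultimately show ?thesis
      unfolding space_grad_def by (simp add: grad_eq q_def tested_gradient_def Let_def vec_eq_iff inner_axis)
  qed
  have zero: "p z = 0" "q z = 0" if "z \<notin> V" for z
  proof -
    have "ball x r \<times> {s - h<..<t + h} \<subseteq> V"
      by (rule subset_trans[OF Sigma_mono sub]) auto
    with that have "z \<notin> ball x r \<times> {s - h<..<t + h}" by blast
    then show "q z = 0" unfolding q_def by (rule tested_gradient_outside[OF r h st])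
    from \<open>z \<notin> ball x r \<times> {s - h<..<t + h}\<close> have "fst z \<notin> ball x r \<or> snd z \<notin> {s - h<..<t + h}" by (cases z) auto
    then show "p z = 0"
      using moll_scaled_outside(1)[OF r, of "fst z" x] bump_in_time_outside(2)[OF h st, of "snd z"]
      by (auto simp: p_def)
  qed
  have [measurable]: "p \<in> borel_measurable borel"
    unfolding p_def borel_prod[symmetric] by measurable
  have [measurable]: "q \<in> borel_measurable borel" unfolding q_def by measurable
  have pb: "\<bar>p z\<bar> \<le> (4 / bump_mass TYPE(real^'n)) * (2 * (4 / bump_mass TYPE(real)) / h)" for z
    unfolding p_def abs_mult using bump_mass_pos[where ?'a = "real^'n"]
    by (intro mult_mono abs_moll_le bump_in_time_deriv_bound h) auto
  have qint: "integrable lborel (\<lambda>z. f z \<bullet> q z)" if f: "integrable lborel f" for f :: "(real^'n) \<times> real \<Rightarrow> real^'n"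
  proof (rule Bochner_Integration.integrable_bound[of _ "\<lambda>z. norm (f z) * (4 / bump_mass TYPE(real^'n) / r)"])
    show "integrable lborel (\<lambda>z. norm (f z) * (4 / bump_mass TYPE(real^'n) / r))" using f by simp
    have [measurable]: "f \<in> borel_measurable borel" using f by (simp add: borel_measurable_integrable)
    show "(\<lambda>z. f z \<bullet> q z) \<in> borel_measurable lborel" by measurable
    have "\<bar>f z \<bullet> q z\<bar> \<le> norm (f z) * (4 / bump_mass TYPE(real^'n) / r)" for z
      unfolding q_def
      by (rule order_trans[OF Cauchy_Schwarz_ineq2 mult_left_mono[OF tested_gradient_bound[OF r] norm_ge_zero]])
    then show "AE z in lborel. norm (f z \<bullet> q z) \<le> norm (norm (f z) * (4 / bump_mass TYPE(real^'n) / r))"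
      unfolding real_norm_def by (intro AE_I2 order_trans[OF _ abs_ge_self])
  qed
  define U where "U = (\<lambda>z. \<Sum>i<N. a i * ut i z)"
  define AA where "AA = (\<lambda>z. \<Sum>i<N. a i *\<^sub>R At i z)"
  define FF where "FF = (\<lambda>z. \<Sum>i<N. a i *\<^sub>R Ft i z)"
  have int: "integrable lborel U" "integrable lborel AA" "integrable lborel FF"
    unfolding U_def AA_def FF_def using ut At Ft by auto
  have Up: "integrable lborel (\<lambda>z. U z * p z)"
    by (rule integrable_mult_bounded[OF int(1) _ pb]) simp
  have "AE z in lborel. \<forall>i\<in>{..<N}. z \<in> V \<longrightarrow> ut i z = u z i \<and> At i z = A z (Du z) i \<and> Ft i z = F z i"
  proof (rule AE_finite_allI)
    fix i assume "i \<in> {..<N}"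
    then have i: "i < N" by simp
    show "AE z in lborel. z \<in> V \<longrightarrow> ut i z = u z i \<and> At i z = A z (Du z) i \<and> Ft i z = F z i"
      using ut(2)[OF i] At(2)[OF i] Ft(2)[OF i] by eventually_elim auto
  qed simp
  then have ae: "AE z in lborel.
      indicator ?ST z *\<^sub>R (- tinner N (u z) (time_deriv \<phi> z) + tinner N (A z (Du z)) (space_grad \<phi> z)) = - (U z * p z) + AA z \<bullet> q z
      \<and> indicator ?ST z *\<^sub>R tinner N (F z) (space_grad \<phi> z) = FF z \<bullet> q z"
  proof eventually_elim
    fix z assume z: "\<forall>i\<in>{..<N}. z \<in> V \<longrightarrow> ut i z = u z i \<and> At i z = A z (Du z) i \<and> Ft i z = F z i"
    have t1: "tinner N (u z) (time_deriv \<phi> z) = (\<Sum>i<N. a i * u z i) * p z"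
      unfolding tinner_def sum_distrib_right by (simp add: td mult_ac)
    have t2: "tinner N f (space_grad \<phi> z) = (\<Sum>i<N. a i *\<^sub>R f i) \<bullet> q z" for f
      unfolding tinner_def by (simp add: sg inner_sum_left)
    show "indicator ?ST z *\<^sub>R (- tinner N (u z) (time_deriv \<phi> z) + tinner N (A z (Du z)) (space_grad \<phi> z)) = - (U z * p z) + AA z \<bullet> q z
      \<and> indicator ?ST z *\<^sub>R tinner N (F z) (space_grad \<phi> z) = FF z \<bullet> q z"
    proof (cases "z \<in> V")
      case True
      then have "z \<in> ?ST" using V by blast
      moreover have "U z = (\<Sum>i<N. a i * u z i)" "AA z = (\<Sum>i<N. a i *\<^sub>R A z (Du z) i)" "FF z = (\<Sum>i<N. a i *\<^sub>R F z i)"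
        unfolding U_def AA_def FF_def using z True by (auto intro!: sum.cong)
      ultimately show ?thesis by (simp add: t1 t2)
    next
      case False
      then show ?thesis by (simp add: t1 t2 zero)
    qed
  qed
  have [measurable]: "U \<in> borel_measurable borel" "AA \<in> borel_measurable borel" "FF \<in> borel_measurable borel"
    using int by (simp_all add: borel_measurable_integrable)
  have "(LINT z:?ST|lebesgue. - tinner N (u z) (time_deriv \<phi> z) + tinner N (A z (Du z)) (space_grad \<phi> z))
      = (LBINT z. - (U z * p z) + AA z \<bullet> q z)"
    unfolding set_lebesgue_integral_def
    by (rule lebesgue_integral_eq_borel) (use ae in \<open>auto elim: eventually_mono\<close>)
  also have "\<dots> = - (LBINT z. U z * p z) + (LBINT z. AA z \<bullet> q z)"
    using Up qint[OF int(2)] by simp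
  finally have 1: "(LINT z:?ST|lebesgue. - tinner N (u z) (time_deriv \<phi> z) + tinner N (A z (Du z)) (space_grad \<phi> z))
      = - (LBINT z. U z * p z) + (LBINT z. AA z \<bullet> q z)" .
  have 2: "(LINT z:?ST|lebesgue. tinner N (F z) (space_grad \<phi> z)) = (LBINT z. FF z \<bullet> q z)"
    unfolding set_lebesgue_integral_def
    by (rule lebesgue_integral_eq_borel) (use ae in \<open>auto elim: eventually_mono\<close>)
  from ws test have "(LINT z:?ST|lebesgue. - tinner N (u z) (time_deriv \<phi> z) + tinner N (A z (Du z)) (space_grad \<phi> z))
      = (LINT z:?ST|lebesgue. tinner N (F z) (space_grad \<phi> z))"
    unfolding weak_solution_def by blast
  then have "(LBINT z. U z * p z) = (LBINT z. AA z \<bullet> q z) - (LBINT z. FF z \<bullet> q z)"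
    using 1 2 by linarith
  also have "\<dots> = (LBINT z. AA z \<bullet> q z - FF z \<bullet> q z)"
    using qint[OF int(2)] qint[OF int(3)] by simp
  also have "(\<lambda>z. AA z \<bullet> q z - FF z \<bullet> q z) = (\<lambda>z. (\<Sum>i<N. a i *\<^sub>R (At i z - Ft i z)) \<bullet> q z)"
    by (simp add: AA_def FF_def inner_diff_left[symmetric] sum_subtractf[symmetric] scaleR_diff_right)
  finally show ?thesis by (simp add: U_def p_def q_def)
qed

section \<open>Null sets in products\<close>

lemma AE_lborel_not_in:
  assumes "AE z in lborel. P z"
  obtains Z where "Z \<in> sets borel" "emeasure lborel Z = 0" "\<And>z. z \<notin> Z \<Longrightarrow> P z"
proof -
  from AE_E[OF assms] obtain Z where "{z \<in> space lborel. \<not> P z} \<subseteq> Z" "emeasure lborel Z = 0" "Z \<in> sets lborel"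
    by blast
  then show ?thesis by (intro that[of Z]) auto
qed

lemma AE_lborel_pairI:
  fixes P :: "'a::euclidean_space \<times> 'b::euclidean_space \<Rightarrow> bool"
  assumes P: "{z. P z} \<in> sets borel" and ae: "AE x in lborel. AE y in lborel. P (x, y)"
  shows "AE z in lborel. P z"
proof -
  have "AE z in lborel \<Otimes>\<^sub>M lborel. P z"
  proof (rule lborel_pair.AE_pair_measure)
    show "{x \<in> space (lborel \<Otimes>\<^sub>M lborel). P x} \<in> sets (lborel \<Otimes>\<^sub>M lborel)"
      unfolding lborel_prod using P by simp
  qed (rule ae)
  then show ?thesis unfolding lborel_prod .
qed

lemma AE_lborel_fst:
  fixes P :: "'a::euclidean_space \<Rightarrow> bool"
  assumes "AE x in lborel. P x"
  shows "AE z in (lborel :: ('a \<times> 'b::euclidean_space) measure). P (fst z)"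
proof -
  obtain Z where Z[measurable]: "Z \<in> sets borel" "emeasure lborel Z = 0" "\<And>x. x \<notin> Z \<Longrightarrow> P x"
    using AE_lborel_not_in[OF assms] by blast
  have nZ: "AE x in lborel. x \<notin> Z" using Z by (intro AE_not_in) (auto simp: null_sets_def)
  have "AE z in (lborel :: ('a \<times> 'b) measure). fst z \<notin> Z"
  proof (rule AE_lborel_pairI)
    have "{z :: 'a \<times> 'b. fst z \<notin> Z} = (- Z) \<times> UNIV" by auto
    also have "\<dots> \<in> sets (borel \<Otimes>\<^sub>M borel)" using Z by (intro pair_measureI) auto
    finally show "{z :: 'a \<times> 'b. fst z \<notin> Z} \<in> sets borel" unfolding borel_prod .
    show "AE x in lborel. AE y in lborel. fst (x, y::'b) \<notin> Z" using nZ by eventually_elim simp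
  qed
  then show ?thesis by eventually_elim (rule Z(3))
qed

lemma AE_lborel_snd:
  fixes P :: "'b::euclidean_space \<Rightarrow> bool"
  assumes "AE y in lborel. P y"
  shows "AE z in (lborel :: ('a::euclidean_space \<times> 'b) measure). P (snd z)"
proof -
  obtain Z where Z: "Z \<in> sets borel" "emeasure lborel Z = 0" "\<And>x. x \<notin> Z \<Longrightarrow> P x"
    using AE_lborel_not_in[OF assms] by blast
  have nZ: "AE y in lborel. y \<notin> Z" using Z by (intro AE_not_in) (auto simp: null_sets_def)
  have "AE z in (lborel :: ('a \<times> 'b) measure). snd z \<notin> Z"
  proof (rule AE_lborel_pairI)
    have "{z :: 'a \<times> 'b. snd z \<notin> Z} = UNIV \<times> (- Z)" by auto
    also have "\<dots> \<in> sets (borel \<Otimes>\<^sub>M borel)" using Z by (intro pair_measureI) auto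
    finally show "{z :: 'a \<times> 'b. snd z \<notin> Z} \<in> sets borel" unfolding borel_prod .
    show "AE x in lborel. AE y in lborel. snd (x::'a, y) \<notin> Z" using nZ by simp
  qed
  then show ?thesis by eventually_elim (rule Z(3))
qed

lemma AE_lborel_slice:
  fixes P :: "'a::euclidean_space \<times> 'b::euclidean_space \<Rightarrow> bool"
  assumes "AE z in lborel. P z"
  shows "AE x in lborel. AE y in lborel. P (x, y)"
  by (rule lborel_pair.AE_pair) (use assms in \<open>unfold lborel_prod\<close>)

lemma AE_lborel_time_slice:
  fixes P :: "'a::euclidean_space \<times> 'b::euclidean_space \<Rightarrow> bool"
  assumes "AE z in lborel. P z"
  shows "AE y in lborel. AE x in lborel. P (x, y)"
proof -
  obtain Z where Z: "Z \<in> sets borel" "emeasure lborel Z = 0" "\<And>x. x \<notin> Z \<Longrightarrow> P x"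
    using AE_lborel_not_in[OF assms] by blast
  have "AE z in lborel. z \<notin> Z" using Z by (intro AE_not_in) (auto simp: null_sets_def)
  then have "AE x in lborel. AE y in lborel. (x, y) \<notin> Z" by (rule AE_lborel_slice)
  then have "AE y in lborel. AE x in lborel. (x, y) \<notin> Z"
  proof (rule lborel_pair.AE_commute[THEN iffD1, rotated])
    have "{x \<in> space (lborel \<Otimes>\<^sub>M lborel). (fst x, snd x) \<notin> Z} = - Z" by (auto simp: space_pair_measure)
    also have "\<dots> \<in> sets (lborel \<Otimes>\<^sub>M lborel)" unfolding lborel_prod using Z(1) by simp
    finally show "{x \<in> space (lborel \<Otimes>\<^sub>M lborel). (fst x, snd x) \<notin> Z} \<in> sets (lborel \<Otimes>\<^sub>M lborel)" .
  qed
  then show ?thesis by eventually_elim (auto intro: Z(3) elim: eventually_mono)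
qed

text \<open>
The set of bad \<open>(x,t,s)\<close> is covered by two copies of one Borel null set of space-time, each with a free time
variable added.
\<close>

lemma AE_lborel_two_times:
  fixes P :: "'a::euclidean_space \<times> real \<Rightarrow> bool"
  assumes "AE z in lborel. P z"
  shows "AE w in lborel. P (fst w, fst (snd w)) \<and> P (fst w, snd (snd w))"
proof -
  obtain Z where Z: "Z \<in> sets borel" "emeasure lborel Z = 0" "\<And>x. x \<notin> Z \<Longrightarrow> P x"
    using AE_lborel_not_in[OF assms] by blast
  have Zm[measurable]: "Z \<in> sets (borel \<Otimes>\<^sub>M borel)" using Z(1) unfolding borel_prod .
  let ?Q = "\<lambda>w::'a \<times> real \<times> real. (fst w, fst (snd w)) \<notin> Z \<and> (fst w, snd (snd w)) \<notin> Z"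
  have "AE z in lborel. z \<notin> Z" using Z by (intro AE_not_in) (auto simp: null_sets_def)
  then have ae: "AE x in lborel. AE t in lborel. (x, t) \<notin> Z" by (rule AE_lborel_slice)
  have "AE w in lborel. ?Q w"
  proof (rule AE_lborel_pairI)
    have "Measurable.pred (borel \<Otimes>\<^sub>M (borel \<Otimes>\<^sub>M borel)) ?Q" by measurable
    then show "{w. ?Q w} \<in> sets borel"
      unfolding borel_prod pred_def by simp
    show "AE x in lborel. AE p in lborel. ?Q (x, p)"
      using ae
    proof eventually_elim
      fix x assume x: "AE t in lborel. (x, t) \<notin> Z"
      from AE_lborel_fst[OF x, where ?'b = real] AE_lborel_snd[OF x, where ?'a = real]
      show "AE p in lborel. ?Q (x, p)" by eventually_elim simp
    qed
  qed
  then show ?thesis by eventually_elim (use Z(3) in blast)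
qed

lemma integrable_time_slice:
  fixes f :: "'a::euclidean_space \<times> 'b::euclidean_space \<Rightarrow> 'c::{banach, second_countable_topology}"
  assumes "integrable lborel f"
  shows "AE t in lborel. integrable lborel (\<lambda>y. f (y, t))"
proof -
  have "integrable (lborel \<Otimes>\<^sub>M lborel) (\<lambda>(y, t). f (y, t))"
    using assms unfolding lborel_prod by simp
  from lborel_pair.AE_integrable_snd[OF this] show ?thesis .
qed

lemma borel_time_slice:
  fixes f :: "'a::euclidean_space \<times> 'b::euclidean_space \<Rightarrow> 'c::topological_space"
  assumes "f \<in> borel_measurable borel"
  shows "(\<lambda>y. f (y, t)) \<in> borel_measurable borel" "(\<lambda>t. f (x, t)) \<in> borel_measurable borel"
  using assms unfolding borel_prod[symmetric] by measurable

section \<open>Euclidean norms of finite families\<close>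

text \<open>
Choosing \<open>a = d\<close> gives \<open>|d|\<^sup>2 \<le> |d| B\<close>. Scalar estimates for all linear combinations thus become an estimate
of the Euclidean norm with the same constant, whatever the number of components.
\<close>

lemma L2_set_dual:
  assumes "\<And>a. \<bar>\<Sum>i\<in>I. a i * d i\<bar> \<le> L2_set a I * B" and "0 \<le> B"
  shows "L2_set d I \<le> B"
proof -
  have "(L2_set d I)\<^sup>2 = (\<Sum>i\<in>I. d i * d i)"
    by (simp add: L2_set_def sum_nonneg power2_eq_square)
  also have "\<dots> \<le> L2_set d I * B" using assms(1)[of d] by linarith
  finally have "L2_set d I * L2_set d I \<le> L2_set d I * B" by (simp add: power2_eq_square)
  then show ?thesis
    using assms(2) L2_set_nonneg[of d I] by (cases "L2_set d I = 0") (auto simp: mult_le_cancel_left)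
qed

lemma norm_sum_le_L2_set:
  fixes G :: "'i \<Rightarrow> 'a::real_normed_vector"
  shows "norm (\<Sum>i\<in>I. a i *\<^sub>R G i) \<le> L2_set a I * L2_set (\<lambda>i. norm (G i)) I"
proof -
  have "norm (\<Sum>i\<in>I. a i *\<^sub>R G i) \<le> (\<Sum>i\<in>I. \<bar>a i\<bar> * \<bar>norm (G i)\<bar>)"
    using norm_sum[of "\<lambda>i. a i *\<^sub>R G i" I] by simp
  also have "\<dots> \<le> L2_set a I * L2_set (\<lambda>i. norm (G i)) I" by (rule L2_set_mult_ineq)
  finally show ?thesis .
qed

lemma tendsto_L2_set:
  assumes "\<And>i. i \<in> I \<Longrightarrow> ((\<lambda>j. f j i) \<longlongrightarrow> l i) F"
  shows "((\<lambda>j. L2_set (f j) I) \<longlongrightarrow> L2_set l I) F"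
  unfolding L2_set_def using assms by (intro tendsto_intros) auto

lemma L2_set_diff_triangle:
  "L2_set (\<lambda>i. f i - h i) I \<le> L2_set (\<lambda>i. f i - g i) I + L2_set (\<lambda>i. g i - h i) I"
  using L2_set_triangle_ineq[of "\<lambda>i. f i - g i" "\<lambda>i. g i - h i" I] by simp

lemma L2_set_diff_commute: "L2_set (\<lambda>i. f i - g i :: real) I = L2_set (\<lambda>i. g i - f i) I"
  by (simp add: L2_set_def power2_commute)

section \<open>Oscillation estimates at a good point\<close>

abbreviation along_space :: "real^'n \<Rightarrow> (real^'n) \<times> real" where
  "along_space w \<equiv> (w, 0)"

abbreviation along_time :: "real \<Rightarrow> (real^'n) \<times> real" where
  "along_time \<sigma> \<equiv> (0, \<sigma>)"

lemma bounded_linear_along: "bounded_linear along_space" "bounded_linear along_time"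
  by (auto intro: bounded_linear_Pair bounded_linear_ident bounded_linear_zero)

definition space_mean :: "real \<Rightarrow> ((real^'n) \<times> real \<Rightarrow> real) \<Rightarrow> (real^'n) \<times> real \<Rightarrow> real" where
  "space_mean r = smear moll along_space r"

definition ball_mean :: "real \<Rightarrow> ((real^'n) \<times> real \<Rightarrow> real) \<Rightarrow> (real^'n) \<times> real \<Rightarrow> real" where
  "ball_mean r = smear (indicator (ball 0 1)) along_space r"

definition time_mean :: "real \<Rightarrow> ((real^'n) \<times> real \<Rightarrow> real) \<Rightarrow> (real^'n) \<times> real \<Rightarrow> real" where
  "time_mean h = smear moll along_time h"

lemma space_mean_eq: "space_mean r f (x, t) = (LBINT w. moll w * f (x + r *\<^sub>R w, t))"
  by (simp add: space_mean_def smear_def)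

lemma time_mean_eq: "time_mean h f (x, t) = (LBINT \<sigma>. moll \<sigma> * f (x, t + h * \<sigma>))"
  by (simp add: time_mean_def smear_def)

lemma ball_mean_eq:
  fixes f :: "(real^'n) \<times> real \<Rightarrow> real"
  assumes f: "f \<in> borel_measurable borel" and r: "0 < r"
  shows "r ^ CARD('n) * ball_mean r f (x, t) = (LBINT y. indicator (ball x r) y * f (y, t))"
proof -
  have [measurable]: "(\<lambda>y. f (y, t)) \<in> borel_measurable borel" by (rule borel_time_slice[OF f])
  have "indicator (ball x r) (x + r *\<^sub>R w) = (indicator (ball 0 1) w :: real)" for w
    using r by (auto simp: indicator_def dist_norm)
  moreover have "(\<lambda>y. indicator (ball x r) y * f (y, t)) \<in> borel_measurable borel"
    by (intro borel_measurable_times borel_measurable_indicator borel_open open_ball) measurable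
  ultimately show ?thesis
    using integral_affine[OF r, of "\<lambda>y. indicator (ball x r) y * f (y, t)" x]
    by (simp add: ball_mean_def smear_def)
qed

lemma space_mean_integrable: "integrable lborel f \<Longrightarrow> integrable lborel (space_mean r f)"
  unfolding space_mean_def by (intro smear_integrable moll_integrable bounded_linear_along)

lemma ball_mean_integrable: "integrable lborel f \<Longrightarrow> integrable lborel (ball_mean r f)"
  unfolding ball_mean_def
  by (intro smear_integrable integrable_real_indicator bounded_linear_along) (use emeasure_lborel_ball_finite in auto)

text \<open>
\<open>M\<^sup>*g(z) \<le> m\<close>, stated through real-valued integrals for an integrable \<open>g \<ge> 0\<close>; the factor in front of \<open>m\<close>
is the volume of the cylinder.
\<close>

definition mean_bound :: "((real^'n) \<times> real \<Rightarrow> real) \<Rightarrow> (real^'n) \<times> real \<Rightarrow> real \<Rightarrow> bool" where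
  "mean_bound g z m \<longleftrightarrow> (\<forall>y r a b. 0 < r \<longrightarrow> a < b \<longrightarrow> z \<in> ball y r \<times> {a<..<b} \<longrightarrow>
     (LBINT \<zeta>. indicator (ball y r \<times> {a<..<b}) \<zeta> * g \<zeta>)
       \<le> r ^ CARD('n) * measure lborel (ball (0::real^'n) 1) * (b - a) * m)"

text \<open>
A time mollification at scale \<open>h\<close> of the average over \<open>B\<^sub>r(x)\<close> is at most a constant times the average over
the cylinder \<open>B\<^sub>r(x) \<times> (t - h, t + h)\<close>, uniformly in the ratio of \<open>h\<close> and \<open>r\<close>.
\<close>

lemma time_mean_ball_mean_bound:
  fixes g :: "(real^'n) \<times> real \<Rightarrow> real"
  assumes g: "integrable lborel g" "\<And>z. 0 \<le> g z" and r: "0 < r" and h: "0 < h" and m: "mean_bound g (x, t) m"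
  shows "time_mean h (ball_mean r g) (x, t)
    \<le> 2 * (4 / bump_mass TYPE(real)) * measure lborel (ball (0::real^'n) 1) * m"
proof -
  let ?n = "CARD('n)" let ?C = "ball x r \<times> {t - h<..<t + h}" let ?\<beta> = "measure lborel (ball (0::real^'n) 1)"
  define K where "K = 4 / bump_mass TYPE(real)"
  have gm: "g \<in> borel_measurable borel" using g by (simp add: borel_measurable_integrable)
  define f where "f = (\<lambda>\<tau>. (LBINT y. indicator ?C (y, \<tau>) * g (y, \<tau>)))"
  have gi: "integrable lborel (\<lambda>z. indicator ?C z * g z)"
    using integrable_mult_indicator[of ?C lborel g] g by (simp add: borel_open open_Times)
  have fi: "integrable lborel f" and fI: "(LBINT \<tau>. f \<tau>) = (LBINT z. indicator ?C z * g z)"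
  proof -
    have "integrable (lborel \<Otimes>\<^sub>M lborel) (\<lambda>(y, \<tau>). indicator ?C (y, \<tau>) * g (y, \<tau>))"
      using gi unfolding lborel_prod by (simp add: case_prod_unfold)
    from lborel_pair.integrable_snd[OF this] lborel_pair.integral_snd[OF this]
    show "integrable lborel f" "(LBINT \<tau>. f \<tau>) = (LBINT z. indicator ?C z * g z)"
      unfolding f_def lborel_prod by (simp_all add: case_prod_unfold)
  qed
  have f_eq: "moll \<sigma> * ball_mean r g (x, t + h * \<sigma>) \<le> K / r ^ ?n * f (t + h * \<sigma>)" for \<sigma>
  proof (cases "norm \<sigma> < 1")
    case True
    then have "\<bar>h * \<sigma>\<bar> < h" using h by (simp add: abs_mult)
    then have in_C: "t + h * \<sigma> \<in> {t - h<..<t + h}" by auto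
    have "f (t + h * \<sigma>) = (LBINT y. indicator (ball x r) y * g (y, t + h * \<sigma>))"
      unfolding f_def using in_C by (intro Bochner_Integration.integral_cong) (auto simp: indicator_def)
    then have bm: "ball_mean r g (x, t + h * \<sigma>) = f (t + h * \<sigma>) / r ^ ?n"
      using ball_mean_eq[OF gm r, of x "t + h * \<sigma>"] r by (simp add: field_simps)
    have "0 \<le> f (t + h * \<sigma>)" unfolding f_def using g(2) by simp
    then have "moll \<sigma> * (f (t + h * \<sigma>) / r ^ ?n) \<le> K * (f (t + h * \<sigma>) / r ^ ?n)"
      using moll_le[of \<sigma>] r unfolding K_def by (intro mult_right_mono) auto
    then show ?thesis by (simp add: bm)
  next
    case False
    have "0 \<le> f (t + h * \<sigma>)" unfolding f_def using g(2) by simp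
    then show ?thesis using False r bump_mass_pos[where ?'a = real] by (simp add: moll_outside K_def)
  qed
  have aff: "integrable lborel (\<lambda>\<sigma>. K / r ^ ?n * f (t + h * \<sigma>))"
    using lborel_integrable_real_affine[OF fi, of h t] h by auto
  have "time_mean h (ball_mean r g) (x, t) \<le> (LBINT \<sigma>. K / r ^ ?n * f (t + h * \<sigma>))"
    unfolding time_mean_eq
  proof (rule integral_mono'[OF aff f_eq])
    fix \<sigma>
    have "0 \<le> f (t + h * \<sigma>)" unfolding f_def using g(2) by simp
    then show "0 \<le> K / r ^ ?n * f (t + h * \<sigma>)" using r bump_mass_pos[where ?'a = real] by (simp add: K_def)
  qed
  also have "\<dots> = K / r ^ ?n * (LBINT \<sigma>. f (t + h * \<sigma>))" by simp
  also have "(LBINT \<sigma>. f (t + h * \<sigma>)) = (LBINT \<tau>. f \<tau>) / h"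
    using lborel_integral_real_affine[of h f t] h by simp
  also have "\<dots> \<le> (r ^ ?n * ?\<beta> * (2 * h) * m) / h"
  proof (rule divide_right_mono)
    have "(x, t) \<in> ?C" using r h by simp
    then have "(LBINT z. indicator ?C z * g z) \<le> r ^ ?n * ?\<beta> * ((t + h) - (t - h)) * m"
      using m[unfolded mean_bound_def, rule_format, of r "t - h" "t + h" x] r h by simp
    then show "(LBINT \<tau>. f \<tau>) \<le> r ^ ?n * ?\<beta> * (2 * h) * m" by (simp add: fI)
  qed (use h in simp)
  finally have "time_mean h (ball_mean r g) (x, t) \<le> K / r ^ ?n * ((r ^ ?n * ?\<beta> * (2 * h) * m) / h)"
    using r bump_mass_pos[where ?'a = real] by (simp add: K_def mult_left_mono divide_right_mono)
  also have "\<dots> = 2 * K * ?\<beta> * m" using r h by simp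
  finally show ?thesis by (simp add: K_def)
qed

text \<open>
The properties of a time slice that the spatial estimate uses. They hold for almost every \<open>t\<close>, and then for
all centres \<open>x\<close> and all radii at once.
\<close>

definition good_slice :: "nat \<Rightarrow> (real^'n) set \<Rightarrow> (nat \<Rightarrow> (real^'n) \<times> real \<Rightarrow> real) \<Rightarrow>
    (nat \<Rightarrow> (real^'n) \<times> real \<Rightarrow> real^'n) \<Rightarrow> ((real^'n) \<times> real \<Rightarrow> real) \<Rightarrow> real \<Rightarrow> bool" where
  "good_slice N U v G g t \<longleftrightarrow>
     (\<forall>i<N. integrable lborel (\<lambda>y. v i (y, t)) \<and> integrable lborel (\<lambda>y. G i (y, t)) \<and>
        (\<forall>\<psi>\<in>test_functions U. (LBINT y. v i (y, t) *\<^sub>R grad \<psi> y) = - (LBINT y. \<psi> y *\<^sub>R G i (y, t)))) \<and>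
     integrable lborel (\<lambda>y. g (y, t)) \<and>
     (AE y in lborel. L2_set (\<lambda>i. norm (G i (y, t))) {..<N} \<le> g (y, t))"

text \<open>
A test function and its gradient are continuous and vanish outside a compact set.
\<close>

lemma test_function_measurable:
  fixes \<psi> :: "real^'n \<Rightarrow> real"
  assumes "\<psi> \<in> test_functions U"
  shows "\<psi> \<in> borel_measurable borel" "grad \<psi> \<in> borel_measurable borel" "bounded (range \<psi>)" "bounded (range (grad \<psi>))"
proof -
  have C: "C_k 0 \<psi>" "C_k (Suc 0) \<psi>" and K: "compact (closure {x. \<psi> x \<noteq> 0})"
    using assms by (auto simp: test_functions_def compactly_in_def)
  have c0: "continuous_on UNIV \<psi>" using C(1) by simp
  have "continuous_on UNIV (\<lambda>x. frechet_derivative \<psi> (at x) (axis j 1))" for j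
    using C_k_partial[OF C(2), of "axis j 1"] by (simp add: axis_in_Basis_iff)
  then have c1: "continuous_on UNIV (grad \<psi>)"
    unfolding grad_def[abs_def] by (intro continuous_on_vec_lambda) auto
  show "\<psi> \<in> borel_measurable borel" "grad \<psi> \<in> borel_measurable borel"
    using c0 c1 by (auto intro: borel_measurable_continuous_onI)
  let ?K = "closure {x. \<psi> x \<noteq> 0}"
  have out: "\<psi> x = 0" "grad \<psi> x = 0" if "x \<notin> ?K" for x
  proof -
    show "\<psi> x = 0" using that closure_subset[of "{x. \<psi> x \<noteq> 0}"] by blast
    have "(\<psi> has_derivative (\<lambda>h. 0)) (at x)"
    proof (rule has_derivative_transform_within_open[of "\<lambda>x. 0" _ _ _ "- ?K"])
      show "0 = \<psi> y" if "y \<in> - ?K" for y using that closure_subset[of "{x. \<psi> x \<noteq> 0}"] by force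
    qed (use that in auto)
    from grad_eq[OF this] show "grad \<psi> x = 0" by (simp add: vec_eq_iff)
  qed
  have bd: "bounded (range f)" if f: "continuous_on UNIV f" and "\<And>x. x \<notin> ?K \<Longrightarrow> f x = 0"
    for f :: "real^'n \<Rightarrow> 'b::real_normed_vector"
  proof -
    have "bounded (f ` ?K)"
      by (rule compact_imp_bounded[OF compact_continuous_image[OF continuous_on_subset[OF f subset_UNIV] K]])
    then have "bounded (insert 0 (f ` ?K))" by simp
    then show ?thesis by (rule bounded_subset) (use that(2) in auto)
  qed
  show "bounded (range \<psi>)" by (rule bd[OF c0 out(1)])
  show "bounded (range (grad \<psi>))" by (rule bd[OF c1 out(2)])
qed

lemma weak_gradient_combination:
  fixes v :: "nat \<Rightarrow> real^'n \<Rightarrow> real" and G :: "nat \<Rightarrow> real^'n \<Rightarrow> real^'n"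
  assumes int: "\<And>i. i < N \<Longrightarrow> integrable lborel (v i)" "\<And>i. i < N \<Longrightarrow> integrable lborel (G i)"
    and weak: "\<And>i. i < N \<Longrightarrow> (LBINT y. v i y *\<^sub>R grad \<psi> y) = - (LBINT y. \<psi> y *\<^sub>R G i y)"
    and \<psi>: "\<psi> \<in> test_functions U"
  shows "(LBINT y. (\<Sum>i<N. a i * v i y) *\<^sub>R grad \<psi> y) = - (LBINT y. \<psi> y *\<^sub>R (\<Sum>i<N. a i *\<^sub>R G i y))"
proof -
  note [measurable] = test_function_measurable(1,2)[OF \<psi>]
  obtain B1 where B1: "\<And>y. norm (\<psi> y) \<le> B1" using test_function_measurable(3)[OF \<psi>] by (auto simp: bounded_iff)
  obtain B2 where B2: "\<And>y. norm (grad \<psi> y) \<le> B2" using test_function_measurable(4)[OF \<psi>] by (auto simp: bounded_iff)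
  have i1: "integrable lborel (\<lambda>y. v i y *\<^sub>R grad \<psi> y)" if "i < N" for i
  proof (rule Bochner_Integration.integrable_bound[of _ "\<lambda>y. B2 * v i y"])
    show "AE y in lborel. norm (v i y *\<^sub>R grad \<psi> y) \<le> norm (B2 * v i y)"
    proof (rule AE_I2)
      fix y
      have "norm (grad \<psi> y) \<le> \<bar>B2\<bar>" using B2[of y] by linarith
      then show "norm (v i y *\<^sub>R grad \<psi> y) \<le> norm (B2 * v i y)"
        unfolding norm_scaleR real_norm_def abs_mult mult.commute[of "\<bar>B2\<bar>"] by (rule mult_left_mono) simp
    qed
  qed (use int(1)[OF that] in auto)
  have i2: "integrable lborel (\<lambda>y. \<psi> y *\<^sub>R G i y)" if "i < N" for i
  proof (rule Bochner_Integration.integrable_bound[of _ "\<lambda>y. B1 *\<^sub>R G i y"])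
    show "AE y in lborel. norm (\<psi> y *\<^sub>R G i y) \<le> norm (B1 *\<^sub>R G i y)"
      using B1 by (auto intro!: mult_right_mono order_trans[OF _ abs_ge_self])
  qed (use int(2)[OF that] in auto)
  have "(LBINT y. (\<Sum>i<N. a i * v i y) *\<^sub>R grad \<psi> y) = (LBINT y. (\<Sum>i<N. a i *\<^sub>R (v i y *\<^sub>R grad \<psi> y)))"
    by (simp add: scaleR_sum_left)
  also have "\<dots> = (\<Sum>i<N. a i *\<^sub>R (LBINT y. v i y *\<^sub>R grad \<psi> y))"
    using i1 by (subst Bochner_Integration.integral_sum) (auto simp del: scaleR_scaleR)
  also have "\<dots> = - (\<Sum>i<N. a i *\<^sub>R (LBINT y. \<psi> y *\<^sub>R G i y))"
    by (simp add: weak sum_negf)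
  also have "(\<Sum>i<N. a i *\<^sub>R (LBINT y. \<psi> y *\<^sub>R G i y)) = (LBINT y. (\<Sum>i<N. a i *\<^sub>R (\<psi> y *\<^sub>R G i y)))"
    using i2 by (subst Bochner_Integration.integral_sum) (auto simp del: scaleR_scaleR)
  also have "\<dots> = (LBINT y. \<psi> y *\<^sub>R (\<Sum>i<N. a i *\<^sub>R G i y))"
    by (simp add: scaleR_sum_right mult.commute)
  finally show ?thesis .
qed

text \<open>
The scalar estimate is applied to all linear combinations of the components, whose weak gradients are the
corresponding combinations.
\<close>

lemma good_slice_average_difference:
  fixes v :: "nat \<Rightarrow> (real^'n) \<times> real \<Rightarrow> real"
  assumes gs: "good_slice N U v G g t" and r: "0 < r'" "r' \<le> r" "cball x r \<subseteq> U" and g0: "\<And>z. 0 \<le> g z"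
  shows "L2_set (\<lambda>i. space_mean r (v i) (x, t) - space_mean r' (v i) (x, t)) {..<N}
    \<le> (r - r') * (4 / bump_mass TYPE(real^'n) / r' ^ CARD('n) * (LBINT y. indicator (ball x r) y * g (y, t)))"
proof (rule L2_set_dual)
  let ?M = "4 / bump_mass TYPE(real^'n) / r' ^ CARD('n)"
  have M: "0 \<le> ?M" using bump_mass_pos[where ?'a = "real^'n"] r by simp
  show "0 \<le> (r - r') * (?M * (LBINT y. indicator (ball x r) y * g (y, t)))"
    using M r g0 by (intro mult_nonneg_nonneg integral_nonneg_AE) auto
  fix a :: "nat \<Rightarrow> real"
  let ?v = "\<lambda>y. \<Sum>i<N. a i * v i (y, t)" let ?G = "\<lambda>y. \<Sum>i<N. a i *\<^sub>R G i (y, t)"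
  have int: "\<And>i. i < N \<Longrightarrow> integrable lborel (\<lambda>y. v i (y, t))" "\<And>i. i < N \<Longrightarrow> integrable lborel (\<lambda>y. G i (y, t))"
    "integrable lborel (\<lambda>y. g (y, t))"
    and weak: "\<And>i \<psi>. i < N \<Longrightarrow> \<psi> \<in> test_functions U \<Longrightarrow> (LBINT y. v i (y, t) *\<^sub>R grad \<psi> y) = - (LBINT y. \<psi> y *\<^sub>R G i (y, t))"
    and le: "AE y in lborel. L2_set (\<lambda>i. norm (G i (y, t))) {..<N} \<le> g (y, t)"
    using gs by (auto simp: good_slice_def)
  have sm: "(LBINT w. moll w * ?v (x + \<rho> *\<^sub>R w)) = (\<Sum>i<N. a i * space_mean \<rho> (v i) (x, t))" if "0 < \<rho>" for \<rho>
  proof -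
    have "integrable lborel (\<lambda>w. moll w * v i (x + \<rho> *\<^sub>R w, t))" if i: "i < N" for i
    proof -
      have "integrable lborel (\<lambda>w. v i (x + \<rho> *\<^sub>R w, t))"
      proof -
        have [measurable]: "(\<lambda>y. v i (y, t)) \<in> borel_measurable borel"
          using int(1)[OF i] by (simp add: borel_measurable_integrable)
        have "integrable (density (distr lborel borel (\<lambda>w. x + \<rho> *\<^sub>R w)) (\<lambda>_. ennreal (\<bar>\<rho>\<bar> ^ DIM(real^'n)))) (\<lambda>y. v i (y, t))"
          using int(1)[OF i] lborel_affine[of \<rho> x] \<open>0 < \<rho>\<close> by simp
        then have "integrable (distr lborel borel (\<lambda>w. x + \<rho> *\<^sub>R w)) (\<lambda>y. \<bar>\<rho>\<bar> ^ DIM(real^'n) *\<^sub>R v i (y, t))"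
          by (subst (asm) integrable_density) auto
        then have "integrable lborel (\<lambda>w. \<bar>\<rho>\<bar> ^ DIM(real^'n) *\<^sub>R v i (x + \<rho> *\<^sub>R w, t))"
          by (subst (asm) integrable_distr_eq) auto
        then show ?thesis using \<open>0 < \<rho>\<close> by simp
      qed
      from integrable_mult_bounded[OF this, of moll "4 / bump_mass TYPE(real^'n)"] show ?thesis
        using moll_le[where ?'a = "real^'n"] moll_nonneg[where ?'a = "real^'n"] by (simp add: mult.commute)
    qed
    then show ?thesis
      unfolding space_mean_eq sum_distrib_left mult.left_commute[of "moll _"]
      by (subst Bochner_Integration.integral_sum) auto
  qed
  have "\<bar>\<Sum>i<N. a i * (space_mean r (v i) (x, t) - space_mean r' (v i) (x, t))\<bar>
      = \<bar>(LBINT w. moll w * ?v (x + r *\<^sub>R w)) - (LBINT w. moll w * ?v (x + r' *\<^sub>R w))\<bar>"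
    using r by (simp add: sm right_diff_distrib sum_subtractf)
  also have "\<dots> \<le> (r - r') * (?M * (LBINT y. indicator (ball x r) y * norm (?G y)))"
  proof (rule spatial_average_difference[where U = U])
    show "(LBINT y. ?v y *\<^sub>R grad \<psi> y) = - (LBINT y. \<psi> y *\<^sub>R ?G y)" if "\<psi> \<in> test_functions U" for \<psi>
      by (rule weak_gradient_combination[OF int(1,2) weak that]) (use that in auto)
  qed (use int r in auto)
  also have "\<dots> \<le> (r - r') * (?M * (LBINT y. L2_set a {..<N} * (indicator (ball x r) y * g (y, t))))"
  proof (rule mult_left_mono[OF mult_left_mono[OF _ M]])
    show "(LBINT y. indicator (ball x r) y * norm (?G y))
      \<le> (LBINT y. L2_set a {..<N} * (indicator (ball x r) y * g (y, t)))"
    proof (rule integral_mono_AE)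
      have "integrable lborel (\<lambda>y. norm (?G y))"
        by (intro integrable_norm Bochner_Integration.integrable_sum integrable_scaleR_right int(2)) simp
      then show "integrable lborel (\<lambda>y. indicator (ball x r) y * norm (?G y))"
        using integrable_mult_indicator[of "ball x r" lborel "\<lambda>y. norm (?G y)"] by simp
      show "integrable lborel (\<lambda>y. L2_set a {..<N} * (indicator (ball x r) y * g (y, t)))"
        using integrable_mult_indicator[of "ball x r" lborel "\<lambda>y. g (y, t)"] int(3) by simp
      show "AE y in lborel. indicator (ball x r) y * norm (?G y) \<le> L2_set a {..<N} * (indicator (ball x r) y * g (y, t))"
        using le
      proof eventually_elim
        fix y assume y: "L2_set (\<lambda>i. norm (G i (y, t))) {..<N} \<le> g (y, t)"
        have "norm (?G y) \<le> L2_set a {..<N} * L2_set (\<lambda>i. norm (G i (y, t))) {..<N}"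
          by (rule norm_sum_le_L2_set)
        also have "\<dots> \<le> L2_set a {..<N} * g (y, t)" using y by (intro mult_left_mono) auto
        finally show "indicator (ball x r) y * norm (?G y) \<le> L2_set a {..<N} * (indicator (ball x r) y * g (y, t))"
          by (auto simp: indicator_def)
      qed
    qed
    show "0 \<le> r - r'" using r by simp
  qed
  also have "(LBINT y. L2_set a {..<N} * (indicator (ball x r) y * g (y, t)))
      = L2_set a {..<N} * (LBINT y. indicator (ball x r) y * g (y, t))" by simp
  finally show "\<bar>\<Sum>i<N. a i * (space_mean r (v i) (x, t) - space_mean r' (v i) (x, t))\<bar>
      \<le> L2_set a {..<N} * ((r - r') * (?M * (LBINT y. indicator (ball x r) y * g (y, t))))"
    by (simp only: mult_ac)
qed

text \<open>
The passage from averages over cylinders to averages over a ball in one time slice: the bound for the time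
mollification does not depend on \<open>h\<close>.
\<close>

lemma ball_mean_le:
  fixes g :: "(real^'n) \<times> real \<Rightarrow> real"
  assumes g: "integrable lborel g" "\<And>z. 0 \<le> g z" and r: "0 < r" and m: "mean_bound g (x, t) m"
    and h: "\<And>j. 0 < h j" and lim: "(\<lambda>j. time_mean (h j) (ball_mean r g) (x, t)) \<longlonglongrightarrow> ball_mean r g (x, t)"
  shows "ball_mean r g (x, t) \<le> 2 * (4 / bump_mass TYPE(real)) * measure lborel (ball (0::real^'n) 1) * m"
  by (rule LIMSEQ_le_const2[OF lim]) (use time_mean_ball_mean_bound[OF g r h m] in blast)

lemma good_slice_dyadic_step:
  fixes v :: "nat \<Rightarrow> (real^'n) \<times> real \<Rightarrow> real"
  assumes gs: "good_slice N U v G g t" and g: "g \<in> borel_measurable borel" "\<And>z. 0 \<le> g z"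
    and r: "0 < r" "cball x r \<subseteq> U" and M: "ball_mean r g (x, t) \<le> M"
  shows "L2_set (\<lambda>i. space_mean r (v i) (x, t) - space_mean (r / 2) (v i) (x, t)) {..<N}
    \<le> r / 2 * (2 ^ CARD('n) * (4 / bump_mass TYPE(real^'n)) * M)"
proof -
  let ?n = "CARD('n)"
  define K where "K = 4 / bump_mass TYPE(real^'n)"
  have K: "0 < K" using bump_mass_pos by (simp add: K_def)
  have "L2_set (\<lambda>i. space_mean r (v i) (x, t) - space_mean (r / 2) (v i) (x, t)) {..<N}
      \<le> (r - r / 2) * (K / (r / 2) ^ ?n * (LBINT y. indicator (ball x r) y * g (y, t)))"
    unfolding K_def using r by (intro good_slice_average_difference[OF gs]) (auto simp: g)
  also have "(LBINT y. indicator (ball x r) y * g (y, t)) = r ^ ?n * ball_mean r g (x, t)"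
    by (rule ball_mean_eq[OF g(1) r(1), symmetric])
  also have "(r - r / 2) * (K / (r / 2) ^ ?n * (r ^ ?n * ball_mean r g (x, t))) = r / 2 * (2 ^ ?n * K * ball_mean r g (x, t))"
    using r by (simp add: power_divide)
  also have "\<dots> \<le> r / 2 * (2 ^ ?n * K * M)"
    using r K M by (intro mult_left_mono) auto
  finally show ?thesis by (simp add: K_def)
qed

text \<open>
The steps between consecutive dyadic radii form a geometric series; the sequence of averages has the value of
\<open>v\<close> as a limit along a subsequence, so the total bounds the distance to this value.
\<close>

lemma space_mean_deviation:
  fixes v :: "nat \<Rightarrow> (real^'n) \<times> real \<Rightarrow> real"
  assumes gs: "good_slice N U v G g t" and g: "g \<in> borel_measurable borel" "\<And>z. 0 \<le> g z"
    and \<rho>: "0 < \<rho>" "cball x \<rho> \<subseteq> U" and M: "\<And>k. ball_mean (\<rho> / 2 ^ k) g (x, t) \<le> M"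
    and q: "strict_mono (q :: nat \<Rightarrow> nat)"
    and lim: "\<And>i. i < N \<Longrightarrow> (\<lambda>j. space_mean (\<rho> / 2 ^ q j) (v i) (x, t)) \<longlonglongrightarrow> v i (x, t)"
  shows "L2_set (\<lambda>i. space_mean (\<rho> / 2 ^ k) (v i) (x, t) - v i (x, t)) {..<N}
    \<le> \<rho> / 2 ^ k * (2 ^ CARD('n) * (4 / bump_mass TYPE(real^'n)) * M)"
proof -
  define C where "C = 2 ^ CARD('n) * (4 / bump_mass TYPE(real^'n)) * M"
  define S where "S = (\<lambda>k i. space_mean (\<rho> / 2 ^ k) (v i) (x, t))"
  have step: "L2_set (\<lambda>i. S k i - S (Suc k) i) {..<N} \<le> \<rho> / 2 ^ k / 2 * C" for k
  proof -
    have "\<rho> / 2 ^ k \<le> \<rho>" using \<rho>(1) by (simp add: divide_le_eq)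
    then have "cball x (\<rho> / 2 ^ k) \<subseteq> U" using \<rho>(2) subset_cball by blast
    from good_slice_dyadic_step[OF gs g _ this M] \<rho>(1)
    show ?thesis by (simp add: S_def C_def mult.commute[of 2])
  qed
  have C: "0 \<le> C"
  proof -
    have "0 \<le> \<rho> / 2 * C" using order_trans[OF L2_set_nonneg step[of 0]] by simp
    then show ?thesis using \<rho>(1) by (simp add: zero_le_mult_iff)
  qed
  \<comment> \<open>The factor \<open>1 - 2\<^sup>-\<^sup>l\<close> is the partial sum of the geometric series of the steps.\<close>
  have tele: "L2_set (\<lambda>i. S k i - S (k + l) i) {..<N} \<le> \<rho> / 2 ^ k * (1 - 1 / 2 ^ l) * C" for l
  proof (induction l)
    case 0
    show ?case by (simp add: L2_set_def)
  next
    case (Suc l)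
    have "L2_set (\<lambda>i. S k i - S (k + Suc l) i) {..<N}
        \<le> L2_set (\<lambda>i. S k i - S (k + l) i) {..<N} + L2_set (\<lambda>i. S (k + l) i - S (Suc (k + l)) i) {..<N}"
      using L2_set_diff_triangle[of "S k" "S (k + Suc l)" "{..<N}" "S (k + l)"] by simp
    also have "\<dots> \<le> \<rho> / 2 ^ k * (1 - 1 / 2 ^ l) * C + \<rho> / 2 ^ (k + l) / 2 * C"
      by (rule add_mono[OF Suc.IH step])
    also have "\<dots> = \<rho> / 2 ^ k * (1 - 1 / 2 ^ Suc l) * C"
      by (simp add: power_add field_simps)
    finally show ?case .
  qed
  have "L2_set (\<lambda>i. S k i - S l i) {..<N} \<le> \<rho> / 2 ^ k * C" if "k \<le> l" for l
  proof -
    have "L2_set (\<lambda>i. S k i - S l i) {..<N} \<le> \<rho> / 2 ^ k * (1 - 1 / 2 ^ (l - k)) * C"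
      using tele[of "l - k"] that by simp
    also have "\<dots> \<le> \<rho> / 2 ^ k * 1 * C"
      using \<rho>(1) C by (intro mult_right_mono mult_left_mono) auto
    finally show ?thesis by simp
  qed
  moreover have "k \<le> q j" if "k \<le> j" for j
    using seq_suble[OF q, of j] that by linarith
  ultimately have ev: "\<forall>j\<ge>k. L2_set (\<lambda>i. S k i - S (q j) i) {..<N} \<le> \<rho> / 2 ^ k * C" by blast
  have "(\<lambda>j. L2_set (\<lambda>i. S k i - S (q j) i) {..<N}) \<longlonglongrightarrow> L2_set (\<lambda>i. S k i - v i (x, t)) {..<N}"
    using lim unfolding S_def by (intro tendsto_L2_set tendsto_diff tendsto_const) auto
  from LIMSEQ_le_const2[OF this] ev
  show ?thesis unfolding S_def C_def by blast
qed

text \<open>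
By Fubini and substitution, the two mollifiers in the derivative of \<open>bump_in_time\<close> become the time means of
the spatial average at \<open>s\<close> and at \<open>t\<close>.
\<close>

lemma tested_time_difference:
  fixes f :: "(real^'n) \<times> real \<Rightarrow> real"
  assumes f: "integrable lborel f" and r: "0 < r" and h: "0 < h"
  shows "(LBINT z. f z * (moll (rescale x r (fst z)) * bump_in_time_deriv s t h (snd z)))
    = r ^ CARD('n) * (time_mean h (space_mean r f) (x, s) - time_mean h (space_mean r f) (x, t))"
proof -
  let ?n = "CARD('n)"
  have fm: "f \<in> borel_measurable borel" using f by (simp add: borel_measurable_integrable)
  have [measurable]: "(\<lambda>y. f (y, \<tau>)) \<in> borel_measurable borel" for \<tau> by (rule borel_time_slice(1)[OF fm])
  define I where "I = (\<lambda>\<tau>. (LBINT y. f (y, \<tau>) * moll (rescale x r y)))"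
  have I_eq: "I \<tau> = r ^ ?n * space_mean r f (x, \<tau>)" for \<tau>
    using integral_affine[OF r, of "\<lambda>y. f (y, \<tau>) * moll (rescale x r y)" x] r
    by (simp add: I_def space_mean_eq mult.commute)
  have mm: "(\<lambda>z::(real^'n) \<times> real. moll (rescale x r (fst z))) \<in> borel_measurable borel"
    unfolding borel_prod[symmetric] by measurable
  have fmoll: "integrable lborel (\<lambda>z. f z * moll (rescale x r (fst z)))"
  proof (rule integrable_mult_bounded[OF f])
    show "\<bar>moll (rescale x r (fst z))\<bar> \<le> 4 / bump_mass TYPE(real^'n)" for z :: "(real^'n) \<times> real"
      by (rule abs_moll_le)
  qed (use mm in simp)
  then have "integrable (lborel \<Otimes>\<^sub>M lborel) (\<lambda>(y, \<tau>). f (y, \<tau>) * moll (rescale x r y))"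
    unfolding lborel_prod by (simp add: case_prod_unfold)
  then have Iint: "integrable lborel I" unfolding I_def by (rule lborel_pair.integrable_snd)
  have Im: "integrable lborel (\<lambda>\<tau>. I \<tau> * moll ((\<tau> - a) / h))" for a
    by (rule integrable_mult_bounded[OF Iint _ abs_moll_le]) measurable
  have one: "(LBINT \<tau>. I \<tau> * moll ((\<tau> - a) / h)) = h * (r ^ ?n * time_mean h (space_mean r f) (x, a))" for a
  proof -
    have "(LBINT \<tau>. I \<tau> * moll ((\<tau> - a) / h)) = h * (LBINT \<sigma>. I (a + h * \<sigma>) * moll \<sigma>)"
      using lborel_integral_real_affine[of h "\<lambda>\<tau>. I \<tau> * moll ((\<tau> - a) / h)" a] h by simp
    also have "(LBINT \<sigma>. I (a + h * \<sigma>) * moll \<sigma>)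
        = (LBINT \<sigma>. r ^ ?n * (moll \<sigma> * space_mean r f (x, a + h * \<sigma>)))"
      unfolding I_eq by (simp only: mult_ac)
    also have "\<dots> = r ^ ?n * time_mean h (space_mean r f) (x, a)"
      unfolding time_mean_eq by simp
    finally show ?thesis .
  qed
  have D: "integrable lborel (\<lambda>z. (f z * moll (rescale x r (fst z))) * bump_in_time_deriv s t h (snd z))"
  proof (rule integrable_mult_bounded[OF fmoll])
    show "(\<lambda>z::(real^'n) \<times> real. bump_in_time_deriv s t h (snd z)) \<in> borel_measurable lborel"
      unfolding sets_lborel[THEN measurable_cong_sets[OF _ refl]] borel_prod[symmetric] by measurable
    show "\<bar>bump_in_time_deriv s t h (snd z)\<bar> \<le> 2 * (4 / bump_mass TYPE(real)) / h" for z :: "(real^'n) \<times> real"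
      by (rule bump_in_time_deriv_bound[OF h])
  qed
  then have D2: "integrable (lborel \<Otimes>\<^sub>M lborel) (\<lambda>(y, \<tau>). f (y, \<tau>) * moll (rescale x r y) * bump_in_time_deriv s t h \<tau>)"
    unfolding lborel_prod by (simp add: case_prod_unfold)
  have "(LBINT z. f z * (moll (rescale x r (fst z)) * bump_in_time_deriv s t h (snd z)))
      = (LBINT \<tau>. (LBINT y. f (y, \<tau>) * moll (rescale x r y) * bump_in_time_deriv s t h \<tau>))"
    unfolding lborel_pair.integral_snd[OF D2] unfolding lborel_prod by (simp add: case_prod_unfold mult.assoc)
  also have "\<dots> = (LBINT \<tau>. I \<tau> * bump_in_time_deriv s t h \<tau>)"
    unfolding I_def by simp
  also have "\<dots> = (LBINT \<tau>. (I \<tau> * moll ((\<tau> - s) / h) - I \<tau> * moll ((\<tau> - t) / h)) / h)"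
    by (simp add: bump_in_time_deriv_def right_diff_distrib)
  also have "\<dots> = ((LBINT \<tau>. I \<tau> * moll ((\<tau> - s) / h)) - (LBINT \<tau>. I \<tau> * moll ((\<tau> - t) / h))) / h"
    using Im by simp
  also have "\<dots> = r ^ ?n * (time_mean h (space_mean r f) (x, s) - time_mean h (space_mean r f) (x, t))"
    using h by (simp add: one right_diff_distrib[symmetric])
  finally show ?thesis .
qed

text \<open>
The tested gradient is bounded by a constant over \<open>r\<close> and supported in the cylinder over \<open>B\<^sub>r(x)\<close> and
\<open>(s - h, t + h)\<close>, which contains \<open>(x,t)\<close>; the volume of the ball cancels the factor \<open>r\<^sup>n\<close>.
\<close>

lemma space_mean_time_difference:
  fixes v :: "nat \<Rightarrow> (real^'n) \<times> real \<Rightarrow> real" and H :: "nat \<Rightarrow> (real^'n) \<times> real \<Rightarrow> real^'n"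
  assumes v: "\<And>i. i < N \<Longrightarrow> integrable lborel (v i)" and H: "\<And>i. i < N \<Longrightarrow> integrable lborel (H i)"
    and g: "integrable lborel g" "\<And>z. 0 \<le> g z" and \<Lambda>: "0 \<le> \<Lambda>"
    and Hg: "AE z in lborel. L2_set (\<lambda>i. norm (H i z)) {..<N} \<le> \<Lambda> * g z"
    and eqn: "\<And>a. (LBINT z. (\<Sum>i<N. a i * v i z) * (moll (rescale x r (fst z)) * bump_in_time_deriv s t h (snd z)))
      = (LBINT z. (\<Sum>i<N. a i *\<^sub>R H i z) \<bullet> tested_gradient x r s t h z)"
    and r: "0 < r" and h: "0 < h" and st: "s < t" and m: "mean_bound g (x, t) m" "0 \<le> m"
  shows "L2_set (\<lambda>i. time_mean h (space_mean r (v i)) (x, s) - time_mean h (space_mean r (v i)) (x, t)) {..<N}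
    \<le> \<Lambda> * (4 / bump_mass TYPE(real^'n)) * measure lborel (ball (0::real^'n) 1) * (t - s + 2 * h) * m / r"
proof -
  let ?n = "CARD('n)" let ?C = "ball x r \<times> {s - h<..<t + h}" let ?\<beta> = "measure lborel (ball (0::real^'n) 1)"
  define K where "K = 4 / bump_mass TYPE(real^'n)"
  have K: "0 < K" using bump_mass_pos by (simp add: K_def)
  define d where "d = (\<lambda>i. time_mean h (space_mean r (v i)) (x, s) - time_mean h (space_mean r (v i)) (x, t))"
  define p where "p = (\<lambda>z. moll (rescale x r (fst z)) * bump_in_time_deriv s t h (snd z))"
  have rn: "0 < r ^ ?n" using r by simp
  have gi: "integrable lborel (\<lambda>z. indicator ?C z * g z)"
    using integrable_mult_indicator[of ?C lborel g] g by (simp add: borel_open open_Times)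
  have vp: "integrable lborel (\<lambda>z. v i z * p z)" if "i < N" for i
  proof (rule integrable_mult_bounded[OF v[OF that]])
    show "p \<in> borel_measurable lborel"
      unfolding p_def sets_lborel[THEN measurable_cong_sets[OF _ refl]] borel_prod[symmetric] by measurable
    show "\<bar>p z\<bar> \<le> K * (2 * (4 / bump_mass TYPE(real)) / h)" for z
      unfolding p_def abs_mult K_def using bump_mass_pos[where ?'a = "real^'n"]
      by (intro mult_mono abs_moll_le bump_in_time_deriv_bound h) auto
  qed
  have "L2_set d {..<N} \<le> (\<Lambda> * K / r * (LBINT z. indicator ?C z * g z)) / r ^ ?n"
  proof (rule L2_set_dual)
    have "0 \<le> (LBINT z. indicator ?C z * g z)" using g by simp
    then show "0 \<le> (\<Lambda> * K / r * (LBINT z. indicator ?C z * g z)) / r ^ ?n"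
      using \<Lambda> K r by simp
    fix a :: "nat \<Rightarrow> real"
    let ?H = "\<lambda>z. \<Sum>i<N. a i *\<^sub>R H i z"
    have "r ^ ?n * (\<Sum>i<N. a i * d i) = (\<Sum>i<N. a i * (LBINT z. v i z * p z))"
      unfolding p_def d_def sum_distrib_left
      by (intro sum.cong refl) (simp add: tested_time_difference[OF v r h])
    also have "\<dots> = (LBINT z. (\<Sum>i<N. a i * (v i z * p z)))"
      using vp by (subst Bochner_Integration.integral_sum) auto
    also have "\<dots> = (LBINT z. (\<Sum>i<N. a i * v i z) * p z)"
      by (simp add: sum_distrib_right mult.assoc)
    also have "\<dots> = (LBINT z. ?H z \<bullet> tested_gradient x r s t h z)"
      unfolding p_def by (rule eqn)
    finally have "\<bar>r ^ ?n * (\<Sum>i<N. a i * d i)\<bar> \<le> (LBINT z. \<bar>?H z \<bullet> tested_gradient x r s t h z\<bar>)"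
      using integral_abs_bound[of lborel "\<lambda>z. ?H z \<bullet> tested_gradient x r s t h z"] by simp
    also have "\<dots> \<le> (LBINT z. L2_set a {..<N} * (\<Lambda> * K / r) * (indicator ?C z * g z))"
    proof (rule integral_mono_AE')
      show "integrable lborel (\<lambda>z. L2_set a {..<N} * (\<Lambda> * K / r) * (indicator ?C z * g z))" using gi by simp
      show "AE z in lborel. \<bar>?H z \<bullet> tested_gradient x r s t h z\<bar> \<le> L2_set a {..<N} * (\<Lambda> * K / r) * (indicator ?C z * g z)"
        using Hg
      proof eventually_elim
        fix z assume z: "L2_set (\<lambda>i. norm (H i z)) {..<N} \<le> \<Lambda> * g z"
        show "\<bar>?H z \<bullet> tested_gradient x r s t h z\<bar> \<le> L2_set a {..<N} * (\<Lambda> * K / r) * (indicator ?C z * g z)"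
        proof (cases "z \<in> ?C")
          case True
          have "norm (?H z) \<le> L2_set a {..<N} * L2_set (\<lambda>i. norm (H i z)) {..<N}" by (rule norm_sum_le_L2_set)
          also have "\<dots> \<le> L2_set a {..<N} * (\<Lambda> * g z)" using z by (intro mult_left_mono) auto
          finally have 1: "norm (?H z) \<le> L2_set a {..<N} * (\<Lambda> * g z)" .
          have "\<bar>?H z \<bullet> tested_gradient x r s t h z\<bar> \<le> norm (?H z) * norm (tested_gradient x r s t h z)"
            by (rule Cauchy_Schwarz_ineq2)
          also have "\<dots> \<le> (L2_set a {..<N} * (\<Lambda> * g z)) * (K / r)"
            using 1 tested_gradient_bound[OF r, of x s t h z] \<Lambda> g(2) by (intro mult_mono) (auto simp: K_def)
          finally show ?thesis using True by (simp add: mult_ac)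
        next
          case False
          from tested_gradient_outside[OF r h st this] show ?thesis using False by simp
        qed
      qed
      show "AE z in lborel. 0 \<le> L2_set a {..<N} * (\<Lambda> * K / r) * (indicator ?C z * g z)"
        using \<Lambda> K r g(2) by (intro AE_I2 mult_nonneg_nonneg) auto
    qed
    also have "\<dots> = L2_set a {..<N} * (\<Lambda> * K / r * (LBINT z. indicator ?C z * g z))"
      by (simp only: integral_mult_right_zero mult.assoc)
    finally have "r ^ ?n * \<bar>\<Sum>i<N. a i * d i\<bar> \<le> L2_set a {..<N} * (\<Lambda> * K / r * (LBINT z. indicator ?C z * g z))"
      using rn by (simp only: abs_mult abs_of_pos)
    then show "\<bar>\<Sum>i<N. a i * d i\<bar> \<le> L2_set a {..<N} * ((\<Lambda> * K / r * (LBINT z. indicator ?C z * g z)) / r ^ ?n)"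
      using rn by (simp only: times_divide_eq_right pos_le_divide_eq mult.commute[of "r ^ ?n"])
  qed
  also have "\<dots> \<le> (\<Lambda> * K / r * (r ^ ?n * ?\<beta> * (t - s + 2 * h) * m)) / r ^ ?n"
  proof (rule divide_right_mono[OF mult_left_mono])
    have "(x, t) \<in> ?C" using r h st by simp
    then show "(LBINT z. indicator ?C z * g z) \<le> r ^ ?n * ?\<beta> * (t - s + 2 * h) * m"
      using m(1)[unfolded mean_bound_def, rule_format, of r "s - h" "t + h" x] r h st by (simp add: algebra_simps)
  qed (use \<Lambda> K r in auto)
  also have "\<dots> = \<Lambda> * K * ?\<beta> * (t - s + 2 * h) * m / r" using r by simp
  finally show ?thesis by (simp add: d_def K_def)
qed

text \<open>
The first summand comes from the two spatial deviations, the second from the drift in time.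
\<close>

definition oscillation_constant :: "'n::finite itself \<Rightarrow> real \<Rightarrow> real" where
  "oscillation_constant _ \<Lambda> = measure lborel (ball (0::real^'n) 1) * (4 / bump_mass TYPE(real^'n)) *
     (2 ^ CARD('n) * (2 * (4 / bump_mass TYPE(real))) + 2 * \<Lambda>)"

lemma dyadic_radius:
  fixes \<rho> \<delta> :: real
  assumes "0 < \<rho>" "0 < \<delta>" "\<delta> \<le> 2 * \<rho>"
  obtains k where "\<rho> / 2 ^ k \<le> \<delta>" "\<delta> \<le> 2 * (\<rho> / 2 ^ k)"
proof -
  have "(\<lambda>k. \<rho> / 2 ^ k) \<longlonglongrightarrow> 0" by (rule LIMSEQ_divide_realpow_zero) simp
  then have "\<forall>\<^sub>F k in sequentially. \<rho> / 2 ^ k < \<delta>" using assms by (simp add: order_tendstoD(2))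
  then have ex: "\<exists>k. \<rho> / 2 ^ k \<le> \<delta>" using eventually_happens'[OF sequentially_bot] less_imp_le by blast
  define k where "k = (LEAST k. \<rho> / 2 ^ k \<le> \<delta>)"
  have 1: "\<rho> / 2 ^ k \<le> \<delta>" unfolding k_def by (rule LeastI_ex[OF ex])
  have "\<delta> \<le> 2 * (\<rho> / 2 ^ k)"
  proof (cases k)
    case (Suc l)
    then have "\<not> \<rho> / 2 ^ l \<le> \<delta>" using not_less_Least[of l "\<lambda>k. \<rho> / 2 ^ k \<le> \<delta>"] by (simp add: k_def)
    then show ?thesis using Suc by simp
  qed (use assms in simp)
  with 1 show ?thesis by (rule that)
qed

text \<open>
The predicate \<open>P\<close> collects the properties of a good point: its time slice is good, and the countably many
mollifications involved converge there along fixed subsequences.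
\<close>

lemma oscillation_estimate:
  fixes v :: "nat \<Rightarrow> (real^'n) \<times> real \<Rightarrow> real" and G H :: "nat \<Rightarrow> (real^'n) \<times> real \<Rightarrow> real^'n"
  assumes \<rho>: "0 < \<rho>" and \<Lambda>: "0 \<le> \<Lambda>"
    and v: "\<And>i. i < N \<Longrightarrow> integrable lborel (v i)" and H: "\<And>i. i < N \<Longrightarrow> integrable lborel (H i)"
    and g: "integrable lborel g" "\<And>z. 0 \<le> g z"
    and Hg: "AE z in lborel. L2_set (\<lambda>i. norm (H i z)) {..<N} \<le> \<Lambda> * g z"
    and slices: "AE t in lborel. good_slice N (ball x0 (2 * \<rho>)) v G g t"
    and eqn: "\<And>a x r s t h. 0 < r \<Longrightarrow> 0 < h \<Longrightarrow> s < t \<Longrightarrow> cball x r \<times> {s - h..t + h} \<subseteq> par_cylinder x0 t0 (2 * \<rho>) \<Longrightarrow>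
      (LBINT z. (\<Sum>i<N. a i * v i z) * (moll (rescale x r (fst z)) * bump_in_time_deriv s t h (snd z)))
      = (LBINT z. (\<Sum>i<N. a i *\<^sub>R H i z) \<bullet> tested_gradient x r s t h z)"
  shows "\<exists>P. (AE z in lborel. P z) \<and>
    (\<forall>x s t ms mt. x \<in> ball x0 \<rho> \<longrightarrow> s \<in> {t0 - \<rho>\<^sup>2<..<t0 + \<rho>\<^sup>2} \<longrightarrow> t \<in> {t0 - \<rho>\<^sup>2<..<t0 + \<rho>\<^sup>2} \<longrightarrow>
      P (x, s) \<longrightarrow> P (x, t) \<longrightarrow> mean_bound g (x, s) ms \<longrightarrow> 0 \<le> ms \<longrightarrow> mean_bound g (x, t) mt \<longrightarrow> 0 \<le> mt \<longrightarrow>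
      L2_set (\<lambda>i. v i (x, t) - v i (x, s)) {..<N}
        \<le> oscillation_constant TYPE('n) \<Lambda> * sqrt \<bar>t - s\<bar> * (mt + ms))"
proof -
  let ?\<beta> = "measure lborel (ball (0::real^'n) 1)" let ?n = "CARD('n)"
  define K where "K = 4 / bump_mass TYPE(real^'n)"
  define K1 where "K1 = 4 / bump_mass TYPE(real)"
  have K: "0 < K" "0 < K1" using bump_mass_pos by (simp_all add: K_def K1_def)
  have \<beta>: "0 \<le> ?\<beta>" by simp
  define rad where "rad = (\<lambda>k::nat. \<rho> / 2 ^ k)"
  define hh where "hh = (\<lambda>j::nat. (1::real) / 2 ^ j)"
  have rad: "0 < rad k" "rad k \<le> \<rho>" for k using \<rho> by (simp_all add: rad_def divide_le_eq)
  have hh: "0 < hh j" "hh \<longlonglongrightarrow> 0" for j by (simp_all add: hh_def LIMSEQ_divide_realpow_zero)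
  have radlim: "rad \<longlonglongrightarrow> 0" unfolding rad_def by (rule LIMSEQ_divide_realpow_zero) simp
  have gm: "g \<in> borel_measurable borel" using g by (simp add: borel_measurable_integrable)
  obtain q :: "nat \<Rightarrow> nat" where q: "strict_mono q"
      "AE z in lborel. \<forall>i\<in>{..<N}. (\<lambda>j. space_mean (rad (q j)) (v i) z) \<longlonglongrightarrow> v i z"
    using smear_AE_subseq[OF moll_integrable integral_moll bounded_linear_along(1) finite_lessThan _ radlim, of N v] v
    unfolding space_mean_def by auto
  have "\<forall>k. \<exists>p::nat\<Rightarrow>nat. strict_mono p \<and>
      (AE z in lborel. \<forall>i\<in>{..<N}. (\<lambda>j. time_mean (hh (p j)) (space_mean (rad k) (v i)) z) \<longlonglongrightarrow> space_mean (rad k) (v i) z)"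
  proof
    fix k
    show "\<exists>p::nat\<Rightarrow>nat. strict_mono p \<and>
      (AE z in lborel. \<forall>i\<in>{..<N}. (\<lambda>j. time_mean (hh (p j)) (space_mean (rad k) (v i)) z) \<longlonglongrightarrow> space_mean (rad k) (v i) z)"
      unfolding time_mean_def
      by (rule smear_AE_subseq[OF moll_integrable integral_moll bounded_linear_along(2) finite_lessThan _ hh(2)])
        (simp add: space_mean_integrable v)
  qed
  then obtain p where p: "\<And>k. strict_mono (p k :: nat \<Rightarrow> nat)"
      "\<And>k. AE z in lborel. \<forall>i\<in>{..<N}. (\<lambda>j. time_mean (hh (p k j)) (space_mean (rad k) (v i)) z) \<longlonglongrightarrow> space_mean (rad k) (v i) z"
    unfolding choice_iff by blast
  have "\<forall>k. \<exists>p::nat\<Rightarrow>nat. strict_mono p \<and>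
      (AE z in lborel. \<forall>i\<in>{()}. (\<lambda>j. time_mean (hh (p j)) (ball_mean (rad k) g) z) \<longlonglongrightarrow> ball_mean (rad k) g z)"
  proof
    fix k
    show "\<exists>p::nat\<Rightarrow>nat. strict_mono p \<and>
      (AE z in lborel. \<forall>i\<in>{()}. (\<lambda>j. time_mean (hh (p j)) (ball_mean (rad k) g) z) \<longlonglongrightarrow> ball_mean (rad k) g z)"
      unfolding time_mean_def
      by (rule smear_AE_subseq[OF moll_integrable integral_moll bounded_linear_along(2) _ _ hh(2)])
        (simp_all add: ball_mean_integrable g)
  qed
  then obtain p' where p': "\<And>k. AE z in lborel. (\<lambda>j. time_mean (hh (p' k j)) (ball_mean (rad k) g) z) \<longlonglongrightarrow> ball_mean (rad k) g z"
    unfolding choice_iff by auto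
  define P where "P = (\<lambda>z. good_slice N (ball x0 (2 * \<rho>)) v G g (snd z) \<and>
     (\<forall>i\<in>{..<N}. (\<lambda>j. space_mean (rad (q j)) (v i) z) \<longlonglongrightarrow> v i z) \<and>
     (\<forall>k. \<forall>i\<in>{..<N}. (\<lambda>j. time_mean (hh (p k j)) (space_mean (rad k) (v i)) z) \<longlonglongrightarrow> space_mean (rad k) (v i) z) \<and>
     (\<forall>k. (\<lambda>j. time_mean (hh (p' k j)) (ball_mean (rad k) g) z) \<longlonglongrightarrow> ball_mean (rad k) g z))"
  have aeP: "AE z in lborel. P z"
    unfolding P_def using AE_lborel_snd[OF slices] q(2) p(2) p'
    by (simp add: AE_conj_iff AE_all_countable)
  have deviation: "L2_set (\<lambda>i. space_mean (rad k) (v i) (x, t) - v i (x, t)) {..<N} \<le> rad k * (2 ^ ?n * K * (2 * K1 * ?\<beta> * m))"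
    if x: "x \<in> ball x0 \<rho>" and Pz: "P (x, t)" and m: "mean_bound g (x, t) m" for x t m k
    unfolding rad_def K_def
  proof (rule space_mean_deviation[OF _ gm g(2) \<rho> _ _ q(1)])
    show "good_slice N (ball x0 (2 * \<rho>)) v G g t" using Pz by (simp add: P_def)
    show "cball x \<rho> \<subseteq> ball x0 (2 * \<rho>)"
    proof
      fix y assume "y \<in> cball x \<rho>"
      then show "y \<in> ball x0 (2 * \<rho>)" using x dist_triangle[of x0 y x] by simp
    qed
    show "ball_mean (\<rho> / 2 ^ k) g (x, t) \<le> 2 * K1 * ?\<beta> * m" for k
      unfolding K1_def
      by (rule ball_mean_le[where h = "\<lambda>j. hh (p' k j)", OF g rad(1)[unfolded rad_def] m hh(1)])
        (use Pz in \<open>simp add: P_def rad_def\<close>)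
    show "(\<lambda>j. space_mean (\<rho> / 2 ^ q j) (v i) (x, t)) \<longlonglongrightarrow> v i (x, t)" if "i < N" for i
      using Pz that by (simp add: P_def rad_def)
  qed
  have drift: "L2_set (\<lambda>i. space_mean (rad k) (v i) (x, s) - space_mean (rad k) (v i) (x, t)) {..<N}
      \<le> \<Lambda> * K * ?\<beta> * (t - s) * m / rad k"
    if x: "x \<in> ball x0 \<rho>" and Ps: "P (x, s)" and Pt: "P (x, t)" and m: "mean_bound g (x, t) m" "0 \<le> m"
      and st: "s < t" and sI: "s \<in> {t0 - \<rho>\<^sup>2<..<t0 + \<rho>\<^sup>2}" and tI: "t \<in> {t0 - \<rho>\<^sup>2<..<t0 + \<rho>\<^sup>2}" for x s t m k
  proof -
    let ?h = "\<lambda>j. hh (p k j)"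
    have hlim: "?h \<longlonglongrightarrow> 0"
      using LIMSEQ_subseq_LIMSEQ[OF hh(2) p(1)[of k]] by (simp add: o_def)
    have "(\<lambda>j. L2_set (\<lambda>i. time_mean (?h j) (space_mean (rad k) (v i)) (x, s) - time_mean (?h j) (space_mean (rad k) (v i)) (x, t)) {..<N})
        \<longlonglongrightarrow> L2_set (\<lambda>i. space_mean (rad k) (v i) (x, s) - space_mean (rad k) (v i) (x, t)) {..<N}"
      using Ps Pt by (intro tendsto_L2_set tendsto_diff) (auto simp: P_def)
    moreover have "(\<lambda>j. \<Lambda> * K * ?\<beta> * (t - s + 2 * ?h j) * m / rad k) \<longlonglongrightarrow> \<Lambda> * K * ?\<beta> * (t - s + 2 * 0) * m / rad k"
      using rad(1)[of k] by (intro tendsto_intros hlim) auto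
    moreover have "\<forall>\<^sub>F j in sequentially.
        L2_set (\<lambda>i. time_mean (?h j) (space_mean (rad k) (v i)) (x, s) - time_mean (?h j) (space_mean (rad k) (v i)) (x, t)) {..<N}
        \<le> \<Lambda> * K * ?\<beta> * (t - s + 2 * ?h j) * m / rad k"
    proof -
      have "\<forall>\<^sub>F j in sequentially. ?h j < \<rho>\<^sup>2" using order_tendstoD(2)[OF hlim] \<rho> by simp
      \<comment> \<open>The doubled cylinder leaves room \<open>3\<rho>\<^sup>2\<close> in time around \<open>s\<close> and \<open>t\<close>.\<close>
      then show ?thesis
      proof eventually_elim
        fix j assume h: "?h j < \<rho>\<^sup>2"
        have sub: "cball x (rad k) \<times> {s - ?h j..t + ?h j} \<subseteq> par_cylinder x0 t0 (2 * \<rho>)"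
          unfolding par_cylinder_def
        proof (rule Sigma_mono)
          show "cball x (rad k) \<subseteq> ball x0 (2 * \<rho>)"
          proof
            fix y assume "y \<in> cball x (rad k)"
            then show "y \<in> ball x0 (2 * \<rho>)" using x rad(2)[of k] dist_triangle[of x0 y x] by simp
          qed
          show "{s - ?h j..t + ?h j} \<subseteq> {t0 - (2 * \<rho>)\<^sup>2<..<t0 + (2 * \<rho>)\<^sup>2}"
            using h sI tI \<rho> by (auto simp: power_mult_distrib)
        qed
        show "L2_set (\<lambda>i. time_mean (?h j) (space_mean (rad k) (v i)) (x, s) - time_mean (?h j) (space_mean (rad k) (v i)) (x, t)) {..<N}
          \<le> \<Lambda> * K * ?\<beta> * (t - s + 2 * ?h j) * m / rad k"
          unfolding K_def
          by (rule space_mean_time_difference[OF v H g \<Lambda> Hg eqn[OF rad(1) hh(1) st sub] rad(1) hh(1) st m])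
      qed
    qed
    ultimately have "L2_set (\<lambda>i. space_mean (rad k) (v i) (x, s) - space_mean (rad k) (v i) (x, t)) {..<N}
        \<le> \<Lambda> * K * ?\<beta> * (t - s + 2 * 0) * m / rad k"
      by (intro tendsto_le[OF sequentially_bot])
    then show ?thesis by simp
  qed
  let ?c = "oscillation_constant TYPE('n) \<Lambda>"
  have main: "L2_set (\<lambda>i. v i (x, s) - v i (x, t)) {..<N} \<le> ?c * sqrt (t - s) * (mt + ms)"
    if x: "x \<in> ball x0 \<rho>" and Ps: "P (x, s)" and Pt: "P (x, t)" and ms: "mean_bound g (x, s) ms" "0 \<le> ms"
      and mt: "mean_bound g (x, t) mt" "0 \<le> mt"
      and st: "s < t" and sI: "s \<in> {t0 - \<rho>\<^sup>2<..<t0 + \<rho>\<^sup>2}" and tI: "t \<in> {t0 - \<rho>\<^sup>2<..<t0 + \<rho>\<^sup>2}" for x s t ms mt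
  proof -
    define \<delta> where "\<delta> = sqrt (t - s)"
    have \<delta>: "0 < \<delta>" "\<delta> * \<delta> = t - s" using st by (simp_all add: \<delta>_def)
    have "t - s \<le> (2 * \<rho>)\<^sup>2" using sI tI by (simp add: power_mult_distrib)
    then have "\<delta> \<le> 2 * \<rho>" unfolding \<delta>_def using \<rho> by (simp add: real_le_lsqrt)
    \<comment> \<open>A dyadic radius comparable to \<open>\<delta>\<close>, the square root of \<open>t - s\<close>; for \<open>\<delta> > \<rho>\<close> it is \<open>\<rho>\<close> itself.\<close>
    then obtain k where k: "rad k \<le> \<delta>" "\<delta> \<le> 2 * rad k"
      unfolding rad_def using dyadic_radius[OF \<rho> \<delta>(1)] by blast
    define A where "A = 2 ^ ?n * K * (2 * K1 * ?\<beta>)"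
    define B where "B = \<Lambda> * K * ?\<beta>"
    have AB: "0 \<le> A" "0 \<le> B" using K \<Lambda> by (simp_all add: A_def B_def)
    have dev: "L2_set (\<lambda>i. space_mean (rad k) (v i) (x, \<tau>) - v i (x, \<tau>)) {..<N} \<le> \<delta> * (A * m)"
      if "P (x, \<tau>)" "mean_bound g (x, \<tau>) m" "0 \<le> m" for \<tau> m
    proof -
      have "L2_set (\<lambda>i. space_mean (rad k) (v i) (x, \<tau>) - v i (x, \<tau>)) {..<N} \<le> rad k * (A * m)"
        using deviation[OF x that(1,2), of k] by (simp add: A_def mult.assoc)
      also have "\<dots> \<le> \<delta> * (A * m)" using k(1) AB that(3) by (intro mult_right_mono) auto
      finally show ?thesis .
    qed
    have "L2_set (\<lambda>i. space_mean (rad k) (v i) (x, s) - space_mean (rad k) (v i) (x, t)) {..<N} \<le> B * (t - s) * mt / rad k"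
      using drift[OF x Ps Pt mt st sI tI, of k] by (simp add: B_def)
    also have "\<dots> = (B * mt * \<delta>) * (\<delta> / rad k)" by (simp add: \<delta>(2)[symmetric] mult_ac)
    also have "\<dots> \<le> (B * mt * \<delta>) * 2"
      using k(2) rad(1)[of k] AB mt(2) \<delta>(1) by (intro mult_left_mono) (auto simp: divide_le_eq)
    finally have dr: "L2_set (\<lambda>i. space_mean (rad k) (v i) (x, s) - space_mean (rad k) (v i) (x, t)) {..<N} \<le> 2 * B * mt * \<delta>"
      by (simp add: mult_ac)
    have "L2_set (\<lambda>i. v i (x, s) - v i (x, t)) {..<N}
        \<le> L2_set (\<lambda>i. v i (x, s) - space_mean (rad k) (v i) (x, s)) {..<N}
          + L2_set (\<lambda>i. space_mean (rad k) (v i) (x, s) - v i (x, t)) {..<N}"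
      by (rule L2_set_diff_triangle)
    also have "L2_set (\<lambda>i. space_mean (rad k) (v i) (x, s) - v i (x, t)) {..<N}
        \<le> L2_set (\<lambda>i. space_mean (rad k) (v i) (x, s) - space_mean (rad k) (v i) (x, t)) {..<N}
          + L2_set (\<lambda>i. space_mean (rad k) (v i) (x, t) - v i (x, t)) {..<N}"
      by (rule L2_set_diff_triangle)
    finally have "L2_set (\<lambda>i. v i (x, s) - v i (x, t)) {..<N} \<le> \<delta> * (A * ms) + (2 * B * mt * \<delta> + \<delta> * (A * mt))"
      using dev[OF Ps ms] dev[OF Pt mt] dr
      unfolding L2_set_diff_commute[of "\<lambda>i. v i (x, s)" "\<lambda>i. space_mean (rad k) (v i) (x, s)"] by linarith
    also have "\<dots> \<le> \<delta> * (A * ms) + (2 * B * (mt + ms) * \<delta> + \<delta> * (A * mt))"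
      using AB ms(2) \<delta>(1) by (intro add_mono mult_right_mono mult_left_mono) auto
    also have "\<dots> = (A + 2 * B) * \<delta> * (mt + ms)" by (simp add: algebra_simps)
    also have "A + 2 * B = ?c"
      by (simp add: A_def B_def oscillation_constant_def K_def K1_def algebra_simps)
    finally show ?thesis by (simp add: \<delta>_def)
  qed
  show ?thesis
  proof (intro exI[of _ P] conjI aeP allI impI)
    fix x s t ms mt
    assume x: "x \<in> ball x0 \<rho>" and I: "s \<in> {t0 - \<rho>\<^sup>2<..<t0 + \<rho>\<^sup>2}" "t \<in> {t0 - \<rho>\<^sup>2<..<t0 + \<rho>\<^sup>2}"
      and PP: "P (x, s)" "P (x, t)" and ms: "mean_bound g (x, s) ms" "0 \<le> ms" and mt: "mean_bound g (x, t) mt" "0 \<le> mt"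
    consider "s < t" | "t < s" | "s = t" by linarith
    then show "L2_set (\<lambda>i. v i (x, t) - v i (x, s)) {..<N} \<le> ?c * sqrt \<bar>t - s\<bar> * (mt + ms)"
    proof cases
      case 1
      from main[OF x PP ms mt 1 I] 1 show ?thesis
        unfolding L2_set_diff_commute[of "\<lambda>i. v i (x, t)" "\<lambda>i. v i (x, s)"] by simp
    next
      case 2
      from main[OF x PP(2,1) mt ms 2 I(2,1)] 2 show ?thesis by (simp add: add.commute)
    next
      case 3
      then show ?thesis by (simp add: L2_set_def)
    qed
  qed
qed

section \<open>The strong maximal function\<close>

text \<open>
Only the class of \<open>g\<close> modulo null sets enters the strong maximal function, so a Borel version may be used.
\<close>

lemma mean_bound_strong_maximal:
  fixes g g0 :: "(real^'n) \<times> real \<Rightarrow> real"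
  assumes g0: "integrable lborel g0" "\<And>z. 0 \<le> g0 z" and eq: "AE z in lborel. g z = g0 z"
    and m: "strong_maximal g z = ennreal m" "0 \<le> m"
  shows "mean_bound g0 z m"
  unfolding mean_bound_def
proof (intro allI impI)
  fix y :: "real^'n" and r a b :: real
  assume r: "0 < r" and ab: "a < b" and z: "z \<in> ball y r \<times> {a<..<b}"
  let ?C = "ball y r \<times> {a<..<b}" let ?\<beta> = "measure lborel (ball (0::real^'n) 1)"
  let ?I = "(LBINT \<zeta>. indicator ?C \<zeta> * g0 \<zeta>)"
  define \<mu> where "\<mu> = r ^ CARD('n) * ?\<beta> * (b - a)"
  have "0 < ?\<beta>" by (rule content_ball_pos) simp
  then have \<mu>: "0 < \<mu>" using r ab by (simp add: \<mu>_def)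
  have "emeasure lebesgue ?C = emeasure lborel ?C" by (simp add: borel_open open_Times)
  also have "\<dots> = emeasure (lborel \<Otimes>\<^sub>M lborel) ?C" unfolding lborel_prod ..
  also have "\<dots> = emeasure lborel (ball y r) * emeasure lborel {a<..<b}"
    by (rule lborel.emeasure_pair_measure_Times) auto
  also have "emeasure lborel (ball y r) = ennreal (r ^ CARD('n) * ?\<beta>)"
  proof -
    have "emeasure lborel (ball y r) = ennreal (measure lborel (ball y r))"
      using emeasure_lborel_ball_finite[of y r] by (intro emeasure_eq_ennreal_measure) auto
    also have "measure lborel (ball y r) = r ^ CARD('n) * ?\<beta>"
      using content_ball_conv_unit_ball[of r y] r by simp
    finally show ?thesis .
  qed
  also have "emeasure lborel {a<..<b} = ennreal (b - a)" using ab by simp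
  finally have meas: "emeasure lebesgue ?C = ennreal \<mu>"
    using r ab by (simp add: \<mu>_def ennreal_mult[symmetric])
  have "(\<integral>\<^sup>+\<zeta>\<in>?C. ennreal \<bar>g \<zeta>\<bar> \<partial>lebesgue) = (\<integral>\<^sup>+\<zeta>. ennreal \<bar>g \<zeta>\<bar> * indicator ?C \<zeta> \<partial>lborel)"
    by (rule nn_integral_completion)
  also have "\<dots> = (\<integral>\<^sup>+\<zeta>. ennreal (indicator ?C \<zeta> * g0 \<zeta>) \<partial>lborel)"
  proof (rule nn_integral_cong_AE)
    show "AE \<zeta> in lborel. ennreal \<bar>g \<zeta>\<bar> * indicator ?C \<zeta> = ennreal (indicator ?C \<zeta> * g0 \<zeta>)"
      using eq by eventually_elim (simp add: g0 indicator_def)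
  qed
  also have "\<dots> = ennreal ?I"
    using integrable_mult_indicator[of ?C lborel g0] g0
    by (intro nn_integral_eq_integral) (auto simp: borel_open open_Times)
  finally have num: "(\<integral>\<^sup>+\<zeta>\<in>?C. ennreal \<bar>g \<zeta>\<bar> \<partial>lebesgue) = ennreal ?I" .
  have "(\<integral>\<^sup>+\<zeta>\<in>?C. ennreal \<bar>g \<zeta>\<bar> \<partial>lebesgue) / emeasure lebesgue ?C \<le> strong_maximal g z"
    unfolding strong_maximal_def using z by (intro SUP_upper) blast
  then have "ennreal (?I / \<mu>) \<le> ennreal m"
    unfolding num meas m using \<mu> g0 by (simp add: divide_ennreal)
  then have "?I / \<mu> \<le> m" using m(2) by (simp add: ennreal_le_iff)
  then show "?I \<le> r ^ CARD('n) * ?\<beta> * (b - a) * m"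
    using \<mu> by (simp add: divide_le_eq \<mu>_def mult_ac)
qed

section \<open>From weak solutions to the oscillation estimate\<close>

lemma tnorm_measurable:
  fixes f :: "'a \<Rightarrow> nat \<Rightarrow> 'b::{real_normed_vector, second_countable_topology}"
  assumes "\<And>i. i < N \<Longrightarrow> (\<lambda>z. f z i) \<in> borel_measurable M"
  shows "(\<lambda>z. tnorm N (f z)) \<in> borel_measurable M"
proof -
  have "(\<lambda>z. \<Sum>i<N. (norm (f z i))\<^sup>2) \<in> borel_measurable M"
    using assms by (intro borel_measurable_sum borel_measurable_power borel_measurable_norm) auto
  then show ?thesis
    unfolding tnorm_def L2_set_def by measurable
qed

lemma norm_le_tnorm: "i < N \<Longrightarrow> norm (v i) \<le> tnorm N v"
  unfolding tnorm_def by (rule member_le_L2_set) auto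

lemma tnorm_nonneg: "0 \<le> tnorm N v"
  by (simp add: tnorm_def)

lemma tnorm_diff_le:
  fixes v w :: "nat \<Rightarrow> 'b::real_normed_vector"
  shows "tnorm N (\<lambda>i. v i - w i) \<le> tnorm N v + tnorm N w"
proof -
  have "tnorm N (\<lambda>i. v i - w i) \<le> L2_set (\<lambda>i. norm (v i) + norm (w i)) {..<N}"
    unfolding tnorm_def by (intro L2_set_mono norm_triangle_ineq4) auto
  also have "\<dots> \<le> tnorm N v + tnorm N w" unfolding tnorm_def by (rule L2_set_triangle_ineq)
  finally show ?thesis .
qed

lemma oscillation_constant_pos: "0 \<le> \<Lambda> \<Longrightarrow> 0 < oscillation_constant TYPE('n::finite) \<Lambda>"
proof -
  assume \<Lambda>: "0 \<le> \<Lambda>"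
  have 1: "0 < measure lborel (ball (0::real^'n) 1)" by (rule content_ball_pos) simp
  have 2: "0 < bump_mass TYPE(real^'n)" "0 < bump_mass TYPE(real)" by (rule bump_mass_pos)+
  show ?thesis
    unfolding oscillation_constant_def using 1 2 \<Lambda>
    by (intro mult_pos_pos add_pos_nonneg) auto
qed

text \<open>
The closure of the cylinder is the product of the closed ball and the closed interval.
\<close>

lemma par_cylinder_compactly_in:
  fixes x0 :: "real^'n"
  assumes R: "0 < R" and c: "compactly_in (par_cylinder x0 t0 R) (space_time \<Omega> T)"
  shows "compactly_in (ball x0 R) \<Omega>" "0 < t0 - R\<^sup>2" "t0 + R\<^sup>2 < T"
    "compact (cball x0 R \<times> {t0 - R\<^sup>2..t0 + R\<^sup>2})" "cball x0 R \<times> {t0 - R\<^sup>2..t0 + R\<^sup>2} \<subseteq> space_time \<Omega> T"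
proof -
  have cl: "closure (par_cylinder x0 t0 R) = cball x0 R \<times> {t0 - R\<^sup>2..t0 + R\<^sup>2}"
    using R by (simp add: par_cylinder_def closure_Times)
  then have sub: "cball x0 R \<times> {t0 - R\<^sup>2..t0 + R\<^sup>2} \<subseteq> space_time \<Omega> T"
    using c by (simp add: compactly_in_def)
  then show "cball x0 R \<times> {t0 - R\<^sup>2..t0 + R\<^sup>2} \<subseteq> space_time \<Omega> T" .
  have "(x0, t0 - R\<^sup>2) \<in> space_time \<Omega> T" "(x0, t0 + R\<^sup>2) \<in> space_time \<Omega> T"
    using sub R by (auto intro!: subsetD[OF sub])
  then show "0 < t0 - R\<^sup>2" "t0 + R\<^sup>2 < T" by (auto simp: space_time_def)
  have "cball x0 R \<subseteq> \<Omega>"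
  proof
    fix x assume "x \<in> cball x0 R"
    then have "(x, t0) \<in> space_time \<Omega> T" using R by (intro subsetD[OF sub]) auto
    then show "x \<in> \<Omega>" by (simp add: space_time_def)
  qed
  then show "compactly_in (ball x0 R) \<Omega>" using R by (simp add: compactly_in_def)
  show "compact (cball x0 R \<times> {t0 - R\<^sup>2..t0 + R\<^sup>2})" by (intro compact_Times) auto
qed

text \<open>
For \<open>t \<in> J\<close> the Borel versions agree with \<open>u\<close> and its gradient almost everywhere on the slice, by Fubini; for
\<open>t \<notin> J\<close> all functions in the weak gradient identity vanish.
\<close>

lemma good_slices_of_weak_gradient:
  fixes u :: "(real^'n) \<times> real \<Rightarrow> nat \<Rightarrow> real" and Du :: "(real^'n) \<times> real \<Rightarrow> nat \<Rightarrow> real^'n"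
  assumes W: "AE t in lebesgue. t \<in> J \<longrightarrow> W11_with_grad N U (\<lambda>x. u (x, t)) (\<lambda>x. Du (x, t))"
    and bv: "\<And>i. i < N \<Longrightarrow> borel_version (U \<times> J) (\<lambda>z. u z i) (v i)" "\<And>i. i < N \<Longrightarrow> borel_version (U \<times> J) (\<lambda>z. Du z i) (G i)"
    and g: "integrable lborel g" "AE z in lborel. L2_set (\<lambda>i. norm (G i z)) {..<N} \<le> g z"
  shows "AE t in lborel. good_slice N U v G g t"
proof -
  note v = borel_versionD[OF bv(1)] and G = borel_versionD[OF bv(2)]
  have W': "AE t in lborel. t \<in> J \<longrightarrow> W11_with_grad N U (\<lambda>x. u (x, t)) (\<lambda>x. Du (x, t))"
    using W by (simp only: AE_completion_iff)
  have ae: "AE t in lborel. \<forall>i\<in>{..<N}. integrable lborel (\<lambda>y. v i (y, t)) \<and> integrable lborel (\<lambda>y. G i (y, t)) \<and>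
      (AE y in lborel. (y, t) \<in> U \<times> J \<longrightarrow> v i (y, t) = u (y, t) i) \<and> (AE y in lborel. (y, t) \<in> U \<times> J \<longrightarrow> G i (y, t) = Du (y, t) i)"
  proof (rule AE_finite_allI)
    fix i assume "i \<in> {..<N}"
    then have i: "i < N" by simp
    show "AE t in lborel. integrable lborel (\<lambda>y. v i (y, t)) \<and> integrable lborel (\<lambda>y. G i (y, t)) \<and>
      (AE y in lborel. (y, t) \<in> U \<times> J \<longrightarrow> v i (y, t) = u (y, t) i) \<and> (AE y in lborel. (y, t) \<in> U \<times> J \<longrightarrow> G i (y, t) = Du (y, t) i)"
      using integrable_time_slice[OF v(1)[OF i]] integrable_time_slice[OF G(1)[OF i]]
        AE_lborel_time_slice[OF v(3)[OF i]] AE_lborel_time_slice[OF G(3)[OF i]]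
      by eventually_elim blast
  qed simp
  from W' ae integrable_time_slice[OF g(1)] AE_lborel_time_slice[OF g(2)] show ?thesis
  proof eventually_elim
    fix t
    assume w: "t \<in> J \<longrightarrow> W11_with_grad N U (\<lambda>x. u (x, t)) (\<lambda>x. Du (x, t))"
      and i: "\<forall>i\<in>{..<N}. integrable lborel (\<lambda>y. v i (y, t)) \<and> integrable lborel (\<lambda>y. G i (y, t)) \<and>
      (AE y in lborel. (y, t) \<in> U \<times> J \<longrightarrow> v i (y, t) = u (y, t) i) \<and> (AE y in lborel. (y, t) \<in> U \<times> J \<longrightarrow> G i (y, t) = Du (y, t) i)"
      and gi: "integrable lborel (\<lambda>y. g (y, t))" "AE y in lborel. L2_set (\<lambda>i. norm (G i (y, t))) {..<N} \<le> g (y, t)"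
    have "(LBINT y. v i (y, t) *\<^sub>R grad \<psi> y) = - (LBINT y. \<psi> y *\<^sub>R G i (y, t))"
      if iN: "i < N" and \<psi>: "\<psi> \<in> test_functions U" for i \<psi>
    proof (cases "t \<in> J")
      case True
      note [measurable] = test_function_measurable(1,2)[OF \<psi>]
      have [measurable]: "(\<lambda>y. v i (y, t)) \<in> borel_measurable borel" "(\<lambda>y. G i (y, t)) \<in> borel_measurable borel"
        using borel_measurable_integrable[of lborel "\<lambda>y. v i (y, t)"]
          borel_measurable_integrable[of lborel "\<lambda>y. G i (y, t)"] i iN by auto
      have 1: "AE y in lborel. indicator U y *\<^sub>R (u (y, t) i *\<^sub>R grad \<psi> y) = v i (y, t) *\<^sub>R grad \<psi> y"
      proof -
        have "AE y in lborel. (y, t) \<in> U \<times> J \<longrightarrow> v i (y, t) = u (y, t) i" using i iN by simp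
        then show ?thesis
        proof eventually_elim
          fix y assume "(y, t) \<in> U \<times> J \<longrightarrow> v i (y, t) = u (y, t) i"
          then show "indicator U y *\<^sub>R (u (y, t) i *\<^sub>R grad \<psi> y) = v i (y, t) *\<^sub>R grad \<psi> y"
            using True v(2)[OF iN, of "(y, t)"] by (cases "y \<in> U") auto
        qed
      qed
      have 2: "AE y in lborel. indicator U y *\<^sub>R (\<psi> y *\<^sub>R Du (y, t) i) = \<psi> y *\<^sub>R G i (y, t)"
      proof -
        have "AE y in lborel. (y, t) \<in> U \<times> J \<longrightarrow> G i (y, t) = Du (y, t) i" using i iN by simp
        then show ?thesis
        proof eventually_elim
          fix y assume "(y, t) \<in> U \<times> J \<longrightarrow> G i (y, t) = Du (y, t) i"
          then show "indicator U y *\<^sub>R (\<psi> y *\<^sub>R Du (y, t) i) = \<psi> y *\<^sub>R G i (y, t)"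
            using True G(2)[OF iN, of "(y, t)"] by (cases "y \<in> U") auto
        qed
      qed
      have "(LINT x:U|lebesgue. u (x, t) i *\<^sub>R grad \<psi> x) = - (LINT x:U|lebesgue. \<psi> x *\<^sub>R Du (x, t) i)"
        using w True iN \<psi> unfolding W11_with_grad_def by blast
      moreover have "(LINT x:U|lebesgue. u (x, t) i *\<^sub>R grad \<psi> x) = (LBINT y. v i (y, t) *\<^sub>R grad \<psi> y)"
        unfolding set_lebesgue_integral_def by (rule lebesgue_integral_eq_borel[OF _ 1]) measurable
      moreover have "(LINT x:U|lebesgue. \<psi> x *\<^sub>R Du (x, t) i) = (LBINT y. \<psi> y *\<^sub>R G i (y, t))"
        unfolding set_lebesgue_integral_def by (rule lebesgue_integral_eq_borel[OF _ 2]) measurable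
      ultimately show ?thesis by simp
    next
      case False
      then show ?thesis using v(2)[OF iN] G(2)[OF iN] by simp
    qed
    then show "good_slice N U v G g t"
      using i gi unfolding good_slice_def by auto
  qed
qed

text \<open>
All data are replaced by Borel versions on the doubled cylinder. The structure condition bounds the flux
\<open>A(z, \<nabla>u) - F\<close> by \<open>(1 + |L|) g\<close>, which brings the situation into the form of \<open>oscillation_estimate\<close>.
\<close>

lemma weak_solution_oscillation:
  fixes u :: "(real^'n) \<times> real \<Rightarrow> nat \<Rightarrow> real" and Du F :: "(real^'n) \<times> real \<Rightarrow> nat \<Rightarrow> real^'n"
  assumes \<Omega>: "open \<Omega>" and car: "caratheodory N (space_time \<Omega> T) A"
    and str: "structure_conditions N (space_time \<Omega> T) \<nu> L A" and Fm: "measurable_field N (space_time \<Omega> T) F"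
    and Fi: "L1loc (space_time \<Omega> T) (\<lambda>z. tnorm N (F z))" and u: "L1loc_W11loc_with_grad N \<Omega> T u Du"
    and ws: "weak_solution N \<Omega> T A F u Du"
    and \<rho>: "0 < \<rho>" and Q: "compactly_in (par_cylinder x0 t0 (2 * \<rho>)) (space_time \<Omega> T)"
  defines "g \<equiv> \<lambda>z. (tnorm N (Du z) + tnorm N (F z)) * indicator (par_cylinder x0 t0 (2 * \<rho>)) z"
  shows "AE (x, t, s) in lebesgue.
      x \<in> ball x0 \<rho> \<and> t \<in> {t0 - \<rho>\<^sup>2<..<t0 + \<rho>\<^sup>2} \<and> s \<in> {t0 - \<rho>\<^sup>2<..<t0 + \<rho>\<^sup>2} \<longrightarrow>
      ennreal (tnorm N (\<lambda>i. u (x, t) i - u (x, s) i) / sqrt \<bar>t - s\<bar>)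
        \<le> ennreal (oscillation_constant TYPE('n) (1 + \<bar>L\<bar>)) * (strong_maximal g (x, t) + strong_maximal g (x, s))"
proof -
  let ?S = "space_time \<Omega> T" let ?R = "2 * \<rho>"
  let ?U = "ball x0 ?R" let ?J = "{t0 - ?R\<^sup>2<..<t0 + ?R\<^sup>2}" let ?V = "par_cylinder x0 t0 ?R"
  have R: "0 < ?R" using \<rho> by simp
  note Qc = par_cylinder_compactly_in[OF R Q]
  have V_eq: "?V = ?U \<times> ?J" by (simp add: par_cylinder_def)
  have V_open: "open ?V" unfolding V_eq by (intro open_Times) auto
  have Vb: "?V \<in> sets borel" using V_open by simp
  have V_K: "?V \<subseteq> cball x0 ?R \<times> {t0 - ?R\<^sup>2..t0 + ?R\<^sup>2}" unfolding V_eq by auto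
  have VS: "?V \<subseteq> ?S" using V_K Qc(5) by (rule subset_trans)
  have S: "?S \<in> sets lebesgue"
    unfolding space_time_def
    by (rule sets_completionI_sets) (simp add: borel_open[OF open_Times[OF \<Omega> open_greaterThanLessThan]])
  have t12: "t0 - ?R\<^sup>2 < t0 + ?R\<^sup>2" using R by simp
  have um: "\<And>i. i < N \<Longrightarrow> (\<lambda>z. u z i) \<in> borel_measurable (lebesgue_on ?S)"
      "\<And>i. i < N \<Longrightarrow> (\<lambda>z. Du z i) \<in> borel_measurable (lebesgue_on ?S)"
    and ut: "\<And>z. z \<in> ?S \<Longrightarrow> Du z \<in> tuples N"
    using u unfolding L1loc_W11loc_with_grad_def by auto
  have W: "AE t in lebesgue. t \<in> ?J \<longrightarrow> W11_with_grad N ?U (\<lambda>x. u (x, t)) (\<lambda>x. Du (x, t))"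
    and wi: "set_integrable lebesgue ?V (\<lambda>z. tnorm N (u z) + tnorm N (Du z))"
  proof -
    have "\<forall>U t1 t2. open U \<and> compactly_in U \<Omega> \<and> 0 < t1 \<and> t1 < t2 \<and> t2 < T \<longrightarrow>
        (AE t in lebesgue. t \<in> {t1<..<t2} \<longrightarrow> W11_with_grad N U (\<lambda>x. u (x, t)) (\<lambda>x. Du (x, t))) \<and>
        set_integrable lebesgue (U \<times> {t1<..<t2}) (\<lambda>z. tnorm N (u z) + tnorm N (Du z))"
      using u unfolding L1loc_W11loc_with_grad_def by (elim conjE)
    from this[rule_format, of ?U "t0 - ?R\<^sup>2" "t0 + ?R\<^sup>2"] Qc(1,2,3) t12
    show "AE t in lebesgue. t \<in> ?J \<longrightarrow> W11_with_grad N ?U (\<lambda>x. u (x, t)) (\<lambda>x. Du (x, t))"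
      "set_integrable lebesgue ?V (\<lambda>z. tnorm N (u z) + tnorm N (Du z))"
      unfolding V_eq by (simp_all only: open_ball simp_thms)
  qed
  have Fint: "set_integrable lebesgue ?V (\<lambda>z. tnorm N (F z))"
  proof (rule set_integrable_subset)
    show "set_integrable lebesgue (cball x0 ?R \<times> {t0 - ?R\<^sup>2..t0 + ?R\<^sup>2}) (\<lambda>z. tnorm N (F z))"
      using Fi Qc(4,5) unfolding L1loc_def by blast
  qed (use V_K Vb in \<open>auto simp: sets_completionI_sets\<close>)
  have FM: "\<And>i. i < N \<Longrightarrow> (\<lambda>z. F z i) \<in> borel_measurable (lebesgue_on ?S)"
    using Fm unfolding measurable_field_def by auto
  have AM: "\<And>i. i < N \<Longrightarrow> (\<lambda>z. A z (Du z) i) \<in> borel_measurable (lebesgue_on ?S)"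
    by (rule caratheodory_composite_measurable[OF car S ut um(2)])
  have wi2: "set_integrable lebesgue ?V (\<lambda>z. \<bar>L\<bar> * (tnorm N (u z) + tnorm N (Du z)))"
    using wi by simp
  have wF: "set_integrable lebesgue ?V (\<lambda>z. (tnorm N (u z) + tnorm N (Du z)) + tnorm N (F z))"
    using wi Fint by (rule set_integral_add)
  have Ab: "AE z in lebesgue. z \<in> ?V \<longrightarrow> tnorm N (A z (Du z)) \<le> \<bar>L\<bar> * tnorm N (Du z)"
    using str unfolding structure_conditions_def
  proof eventually_elim
    fix z assume z: "z \<in> ?S \<longrightarrow> (\<forall>\<xi>\<in>tuples N. \<nu> * (tnorm N \<xi>)\<^sup>2 \<le> tinner N (A z \<xi>) \<xi> \<and> tnorm N (A z \<xi>) \<le> L * tnorm N \<xi>)"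
    show "z \<in> ?V \<longrightarrow> tnorm N (A z (Du z)) \<le> \<bar>L\<bar> * tnorm N (Du z)"
    proof
      assume "z \<in> ?V"
      then have "z \<in> ?S" using VS by blast
      then have "tnorm N (A z (Du z)) \<le> L * tnorm N (Du z)" using z ut by blast
      also have "\<dots> \<le> \<bar>L\<bar> * tnorm N (Du z)" by (intro mult_right_mono) (auto simp: tnorm_nonneg)
      finally show "tnorm N (A z (Du z)) \<le> \<bar>L\<bar> * tnorm N (Du z)" .
    qed
  qed
  obtain v where "\<forall>i<N. borel_version ?V (\<lambda>z. u z i) (v i)"
  proof (rule exE[OF borel_version_choice])
    fix i assume i: "i < N"
    show "\<exists>h. borel_version ?V (\<lambda>z. u z i) h"
    proof (rule borel_version_real[OF S um(1)[OF i] Vb VS wi], intro AE_I2 impI)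
      fix z
      show "\<bar>u z i\<bar> \<le> tnorm N (u z) + tnorm N (Du z)"
        using norm_le_tnorm[OF i, of "u z"] tnorm_nonneg[of N "Du z"] by simp
    qed
  qed
  note bv = this[rule_format] and v = borel_versionD[OF this[rule_format]]
  obtain G where "\<forall>i<N. borel_version ?V (\<lambda>z. Du z i) (G i)"
  proof (rule exE[OF borel_version_choice])
    fix i assume i: "i < N"
    show "\<exists>h. borel_version ?V (\<lambda>z. Du z i) h"
    proof (rule borel_version_vec[OF S um(2)[OF i] Vb VS wi], intro AE_I2 impI)
      fix z
      show "norm (Du z i) \<le> tnorm N (u z) + tnorm N (Du z)"
        using norm_le_tnorm[OF i, of "Du z"] tnorm_nonneg[of N "u z"] by simp
    qed
  qed
  note bG = this[rule_format] and G = borel_versionD[OF this[rule_format]]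
  obtain At where "\<forall>i<N. borel_version ?V (\<lambda>z. A z (Du z) i) (At i)"
  proof (rule exE[OF borel_version_choice])
    fix i assume i: "i < N"
    show "\<exists>h. borel_version ?V (\<lambda>z. A z (Du z) i) h"
    proof (rule borel_version_vec[OF S AM[OF i] Vb VS wi2])
      show "AE z in lebesgue. z \<in> ?V \<longrightarrow> norm (A z (Du z) i) \<le> \<bar>L\<bar> * (tnorm N (u z) + tnorm N (Du z))"
        using Ab
      proof (eventually_elim, intro impI)
        fix z assume z: "z \<in> ?V \<longrightarrow> tnorm N (A z (Du z)) \<le> \<bar>L\<bar> * tnorm N (Du z)" "z \<in> ?V"
        have "norm (A z (Du z) i) \<le> tnorm N (A z (Du z))" by (rule norm_le_tnorm[OF i])
        also have "\<dots> \<le> \<bar>L\<bar> * tnorm N (Du z)" using z by blast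
        also have "\<dots> \<le> \<bar>L\<bar> * (tnorm N (u z) + tnorm N (Du z))"
          by (intro mult_left_mono) (auto simp: tnorm_nonneg)
        finally show "norm (A z (Du z) i) \<le> \<bar>L\<bar> * (tnorm N (u z) + tnorm N (Du z))" .
      qed
    qed
  qed
  note bA = this[rule_format] and At = borel_versionD[OF this[rule_format]]
  obtain Ft where "\<forall>i<N. borel_version ?V (\<lambda>z. F z i) (Ft i)"
  proof (rule exE[OF borel_version_choice])
    fix i assume i: "i < N"
    show "\<exists>h. borel_version ?V (\<lambda>z. F z i) h"
      by (rule borel_version_vec[OF S FM[OF i] Vb VS Fint]) (simp add: norm_le_tnorm[OF i])
  qed
  note bF = this[rule_format] and Ft = borel_versionD[OF this[rule_format]]
  obtain g1 where "borel_version ?V (\<lambda>z. tnorm N (Du z) + tnorm N (F z)) g1"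
  proof (rule exE[OF borel_version_real[OF S _ Vb VS wF]])
    show "(\<lambda>z. tnorm N (Du z) + tnorm N (F z)) \<in> borel_measurable (lebesgue_on ?S)"
      by (intro borel_measurable_add tnorm_measurable um FM)
    show "AE z in lebesgue. z \<in> ?V \<longrightarrow> \<bar>tnorm N (Du z) + tnorm N (F z)\<bar> \<le> tnorm N (u z) + tnorm N (Du z) + tnorm N (F z)"
      by (intro AE_I2) (simp add: tnorm_nonneg abs_of_nonneg)
  qed
  note g1 = borel_versionD[OF this]
  \<comment> \<open>The absolute value makes the Borel version of \<open>g\<close> nonnegative everywhere.\<close>
  define g0 where "g0 = (\<lambda>z. \<bar>g1 z\<bar>)"
  have g0: "integrable lborel g0" "\<And>z. 0 \<le> g0 z" using g1(1) by (simp_all add: g0_def)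
  have geq: "AE z in lborel. g z = g0 z"
    using g1(3)
  proof eventually_elim
    fix z assume "z \<in> ?V \<longrightarrow> g1 z = tnorm N (Du z) + tnorm N (F z)"
    then show "g z = g0 z"
      using g1(2)[of z] by (cases "z \<in> ?V") (auto simp: g_def g0_def tnorm_nonneg abs_of_nonneg)
  qed
  define H where "H = (\<lambda>i z. At i z - Ft i z)"
  have HI: "integrable lborel (H i)" if "i < N" for i using At(1)[OF that] Ft(1)[OF that] by (simp add: H_def)
  have all_eq: "AE z in lborel. \<forall>i\<in>{..<N}. z \<in> ?V \<longrightarrow> v i z = u z i \<and> G i z = Du z i \<and> At i z = A z (Du z) i \<and> Ft i z = F z i"
  proof (rule AE_finite_allI)
    fix i assume "i \<in> {..<N}"
    then have i: "i < N" by simp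
    show "AE z in lborel. z \<in> ?V \<longrightarrow> v i z = u z i \<and> G i z = Du z i \<and> At i z = A z (Du z) i \<and> Ft i z = F z i"
      using v(3)[OF i] G(3)[OF i] At(3)[OF i] Ft(3)[OF i] by eventually_elim blast
  qed simp
  have Ab': "AE z in lborel. z \<in> ?V \<longrightarrow> tnorm N (A z (Du z)) \<le> \<bar>L\<bar> * tnorm N (Du z)"
    using Ab by (simp only: AE_completion_iff)
  have Hg: "AE z in lborel. L2_set (\<lambda>i. norm (H i z)) {..<N} \<le> (1 + \<bar>L\<bar>) * g0 z"
    using all_eq Ab' geq
  proof eventually_elim
    fix z assume z: "\<forall>i\<in>{..<N}. z \<in> ?V \<longrightarrow> v i z = u z i \<and> G i z = Du z i \<and> At i z = A z (Du z) i \<and> Ft i z = F z i"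
      and a: "z \<in> ?V \<longrightarrow> tnorm N (A z (Du z)) \<le> \<bar>L\<bar> * tnorm N (Du z)" and gz: "g z = g0 z"
    show "L2_set (\<lambda>i. norm (H i z)) {..<N} \<le> (1 + \<bar>L\<bar>) * g0 z"
    proof (cases "z \<in> ?V")
      case True
      have "L2_set (\<lambda>i. norm (H i z)) {..<N} = tnorm N (\<lambda>i. A z (Du z) i - F z i)"
        unfolding tnorm_def using z True by (intro L2_set_cong) (auto simp: H_def)
      also have "\<dots> \<le> tnorm N (A z (Du z)) + tnorm N (F z)" by (rule tnorm_diff_le)
      also have "\<dots> \<le> \<bar>L\<bar> * tnorm N (Du z) + tnorm N (F z)" using a True by simp
      also have "\<dots> \<le> (1 + \<bar>L\<bar>) * tnorm N (Du z) + (1 + \<bar>L\<bar>) * tnorm N (F z)"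
        by (intro add_mono) (simp_all add: distrib_right tnorm_nonneg)
      also have "\<dots> = (1 + \<bar>L\<bar>) * g z" using True by (simp add: g_def distrib_left)
      finally show ?thesis by (simp add: gz)
    next
      case False
      then have "L2_set (\<lambda>i. norm (H i z)) {..<N} = 0"
        using At(2) Ft(2) by (intro L2_set_0') (auto simp: H_def)
      then show ?thesis using g0(2)[of z] by simp
    qed
  qed
  have Gg: "AE z in lborel. L2_set (\<lambda>i. norm (G i z)) {..<N} \<le> g0 z"
    using all_eq geq
  proof eventually_elim
    fix z assume z: "\<forall>i\<in>{..<N}. z \<in> ?V \<longrightarrow> v i z = u z i \<and> G i z = Du z i \<and> At i z = A z (Du z) i \<and> Ft i z = F z i"
      and gz: "g z = g0 z"
    show "L2_set (\<lambda>i. norm (G i z)) {..<N} \<le> g0 z"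
    proof (cases "z \<in> ?V")
      case True
      have "L2_set (\<lambda>i. norm (G i z)) {..<N} = tnorm N (Du z)"
        unfolding tnorm_def using z True by (intro L2_set_cong) auto
      also have "\<dots> \<le> g z" using True by (simp add: g_def tnorm_nonneg)
      finally show ?thesis by (simp add: gz)
    next
      case False
      then have "L2_set (\<lambda>i. norm (G i z)) {..<N} = 0" using G(2) by (intro L2_set_0') auto
      then show ?thesis using g0(2)[of z] by simp
    qed
  qed
  have slices: "AE t in lborel. good_slice N ?U v G g0 t"
    by (rule good_slices_of_weak_gradient[OF W bv[unfolded V_eq] bG[unfolded V_eq] g0(1) Gg])
  have eqn: "(LBINT z. (\<Sum>i<N. a i * v i z) * (moll (rescale x r (fst z)) * bump_in_time_deriv s t h (snd z)))
      = (LBINT z. (\<Sum>i<N. a i *\<^sub>R H i z) \<bullet> tested_gradient x r s t h z)"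
    if "0 < r" "0 < h" "s < t" "cball x r \<times> {s - h..t + h} \<subseteq> ?V" for a x r s t h
    unfolding H_def by (rule weak_solution_tested[OF ws VS bv bA bF that])
  let ?c = "oscillation_constant TYPE('n) (1 + \<bar>L\<bar>)"
  have cpos: "0 < ?c" by (rule oscillation_constant_pos) simp
  have L0: "0 \<le> 1 + \<bar>L\<bar>" by simp
  obtain P where "(AE z in lborel. P z) \<and>
    (\<forall>x s t ms mt. x \<in> ball x0 \<rho> \<longrightarrow> s \<in> {t0 - \<rho>\<^sup>2<..<t0 + \<rho>\<^sup>2} \<longrightarrow> t \<in> {t0 - \<rho>\<^sup>2<..<t0 + \<rho>\<^sup>2} \<longrightarrow>
      P (x, s) \<longrightarrow> P (x, t) \<longrightarrow> mean_bound g0 (x, s) ms \<longrightarrow> 0 \<le> ms \<longrightarrow> mean_bound g0 (x, t) mt \<longrightarrow> 0 \<le> mt \<longrightarrow>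
      L2_set (\<lambda>i. v i (x, t) - v i (x, s)) {..<N} \<le> ?c * sqrt \<bar>t - s\<bar> * (mt + ms))"
    by (rule exE[OF oscillation_estimate[OF \<rho> L0 v(1) HI g0 Hg slices]]) (assumption | rule eqn)+
  note P = conjunct1[OF this] conjunct2[OF this, rule_format]
  have "AE z in lborel. P z \<and> (\<forall>i\<in>{..<N}. z \<in> ?V \<longrightarrow> v i z = u z i)"
    using P(1) all_eq by eventually_elim blast
  then have "AE w in (lborel :: ((real^'n) \<times> real \<times> real) measure).
      (P (fst w, fst (snd w)) \<and> (\<forall>i\<in>{..<N}. (fst w, fst (snd w)) \<in> ?V \<longrightarrow> v i (fst w, fst (snd w)) = u (fst w, fst (snd w)) i)) \<and>
      (P (fst w, snd (snd w)) \<and> (\<forall>i\<in>{..<N}. (fst w, snd (snd w)) \<in> ?V \<longrightarrow> v i (fst w, snd (snd w)) = u (fst w, snd (snd w)) i))"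
    by (rule AE_lborel_two_times)
  then have "AE (x, t, s) in lborel.
      x \<in> ball x0 \<rho> \<and> t \<in> {t0 - \<rho>\<^sup>2<..<t0 + \<rho>\<^sup>2} \<and> s \<in> {t0 - \<rho>\<^sup>2<..<t0 + \<rho>\<^sup>2} \<longrightarrow>
      ennreal (tnorm N (\<lambda>i. u (x, t) i - u (x, s) i) / sqrt \<bar>t - s\<bar>)
        \<le> ennreal ?c * (strong_maximal g (x, t) + strong_maximal g (x, s))"
  proof (eventually_elim, clarify)
    fix x t s
    assume Pt: "P (fst (x, t, s), fst (snd (x, t, s)))" and Ps: "P (fst (x, t, s), snd (snd (x, t, s)))"
      and vt: "\<forall>i\<in>{..<N}. (fst (x, t, s), fst (snd (x, t, s))) \<in> ?V \<longrightarrow> v i (fst (x, t, s), fst (snd (x, t, s))) = u (fst (x, t, s), fst (snd (x, t, s))) i"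
      and vs: "\<forall>i\<in>{..<N}. (fst (x, t, s), snd (snd (x, t, s))) \<in> ?V \<longrightarrow> v i (fst (x, t, s), snd (snd (x, t, s))) = u (fst (x, t, s), snd (snd (x, t, s))) i"
      and x: "x \<in> ball x0 \<rho>" and t: "t \<in> {t0 - \<rho>\<^sup>2<..<t0 + \<rho>\<^sup>2}" and s: "s \<in> {t0 - \<rho>\<^sup>2<..<t0 + \<rho>\<^sup>2}"
    have sq: "\<rho>\<^sup>2 \<le> ?R\<^sup>2" using \<rho> by (intro power_mono) auto
    have inV: "(x, t) \<in> ?V" "(x, s) \<in> ?V"
      using x t s sq \<rho> unfolding V_eq by auto
    have tn: "tnorm N (\<lambda>i. u (x, t) i - u (x, s) i) = L2_set (\<lambda>i. v i (x, t) - v i (x, s)) {..<N}"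
    proof -
      have "v i (x, t) = u (x, t) i" "v i (x, s) = u (x, s) i" if "i < N" for i
        using vt vs inV that by simp_all
      then have "tnorm N (\<lambda>i. u (x, t) i - u (x, s) i) = L2_set (\<lambda>i. norm (v i (x, t) - v i (x, s))) {..<N}"
        unfolding tnorm_def by (intro L2_set_cong) simp_all
      then show ?thesis by (simp add: L2_set_def)
    qed
    show "ennreal (tnorm N (\<lambda>i. u (x, t) i - u (x, s) i) / sqrt \<bar>t - s\<bar>)
        \<le> ennreal ?c * (strong_maximal g (x, t) + strong_maximal g (x, s))"
    proof (cases "strong_maximal g (x, t) = top \<or> strong_maximal g (x, s) = top")
      case True
      then have "ennreal ?c * (strong_maximal g (x, t) + strong_maximal g (x, s)) = top"
        using cpos by (auto simp: ennreal_mult_top ennreal_top_mult)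
      then show ?thesis by simp
    next
      case False
      define mt where "mt = enn2real (strong_maximal g (x, t))"
      define ms where "ms = enn2real (strong_maximal g (x, s))"
      have mt: "strong_maximal g (x, t) = ennreal mt" "0 \<le> mt" using False by (auto simp: mt_def less_top intro!: ennreal_enn2real[symmetric])
      have ms: "strong_maximal g (x, s) = ennreal ms" "0 \<le> ms" using False by (auto simp: ms_def less_top intro!: ennreal_enn2real[symmetric])
      have "L2_set (\<lambda>i. v i (x, t) - v i (x, s)) {..<N} \<le> ?c * sqrt \<bar>t - s\<bar> * (mt + ms)"
        using Pt Ps by (intro P(2)[OF x s t _ _ mean_bound_strong_maximal[OF g0 geq ms] ms(2)
              mean_bound_strong_maximal[OF g0 geq mt] mt(2)]) simp_all
      then have "tnorm N (\<lambda>i. u (x, t) i - u (x, s) i) / sqrt \<bar>t - s\<bar> \<le> ?c * (mt + ms)"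
        unfolding tn using cpos mt(2) ms(2) by (cases "t = s") (auto simp: divide_le_eq mult_ac)
      then have "ennreal (tnorm N (\<lambda>i. u (x, t) i - u (x, s) i) / sqrt \<bar>t - s\<bar>) \<le> ennreal (?c * (mt + ms))"
        by (rule ennreal_leI)
      also have "\<dots> = ennreal ?c * (strong_maximal g (x, t) + strong_maximal g (x, s))"
        using cpos mt ms by (simp add: ennreal_mult ennreal_plus)
      finally show ?thesis .
    qed
  qed
  then show ?thesis by (simp only: AE_completion_iff)
qed

theorem lemma5p1:
  fixes L :: real
  shows "\<exists>c>0. \<forall>(N::nat) (\<Omega>::(real^'n) set) (T::real) (\<nu>::real) A F u Du.
    1 \<le> N \<and> open \<Omega> \<and> connected \<Omega> \<and> bounded \<Omega> \<and> 0 < T \<and> 0 < \<nu> \<and> \<nu> < L \<and>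
    caratheodory N (space_time \<Omega> T) A \<and>
    structure_conditions N (space_time \<Omega> T) \<nu> L A \<and>
    measurable_field N (space_time \<Omega> T) F \<and>
    L1loc (space_time \<Omega> T) (\<lambda>z. tnorm N (F z)) \<and>
    L1loc_W11loc_with_grad N \<Omega> T u Du \<and>
    weak_solution N \<Omega> T A F u Du
    \<longrightarrow>
    (\<forall>x0 t0 \<rho>. 0 < \<rho> \<and> compactly_in (par_cylinder x0 t0 (2 * \<rho>)) (space_time \<Omega> T) \<longrightarrow>
      (let g = (\<lambda>z. (tnorm N (Du z) + tnorm N (F z)) * indicator (par_cylinder x0 t0 (2 * \<rho>)) z)
       in AE (x, t, s) in lebesgue.
            x \<in> ball x0 \<rho> \<and> t \<in> {t0 - \<rho>\<^sup>2<..<t0 + \<rho>\<^sup>2} \<and> s \<in> {t0 - \<rho>\<^sup>2<..<t0 + \<rho>\<^sup>2} \<longrightarrow>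
            ennreal (tnorm N (\<lambda>i. u (x, t) i - u (x, s) i) / sqrt \<bar>t - s\<bar>)
              \<le> ennreal c * (strong_maximal g (x, t) + strong_maximal g (x, s))))"
proof (rule exI[of _ "oscillation_constant TYPE('n) (1 + \<bar>L\<bar>)"], intro conjI allI impI)
  show "0 < oscillation_constant TYPE('n) (1 + \<bar>L\<bar>)" by (rule oscillation_constant_pos) simp
qed (unfold Let_def, elim conjE, rule weak_solution_oscillation)

end
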